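(* Let $f\in\mathcal{O}(\mathbb{C}^n)$ be an entire function and let $A=\{z\in\mathbb{C}^n:f(z)=0\}$. Then $(\mathbb{C}^n\setminus A)\times\mathbb{C}$ admits a holomorphic Stein and Runge embedding in $\mathbb{C}^{n+1}$.
   Context: A holomorphic Stein and Runge embedding of an $N$-dimensional complex manifold $Y$ in an $N$-dimensional complex manifold $W$ is an injective holomorphic map $\Phi:Y\to W$ such that $\Phi(Y)$ is Stein and $\Phi(Y)$ is Runge in $W$, i.e. every holomorphic function on $\Phi(Y)$ can be approximated, locally uniformly on $\Phi(Y)$, by restrictions of holomorphic functions on $W$. *)

theory Defs
  imports "HOL-Analysis.Analysis"
begin

text \<open>
  Complex manifolds occurring here are open subsets of complex Euclidean space
  \<^typ>\<open>complex^'n\<close>. On an open set, a function of several complex variables is holomorphic iff it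
  has a complex-linear Frechet derivative at every point; \<^const>\<open>has_derivative\<close> by itself only
  provides real-linearity.
\<close>

definition holomorphic_fun_on :: "(complex^'n \<Rightarrow> complex) \<Rightarrow> (complex^'n) set \<Rightarrow> bool" where
  "holomorphic_fun_on f S \<longleftrightarrow>
     (\<forall>z\<in>S. \<exists>D. (f has_derivative D) (at z) \<and> (\<forall>c v. D (c *s v) = c * D v))"

definition holomorphic_map_on :: "(complex^'n \<Rightarrow> complex^'m) \<Rightarrow> (complex^'n) set \<Rightarrow> bool" where
  "holomorphic_map_on F S \<longleftrightarrow> (\<forall>i. holomorphic_fun_on (\<lambda>z. F z $ i) S)"

text \<open>
  The hull is only meant for nonempty compact \<open>K \<subseteq> S\<close>: then the supremum is over a nonempty bounded set.
\<close>

definition holomorphic_hull :: "(complex^'n) set \<Rightarrow> (complex^'n) set \<Rightarrow> (complex^'n) set" where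
  "holomorphic_hull S K =
     {z \<in> S. \<forall>g. holomorphic_fun_on g S \<longrightarrow> norm (g z) \<le> (SUP w\<in>K. norm (g w))}"

text \<open>
  Stein manifolds: holomorphically convex, holomorphically separable, and with global holomorphic
  functions providing local coordinates at each point. For open subsets of \<^typ>\<open>complex^'n\<close> the last
  two conditions always hold (use the coordinate functions).
\<close>

definition stein :: "(complex^'n) set \<Rightarrow> bool" where
  "stein S \<longleftrightarrow> open S \<and>
     (\<forall>K. compact K \<and> K \<noteq> {} \<and> K \<subseteq> S \<longrightarrow> compact (holomorphic_hull S K)) \<and>
     (\<forall>z\<in>S. \<forall>w\<in>S. z \<noteq> w \<longrightarrow> (\<exists>g. holomorphic_fun_on g S \<and> g z \<noteq> g w)) \<and>
     (\<forall>z\<in>S. \<exists>(G :: complex^'n \<Rightarrow> complex^'n) D.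
        holomorphic_map_on G S \<and> (G has_derivative D) (at z) \<and> bij D)"

text \<open>
  Locally uniform approximation is uniform approximation on compact subsets, as open subsets of
  \<^typ>\<open>complex^'n\<close> are locally compact.
\<close>

definition runge_in :: "(complex^'n) set \<Rightarrow> (complex^'n) set \<Rightarrow> bool" where
  "runge_in U W \<longleftrightarrow>
     (\<forall>g. holomorphic_fun_on g U \<longrightarrow>
       (\<forall>K e. compact K \<and> K \<subseteq> U \<and> e > 0 \<longrightarrow>
         (\<exists>h. holomorphic_fun_on h W \<and> (\<forall>z\<in>K. norm (g z - h z) < e))))"

definition stein_runge_embedding ::
  "(complex^'n \<Rightarrow> complex^'n) \<Rightarrow> (complex^'n) set \<Rightarrow> (complex^'n) set \<Rightarrow> bool" where
  "stein_runge_embedding \<Phi> Y W \<longleftrightarrow>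
     open Y \<and> open W \<and> holomorphic_map_on \<Phi> Y \<and> inj_on \<Phi> Y \<and> \<Phi> ` Y \<subseteq> W \<and>
     stein (\<Phi> ` Y) \<and> runge_in (\<Phi> ` Y) W"

text \<open>
  The product \<open>S \<times> T\<close> under the identification of \<open>\<complex>\<^sup>n \<times> \<complex>\<close> with \<open>\<complex>\<^sup>n\<^sup>+\<^sup>1\<close>. Here \<open>'n + 1\<close> is the disjoint sum
  of the index type \<open>'n\<close> with the one-element type: the indices \<open>Inl i\<close> are the first \<open>n\<close> coordinates
  and \<open>Inr 1\<close> is the last one.
\<close>

definition product_in_succ :: "(complex^'n) set \<Rightarrow> complex set \<Rightarrow> (complex^('n + 1)) set" where
  "product_in_succ S T = {x. (\<chi> i. x $ Inl i) \<in> S \<and> x $ Inr 1 \<in> T}"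

end

theory Submission
  imports Defs "HOL-Complex_Analysis.Complex_Analysis"
begin

text \<open>
  Write \<open>Y = {f \<noteq> 0} \<times> \<complex>\<close>. The graph \<open>{f(z) w = 1}\<close> is a closed copy of \<open>{f \<noteq> 0}\<close>, and
  \<open>(z, s) \<mapsto> (z, 1 / (f(z) + \<epsilon> s))\<close> embeds any given compact part of \<open>Y\<close> in a tube around it, as soon as
  \<open>\<epsilon>\<close> is small; \<open>s\<close> becomes a multiple of \<open>1/w - f\<close>. The tubes of different radii are related by the
  flow of the vector field \<open>(f w\<^sup>2 - w) \<partial>\<^sub>w\<close>, a locally uniform limit of sums of complete shear and
  overshear fields. By Euler's method its flow is, on compact sets where it exists, a limit of
  automorphisms of \<open>\<complex>\<^sup>n\<^sup>+\<^sup>1\<close>. Composing automorphisms that nearly dilate one thin tube to the next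
  thicker one yields a limit map \<open>\<Phi>\<close> on all of \<open>Y\<close> whose image is, up to automorphisms and small errors,
  exhausted by such tubes.

  On a thin tube, \<open>1/w\<close> and \<open>1/f\<close> are geometric series in \<open>1 - f w\<close>, so the Runge property reduces to the
  approximation of holomorphic functions on \<open>Y\<close> by entire functions of \<open>z\<close>, \<open>s\<close> and \<open>1/f\<close>. This is Oka's
  theorem for the graph of \<open>1/f\<close>, proved by gluing local extensions over adjacent boxes with Cauchy integrals.
\<close>

text \<open>Unless \<open>Y\<close> is empty, \<open>f(z) + \<epsilon> s\<close> vanishes somewhere
  on \<open>Y\<close> for every \<open>\<epsilon> > 0\<close>, so no single tube map is defined on
  all of \<open>Y\<close>: the radii have to shrink along an exhaustion, and \<open>\<Phi>\<close>
  can only be a limit. The vector field is read off the tubes: with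
  \<open>\<epsilon> = \<epsilon>' e^t\<close>, the function \<open>w = 1/(f + \<epsilon> s)\<close>
  satisfies \<open>w' = - \<epsilon> s w^2 = f w^2 - w\<close>. Its solutions are thus explicit, so
  that Euler's method starts from given curves and no existence theorem for differential equations
  enters; but they blow up where the denominator vanishes, so automorphisms can follow them only on
  suitable compact sets. One property of the approximations survives in the limit: undoing the
  \<open>k\<close>-th automorphism and the \<open>k\<close>-th tube map brings
  \<open>\<Phi>(x)\<close> back to within \<open>1/(k + 1)\<close> of \<open>x\<close>, for
  \<open>x\<close> in the \<open>k\<close>-th compact set. Injectivity, holomorphy of the inverse
  and the reduction of the Runge property to a thin tube all come from this estimate.\<close>

no_notation fps_nth (infixl "$" 75)

section \<open>Holomorphic functions of several variables\<close>

lemma compact_image_bound: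
  fixes u :: "'a::topological_space \<Rightarrow> 'b::real_normed_vector"
  assumes "compact K" "continuous_on K u"
  obtains B where "B > 0" "\<And>x. x \<in> K \<Longrightarrow> norm (u x) \<le> B"
proof -
  have "bounded (u ` K)"
    by (intro compact_imp_bounded compact_continuous_image assms)
  then show ?thesis using that by (auto simp: bounded_pos)
qed

lemmas norm_component_le = Finite_Cartesian_Product.norm_nth_le

text \<open>Uniform continuity on a compact neighbourhood of \<open>C\<close> inside
  \<open>U\<close>. Only \<open>c\<close> has to lie in \<open>C\<close>; the perturbed point
  \<open>y\<close> may leave it, as approximants and limits do later.\<close>

lemma uniform_on_compact:
  fixes \<Psi> :: "'a::euclidean_space \<Rightarrow> 'b::real_normed_vector"
  assumes U: "open U" "continuous_on U \<Psi>" and C: "compact C" "C \<subseteq> U" and e: "e > 0"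
  shows "\<exists>\<eta>>0. \<forall>c\<in>C. \<forall>y. norm (y - c) \<le> \<eta> \<longrightarrow> y \<in> U \<and> norm (\<Psi> y - \<Psi> c) < e"
proof -
  obtain r where r: "r > 0" "(\<Union>x\<in>C. ball x r) \<subseteq> U"
    using compact_subset_open_imp_ball_epsilon_subset[OF C(1) U(1) C(2)] by blast
  define C' where "C' = {x + y | x y. x \<in> C \<and> y \<in> cball (0 :: 'a) (r / 2)}"
  have C': "compact C'" unfolding C'_def using C(1) by (intro compact_sums) auto
  have in_C': "y \<in> C'" if "c \<in> C" "norm (y - c) \<le> r / 2" for c y
    unfolding C'_def using that by (intro CollectI exI[of _ c] exI[of _ "y - c"]) simp
  have "C' \<subseteq> U"
  proof
    fix z assume "z \<in> C'"
    then obtain x y where "z = x + y" "x \<in> C" "norm y \<le> r / 2" by (auto simp: C'_def)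
    then have "z \<in> ball x r" "x \<in> C" using r(1) by (auto simp: dist_norm)
    then show "z \<in> U" using r(2) by blast
  qed
  then have "uniformly_continuous_on C' \<Psi>"
    by (intro compact_uniformly_continuous C' continuous_on_subset[OF U(2)])
  then obtain \<delta> where \<delta>: "\<delta> > 0" "\<And>x y. x \<in> C' \<Longrightarrow> y \<in> C' \<Longrightarrow> dist y x < \<delta> \<Longrightarrow> dist (\<Psi> y) (\<Psi> x) < e"
    unfolding uniformly_continuous_on_def using e by metis
  show ?thesis
  proof (intro exI[of _ "min (r / 2) (\<delta> / 2)"] conjI ballI allI impI)
    fix c y assume c: "c \<in> C" and y: "norm (y - c) \<le> min (r / 2) (\<delta> / 2)"
    have "y \<in> C'" using in_C'[OF c] y by simp
    moreover have "c \<in> C'" using in_C'[OF c, of c] r(1) by simp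
    ultimately show "y \<in> U" "norm (\<Psi> y - \<Psi> c) < e"
      using \<open>C' \<subseteq> U\<close> \<delta>(2)[of c y] y \<delta>(1) by (auto simp: dist_norm)
  qed (use r \<delta> in auto)
qed

abbreviation complex_differentiable_at :: "(complex^'n \<Rightarrow> complex) \<Rightarrow> complex^'n \<Rightarrow> bool" where
  "complex_differentiable_at f z \<equiv> \<exists>D. (f has_derivative D) (at z) \<and> (\<forall>c v. D (c *s v) = c * D v)"

lemma hol_fun_subset:
  "holomorphic_fun_on f S \<Longrightarrow> T \<subseteq> S \<Longrightarrow> holomorphic_fun_on f T"
  by (auto simp: holomorphic_fun_on_def subset_eq)

lemma hol_fun_continuous_on:
  assumes "holomorphic_fun_on f S"
  shows "continuous_on S f"
proof (rule continuous_at_imp_continuous_on, rule ballI)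
  fix x assume "x \<in> S"
  then obtain D where "(f has_derivative D) (at x)"
    using assms unfolding holomorphic_fun_on_def by blast
  then show "isCont f x" by (rule has_derivative_continuous)
qed

lemma hol_fun_cong:
  assumes "holomorphic_fun_on f S" "open S" "\<And>x. x \<in> S \<Longrightarrow> f x = g x"
  shows "holomorphic_fun_on g S"
  unfolding holomorphic_fun_on_def
proof
  fix z assume "z \<in> S"
  then obtain D where "(f has_derivative D) (at z)" "\<forall>c v. D (c *s v) = c * D v"
    using assms(1) unfolding holomorphic_fun_on_def by blast
  moreover from this(1) have "(g has_derivative D) (at z)"
    using has_derivative_transform_within_open[OF _ assms(2) \<open>z \<in> S\<close>] assms(3) by blast
  ultimately show "complex_differentiable_at g z" by blast
qed

lemma holomorphic_fun_on_Un:
  "holomorphic_fun_on f S \<Longrightarrow> holomorphic_fun_on f T \<Longrightarrow> holomorphic_fun_on f (S \<union> T)"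
  by (auto simp: holomorphic_fun_on_def)

named_theorems hol_intros

lemma hol_fun_const [hol_intros]: "holomorphic_fun_on (\<lambda>x. c) S"
  unfolding holomorphic_fun_on_def by (intro ballI exI[of _ "\<lambda>_. 0"]) simp

lemma hol_fun_nth [hol_intros]: "holomorphic_fun_on (\<lambda>x. x $ i) S"
  unfolding holomorphic_fun_on_def
  by (intro ballI exI[of _ "\<lambda>x. x $ i"])
     (simp add: bounded_linear_imp_has_derivative[OF bounded_linear_vec_nth])

lemma hol_fun_compose_field:
  assumes "holomorphic_fun_on f S" "\<And>x. x \<in> S \<Longrightarrow> g field_differentiable (at (f x))"
  shows "holomorphic_fun_on (\<lambda>x. g (f x)) S"
  unfolding holomorphic_fun_on_def
proof
  fix z assume z: "z \<in> S"
  then obtain D where D: "(f has_derivative D) (at z)" "\<forall>c v. D (c *s v) = c * D v"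
    using assms(1) unfolding holomorphic_fun_on_def by blast
  obtain g' where "(g has_field_derivative g') (at (f z))"
    using assms(2)[OF z] by (auto simp: field_differentiable_def)
  then have "((\<lambda>x. g (f x)) has_derivative (\<lambda>v. g' * D v)) (at z)"
    using has_derivative_compose[OF D(1), of g "(*) g'"] by (simp add: has_field_derivative_def)
  then show "complex_differentiable_at (\<lambda>x. g (f x)) z"
    using D(2) by (auto intro!: exI[of _ "\<lambda>v. g' * D v"])
qed

lemma hol_fun_add [hol_intros]:
  assumes "holomorphic_fun_on f S" "holomorphic_fun_on g S"
  shows "holomorphic_fun_on (\<lambda>x. f x + g x) S"
  unfolding holomorphic_fun_on_def
proof
  fix z assume z: "z \<in> S"
  obtain D E where "(f has_derivative D) (at z)" "\<forall>c v. D (c *s v) = c * D v"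
    "(g has_derivative E) (at z)" "\<forall>c v. E (c *s v) = c * E v"
    using assms z unfolding holomorphic_fun_on_def by metis
  then show "complex_differentiable_at (\<lambda>x. f x + g x) z"
    by (intro exI[of _ "\<lambda>v. D v + E v"]) (auto intro!: derivative_eq_intros simp: algebra_simps)
qed

lemma hol_fun_mult [hol_intros]:
  assumes "holomorphic_fun_on f S" "holomorphic_fun_on g S"
  shows "holomorphic_fun_on (\<lambda>x. f x * g x) S"
  unfolding holomorphic_fun_on_def
proof
  fix z assume z: "z \<in> S"
  obtain D E where "(f has_derivative D) (at z)" "\<forall>c v. D (c *s v) = c * D v"
    "(g has_derivative E) (at z)" "\<forall>c v. E (c *s v) = c * E v"
    using assms z unfolding holomorphic_fun_on_def by metis
  then show "complex_differentiable_at (\<lambda>x. f x * g x) z"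
    by (intro exI[of _ "\<lambda>v. f z * E v + D v * g z"])
      (auto intro!: derivative_eq_intros simp: algebra_simps)
qed

lemma hol_fun_minus [hol_intros]:
  "holomorphic_fun_on f S \<Longrightarrow> holomorphic_fun_on (\<lambda>x. - f x) S"
  using hol_fun_mult[OF hol_fun_const[of "-1" S], of f] by simp

lemma hol_fun_diff [hol_intros]:
  "holomorphic_fun_on f S \<Longrightarrow> holomorphic_fun_on g S \<Longrightarrow> holomorphic_fun_on (\<lambda>x. f x - g x) S"
  using hol_fun_add[OF _ hol_fun_minus, of f S g] by simp

lemma hol_fun_power [hol_intros]:
  "holomorphic_fun_on f S \<Longrightarrow> holomorphic_fun_on (\<lambda>x. f x ^ n) S"
  by (induction n) (auto intro: hol_intros)

lemma hol_fun_sum [hol_intros]: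
  "(\<And>i. i \<in> I \<Longrightarrow> holomorphic_fun_on (f i) S) \<Longrightarrow> holomorphic_fun_on (\<lambda>x. \<Sum>i\<in>I. f i x) S"
  by (induction I rule: infinite_finite_induct) (auto intro: hol_intros)

lemma hol_fun_inverse [hol_intros]:
  assumes "holomorphic_fun_on f S" "\<And>x. x \<in> S \<Longrightarrow> f x \<noteq> 0"
  shows "holomorphic_fun_on (\<lambda>x. inverse (f x)) S"
proof (rule hol_fun_compose_field[OF assms(1), of inverse])
  show "inverse field_differentiable (at (f x))" if "x \<in> S" for x
    using field_differentiable_inverse[OF field_differentiable_ident, of "f x" UNIV] assms(2)[OF that]
    by simp
qed

lemma hol_fun_divide [hol_intros]:
  "holomorphic_fun_on f S \<Longrightarrow> holomorphic_fun_on g S \<Longrightarrow> (\<And>x. x \<in> S \<Longrightarrow> g x \<noteq> 0)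
    \<Longrightarrow> holomorphic_fun_on (\<lambda>x. f x / g x) S"
  unfolding divide_inverse by (intro hol_intros)

lemma hol_fun_exp [hol_intros]:
  "holomorphic_fun_on f S \<Longrightarrow> holomorphic_fun_on (\<lambda>x. exp (f x)) S"
  using hol_fun_compose_field[of f S exp] by (simp add: field_differentiable_within_exp)

lemma has_derivative_vec_complex:
  fixes f :: "'m::finite \<Rightarrow> 'a::real_normed_vector \<Rightarrow> complex"
  assumes "\<And>i. (f i has_derivative D i) F"
  shows "((\<lambda>x. \<chi> i. f i x) has_derivative (\<lambda>v. \<chi> i. D i v)) F"
proof -
  have vec: "(\<chi> i. g i) = (\<Sum>i\<in>UNIV. axis i (g i))" for g :: "'m \<Rightarrow> complex"
    by (simp add: vec_eq_iff axis_def)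
  have bl: "bounded_linear (axis i :: complex \<Rightarrow> complex^'m)" for i
    by (rule linear_conv_bounded_linear[THEN iffD1])
       (auto intro!: linearI simp: vec_eq_iff axis_def)
  show ?thesis
    unfolding vec by (rule has_derivative_sum) (rule bounded_linear.has_derivative[OF bl assms])
qed

lemma hol_fun_compose:
  fixes G :: "complex^'n \<Rightarrow> complex^'m"
  assumes "holomorphic_map_on G S" "holomorphic_fun_on f T" "G ` S \<subseteq> T"
  shows "holomorphic_fun_on (\<lambda>x. f (G x)) S"
  unfolding holomorphic_fun_on_def
proof
  fix z assume z: "z \<in> S"
  have "\<forall>i. complex_differentiable_at (\<lambda>x. G x $ i) z"
    using assms(1) z unfolding holomorphic_map_on_def holomorphic_fun_on_def by blast
  then obtain D where D: "\<And>i. ((\<lambda>x. G x $ i) has_derivative D i) (at z)"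
    "\<And>i c v. D i (c *s v) = c * D i v" by metis
  obtain E where E: "(f has_derivative E) (at (G z))" "\<forall>c v. E (c *s v) = c * E v"
    using assms(2,3) z unfolding holomorphic_fun_on_def by blast
  have "((\<lambda>x. \<chi> i. G x $ i) has_derivative (\<lambda>v. \<chi> i. D i v)) (at z)"
    by (rule has_derivative_vec_complex) (rule D)
  then have "(G has_derivative (\<lambda>v. \<chi> i. D i v)) (at z)" by simp
  from has_derivative_compose[OF this E(1)]
  have "((\<lambda>x. f (G x)) has_derivative (\<lambda>v. E (\<chi> i. D i v))) (at z)" .
  moreover have "E (\<chi> i. D i (c *s v)) = c * E (\<chi> i. D i v)" for c v
  proof -
    have "(\<chi> i. D i (c *s v)) = c *s (\<chi> i. D i v)" by (simp add: vec_eq_iff D(2))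
    then show ?thesis using E(2) by simp
  qed
  ultimately show "complex_differentiable_at (\<lambda>x. f (G x)) z"
    by blast
qed

lemma hol_map_compose:
  "holomorphic_map_on G S \<Longrightarrow> holomorphic_map_on F T \<Longrightarrow> G ` S \<subseteq> T
    \<Longrightarrow> holomorphic_map_on (\<lambda>x. F (G x)) S"
  using hol_fun_compose[of G S "\<lambda>z. F z $ i" T for i] by (simp add: holomorphic_map_on_def)

lemma hol_map_subset:
  "holomorphic_map_on f S \<Longrightarrow> T \<subseteq> S \<Longrightarrow> holomorphic_map_on f T"
  unfolding holomorphic_map_on_def using hol_fun_subset by blast

lemma hol_map_continuous_on:
  assumes "holomorphic_map_on F S"
  shows "continuous_on S F"
proof -
  have "continuous_on S (\<lambda>x. \<chi> i. F x $ i)"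
    using assms by (intro continuous_on_vec_lambda hol_fun_continuous_on) (simp add: holomorphic_map_on_def)
  then show ?thesis by simp
qed

lemma hol_fun_line:
  assumes "holomorphic_fun_on f S" "x + u0 *s v \<in> S"
  shows "(\<lambda>u. f (x + u *s v)) field_differentiable (at u0)"
proof -
  obtain D where D: "(f has_derivative D) (at (x + u0 *s v))" "\<forall>c v. D (c *s v) = c * D v"
    using assms unfolding holomorphic_fun_on_def by blast
  have bl: "bounded_linear (\<lambda>u::complex. u *s v)"
    by (rule linear_conv_bounded_linear[THEN iffD1])
       (auto intro!: linearI simp: vec_eq_iff algebra_simps)
  have "((\<lambda>u. x + u *s v) has_derivative (\<lambda>u. u *s v)) (at u0)"
    by (auto intro!: derivative_eq_intros bounded_linear_imp_has_derivative[OF bl])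
  from has_derivative_compose[OF this D(1)]
  have "((\<lambda>u. f (x + u *s v)) has_derivative (\<lambda>u. D v * u)) (at u0)"
    using D(2) by (simp add: mult.commute)
  then show ?thesis
    unfolding field_differentiable_def has_field_derivative_def by blast
qed

section \<open>Separate holomorphy, Osgood's lemma, integrals and limits\<close>

lemma smult_axis_1: "u *s axis i 1 = axis i (u::complex)"
  by (simp add: vec_eq_iff axis_def)

lemma axis_add: "axis i (a + b :: complex) = axis i a + axis i b"
  by (simp add: vec_eq_iff axis_def)

lemma norm_axis_complex: "norm (axis i (a::complex)) = norm a"
proof -
  have "(norm (axis i a $ j))\<^sup>2 = (if j = i then (norm a)\<^sup>2 else 0)" for j
    by (simp add: axis_def)
  then show ?thesis by (simp add: norm_vec_def L2_set_def)
qed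

lemma continuous_on_axis [continuous_intros]:
  assumes "continuous_on S g"
  shows "continuous_on S (\<lambda>x. axis i (g x :: complex))"
proof -
  have "continuous_on S (\<lambda>x. if j = i then g x else 0)" for j
    using assms by (cases "j = i") auto
  then show ?thesis unfolding axis_def by (intro continuous_on_vec_lambda)
qed

text \<open>Cauchy's estimate for \<open>F p - F p0\<close> bounds the difference of the
  derivatives, and compactness of the closed disc makes \<open>F p - F p0\<close> uniformly small
  for \<open>p\<close> near \<open>p0\<close>.\<close>

lemma continuous_on_deriv_param:
  fixes F :: "'a::metric_space \<Rightarrow> complex \<Rightarrow> complex"
  assumes cont: "continuous_on (A \<times> cball 0 r) (\<lambda>(p, u). F p u)"
    and hol: "\<And>p. p \<in> A \<Longrightarrow> F p holomorphic_on ball 0 r" and r: "r > 0"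
  shows "continuous_on A (\<lambda>p. deriv (F p) 0)"
  unfolding continuous_on_iff
proof (intro ballI allI impI)
  fix p0 and e :: real assume p0: "p0 \<in> A" and e: "e > 0"
  \<comment> \<open>Division by the radius in Cauchy's estimate turns \<open>e * r / 2\<close> into
    \<open>e / 2\<close>.\<close>
  obtain X0 where X0: "p0 \<in> X0" "open X0" and
    b0: "\<forall>p\<in>X0 \<inter> A. \<forall>u\<in>cball 0 r.
      dist (case (p, u) of (p, u) \<Rightarrow> F p u) (case (p0, u) of (p, u) \<Rightarrow> F p u) \<le> e * r / 2"
    by (rule continuous_on_prod_compactE[OF cont compact_cball p0, of "e * r / 2"]) (use e r in auto)
  have b: "dist (F p u) (F p0 u) \<le> e * r / 2" if "p \<in> X0 \<inter> A" "u \<in> cball 0 r" for p u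
    using b0 that by simp
  obtain d where d: "d > 0" "ball p0 d \<subseteq> X0" using X0 openE by blast
  have cF: "continuous_on (cball 0 r) (F p)" if "p \<in> A" for p
  proof -
    have "continuous_on (cball 0 r) (\<lambda>u. case (p, u) of (p, u) \<Rightarrow> F p u)"
      by (rule continuous_on_compose2[OF cont, of _ "\<lambda>u. (p, u)"])
         (use that in \<open>auto intro!: continuous_on_Pair continuous_on_const continuous_on_id\<close>)
    then show ?thesis by simp
  qed
  show "\<exists>d>0. \<forall>x'\<in>A. dist x' p0 < d \<longrightarrow> dist (deriv (F x') 0) (deriv (F p0) 0) < e"
  proof (intro exI[of _ d] conjI d ballI impI)
    fix p assume p: "p \<in> A" "dist p p0 < d"
    then have "p \<in> ball p0 d" by (simp add: dist_commute)
    then have pX: "p \<in> X0 \<inter> A" using d(2) p(1) by blast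
    have "norm ((deriv ^^ 1) (\<lambda>u. F p u - F p0 u) 0) \<le> fact 1 * (e * r / 2) / r ^ 1"
    proof (rule Cauchy_inequality)
      show "(\<lambda>u. F p u - F p0 u) holomorphic_on ball 0 r"
        using hol p(1) p0 by (intro holomorphic_intros)
      show "continuous_on (cball 0 r) (\<lambda>u. F p u - F p0 u)"
        using cF p(1) p0 by (intro continuous_intros)
      show "norm (F p u - F p0 u) \<le> e * r / 2" if "norm (0 - u) = r" for u
        using b[OF pX, of u] that by (simp add: dist_norm)
    qed (use r in auto)
    moreover have "deriv (\<lambda>u. F p u - F p0 u) 0 = deriv (F p) 0 - deriv (F p0) 0"
      using r hol p(1) p0 by (intro deriv_diff holomorphic_on_imp_differentiable_at[of _ "ball 0 r"]) auto
    ultimately show "dist (deriv (F p) 0) (deriv (F p0) 0) < e"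
      using e r by (simp add: dist_norm)
  qed
qed

lemma field_differentiable_shift:
  fixes g :: "complex \<Rightarrow> complex"
  assumes "(\<lambda>u. g (u0 + u)) field_differentiable (at 0)"
  shows "g field_differentiable (at u0)"
proof -
  have "((\<lambda>u. g (u0 + u)) \<circ> (\<lambda>u. u - u0)) field_differentiable (at u0)"
    by (rule field_differentiable_compose) (use assms in \<open>auto intro!: derivative_intros\<close>)
  then show ?thesis by (simp add: o_def)
qed

lemma norm_le_componentwise:
  fixes v :: "complex^'n"
  assumes "\<And>i. norm (w $ i) \<le> norm (v $ i)"
  shows "norm (w::complex^'n) \<le> norm v"
  unfolding norm_vec_def by (rule L2_set_mono) (use assms in auto)

lemma separately_holomorphic_on_line:
  fixes f :: "complex^'n \<Rightarrow> complex"
  assumes "\<And>x i. x \<in> U \<Longrightarrow> (\<lambda>u. f (x + axis i u)) field_differentiable (at 0)"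
    and "x + axis i u0 \<in> U"
  shows "(\<lambda>u. f (x + axis i u)) field_differentiable (at u0)"
  by (rule field_differentiable_shift[of "\<lambda>u. f (x + axis i u)"]) (use assms(1)[OF assms(2), of i] in \<open>simp add: axis_add add.assoc\<close>)

text \<open>Parameter integrals and uniform limits are easily seen to be continuous and separately
  holomorphic; this criterion turns that into a complex-linear total derivative. The partial
  derivatives \<open>D i\<close> are continuous by Cauchy's estimate, and an increment is split into
  moves along single coordinates.\<close>

lemma osgood:
  fixes f :: "complex^'n \<Rightarrow> complex"
  assumes U: "open U" and cont: "continuous_on U f"
    and sep: "\<And>x i. x \<in> U \<Longrightarrow> (\<lambda>u. f (x + axis i u)) field_differentiable (at 0)"
  shows "holomorphic_fun_on f U"
  unfolding holomorphic_fun_on_def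
proof
  define D where "D = (\<lambda>i x. deriv (\<lambda>u. f (x + axis i u)) 0)"
  fix x assume x: "x \<in> U"
  obtain r where r: "r > 0" "cball x (2*r) \<subseteq> U"
  proof -
    obtain e where "e > 0" "cball x e \<subseteq> U" using U x open_contains_cball by blast
    then show ?thesis using that[of "e/2"] by auto
  qed
  have in_U: "y + axis i u \<in> U" if "y \<in> cball x r" "norm u \<le> r" for y i u
  proof -
    have "norm (y - x + axis i u) \<le> r + r"
      using that by (intro norm_triangle_le add_mono) (auto simp: norm_axis_complex dist_norm norm_minus_commute)
    moreover have "dist x (y + axis i u) = norm (y - x + axis i u)"
      by (metis dist_commute dist_norm diff_add_eq)
    ultimately have "y + axis i u \<in> cball x (2*r)" by simp
    then show ?thesis using r(2) by blast
  qed
  have contD: "continuous_on (cball x r) (D i)" for i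
    unfolding D_def
  proof (rule continuous_on_deriv_param[where r=r])
    have "(\<lambda>q. fst q + axis i (snd q)) ` (cball x r \<times> cball 0 r) \<subseteq> U"
      by (intro image_subsetI in_U) (auto simp: mem_Times_iff)
    moreover have "continuous_on (cball x r \<times> cball 0 r) (\<lambda>q. fst q + axis i (snd q))"
      by (intro continuous_intros)
    ultimately have "continuous_on (cball x r \<times> cball 0 r) (\<lambda>q. f (fst q + axis i (snd q)))"
      using continuous_on_compose2[OF cont] by blast
    then show "continuous_on (cball x r \<times> cball 0 r) (\<lambda>(p, u). f (p + axis i u))"
      by (simp add: case_prod_unfold)
    show "(\<lambda>u. f (p + axis i u)) holomorphic_on ball 0 r" if "p \<in> cball x r" for p
      unfolding holomorphic_on_def
    proof (rule ballI, rule field_differentiable_at_within)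
      fix u assume "u \<in> ball (0::complex) r"
      then have "p + axis i u \<in> U" using that by (intro in_U) auto
      with sep show "(\<lambda>u. f (p + axis i u)) field_differentiable (at u)"
        by (rule separately_holomorphic_on_line)
    qed
  qed (use r in auto)
  have dD: "((\<lambda>u. f (y + axis i u)) has_field_derivative D i (y + axis i u)) (at u)"
    if "y + axis i u \<in> U" for y i u
  proof -
    have "(\<lambda>\<eta>. f (y + axis i u + axis i \<eta>)) field_differentiable (at 0)" using sep that by blast
    then have "((\<lambda>\<eta>. f (y + axis i u + axis i \<eta>)) has_field_derivative D i (y + axis i u)) (at (u - u))"
      unfolding D_def by (simp add: field_differentiable_derivI)
    then have "((\<lambda>\<eta>. f (y + axis i u + axis i (\<eta> - u))) has_field_derivative D i (y + axis i u) * 1) (at u)"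
      by (rule DERIV_chain2) (auto intro!: derivative_eq_intros)
    moreover have "y + axis i u + axis i (\<eta> - u) = y + axis i \<eta>" for \<eta>
      by (simp add: vec_eq_iff axis_def)
    ultimately show ?thesis by simp
  qed
  let ?L = "\<lambda>v. \<Sum>i\<in>UNIV. v $ i * D i x"
  have "(f has_derivative ?L) (at x)"
    unfolding has_derivative_at_alt
  proof (intro conjI allI impI)
    show "bounded_linear ?L"
      by (intro bounded_linear_sum bounded_linear_mult_const bounded_linear_vec_nth)
    fix e :: real assume e: "e > 0"
    define e' where "e' = e / real CARD('n)"
    have e': "e' > 0" using e by (simp add: e'_def)
    have "\<exists>d>0. \<forall>y\<in>cball x r. dist y x < d \<longrightarrow> dist (D i y) (D i x) < e'" for i
      using contD[of i, unfolded continuous_on_iff, rule_format, of x e'] e' r(1) by simp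
    then obtain d where d: "\<And>i. d i > 0" "\<And>i y. y \<in> cball x r \<Longrightarrow> dist y x < d i \<Longrightarrow> dist (D i y) (D i x) < e'"
      by metis
    define d0 where "d0 = Min (insert r (range d))"
    have d0: "d0 > 0" "d0 \<le> r" using d(1) r(1) by (auto simp: d0_def)
    have d0_le: "d0 \<le> d i" for i unfolding d0_def by (rule Min_le) auto
    have key: "norm (f (x + v) - f x - ?L v) \<le> e * norm v" if v: "norm v < d0" for v
    proof -
      \<comment> \<open>\<open>vJ J\<close> keeps only the coordinates of \<open>v\<close> in
        \<open>J\<close>; the induction over \<open>J\<close> switches them on one at a time until
        \<open>vJ UNIV = v\<close>.\<close>
      define vJ where "vJ = (\<lambda>J. (\<chi> i. if i \<in> J then v $ i else 0) :: complex^'n)"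
      have "norm (f (x + vJ J) - f x - (\<Sum>i\<in>J. v $ i * D i x)) \<le> (\<Sum>i\<in>J. e' * norm (v $ i))"
        if "finite J" for J
        using that
      proof (induction J)
        case empty
        have "vJ {} = 0" by (simp add: vJ_def vec_eq_iff)
        then show ?case by simp
      next
        case (insert i J)
        have seg: "norm (vJ J + axis i u) \<le> norm v" if "u \<in> closed_segment 0 (v $ i)" for u
        proof (rule norm_le_componentwise)
          have "norm u \<le> norm (v $ i)" using segment_bound1[OF that] by simp
          then show "norm ((vJ J + axis i u) $ j) \<le> norm (v $ j)" for j
            using insert.hyps by (auto simp: vJ_def axis_def)
        qed
        have near: "x + vJ J + axis i u \<in> cball x r" "dist (x + vJ J + axis i u) x < d i"
          if "u \<in> closed_segment 0 (v $ i)" for u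
        proof -
          have "dist (x + vJ J + axis i u) x < d0"
            using seg[OF that] v by (simp add: dist_norm add.assoc)
          then show "x + vJ J + axis i u \<in> cball x r" "dist (x + vJ J + axis i u) x < d i"
            using d0(2) d0_le[of i] by (auto simp: dist_commute)
        qed
        \<comment> \<open>Mean value estimate along a segment in coordinate \<open>i\<close>: after
          subtraction of \<open>u * D i x\<close> the derivative has norm at most
          \<open>e'\<close>.\<close>
        have "norm ((f (x + vJ J + axis i (v $ i)) - v $ i * D i x) - (f (x + vJ J + axis i 0) - 0 * D i x)) \<le> e' * norm (v $ i - 0)"
        proof (rule field_differentiable_bound[where S="closed_segment 0 (v $ i)" and
              f="\<lambda>u. f (x + vJ J + axis i u) - u * D i x" and
              f'="\<lambda>u. D i (x + vJ J + axis i u) - D i x"])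
          fix u assume z: "u \<in> closed_segment 0 (v $ i)"
          have "x + vJ J + axis i u \<in> U" using near[OF z] r(2) r(1) by (auto simp: subset_eq)
          from dD[OF this]
          show "((\<lambda>u. f (x + vJ J + axis i u) - u * D i x) has_field_derivative D i (x + vJ J + axis i u) - D i x) (at u within closed_segment 0 (v $ i))"
            by (rule has_field_derivative_at_within[OF DERIV_diff]) (auto intro!: derivative_eq_intros)
          show "norm (D i (x + vJ J + axis i u) - D i x) \<le> e'"
            using d(2)[OF near[OF z]] by (simp add: dist_norm)
        qed auto
        moreover have "vJ J + axis i (v $ i) = vJ (insert i J)"
          using insert.hyps by (auto simp: vJ_def vec_eq_iff axis_def)
        moreover have "axis i (0::complex) = 0" by (simp add: vec_eq_iff axis_def)
        ultimately have st: "norm (f (x + vJ (insert i J)) - f (x + vJ J) - v $ i * D i x) \<le> e' * norm (v $ i)"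
          by (simp add: add.assoc algebra_simps)
        have "f (x + vJ (insert i J)) - f x - (\<Sum>i\<in>insert i J. v $ i * D i x) =
          (f (x + vJ (insert i J)) - f (x + vJ J) - v $ i * D i x) + (f (x + vJ J) - f x - (\<Sum>i\<in>J. v $ i * D i x))"
          using insert.hyps by simp
        also have "norm \<dots> \<le> e' * norm (v $ i) + (\<Sum>i\<in>J. e' * norm (v $ i))"
          by (intro norm_triangle_le add_mono st insert.IH)
        finally show ?case using insert.hyps by simp
      qed
      from this[of UNIV] have "norm (f (x + vJ UNIV) - f x - ?L v) \<le> (\<Sum>i\<in>(UNIV::'n set). e' * norm (v $ i))" by simp
      also have "\<dots> \<le> (\<Sum>i\<in>(UNIV::'n set). e' * norm v)"
        using e' by (intro sum_mono mult_left_mono) (auto simp: norm_component_le)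
      also have "\<dots> = e * norm v" by (simp add: e'_def)
      finally show ?thesis by (simp add: vJ_def)
    qed
    show "\<exists>d>0. \<forall>y. norm (y - x) < d \<longrightarrow> norm (f y - f x - ?L (y - x)) \<le> e * norm (y - x)"
      using key[of "y - x" for y] d0(1) by (intro exI[of _ d0]) auto
  qed
  moreover have "?L (c *s v) = c * ?L v" for c v by (simp add: sum_distrib_left mult.assoc)
  ultimately show "\<exists>D. (f has_derivative D) (at x) \<and> (\<forall>c v. D (c *s v) = c * D v)" by blast
qed

lemma hol_fun_imp_separately:
  assumes "holomorphic_fun_on f U" "x + axis i u \<in> U"
  shows "(\<lambda>u. f (x + axis i u)) field_differentiable (at u)"
  using hol_fun_line[OF assms(1), of x u "axis i 1"] assms(2)
  by (simp only: smult_axis_1)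

text \<open>Osgood's lemma and differentiation under the integral sign. Joint continuity of
  \<open>F\<close> is enough, since the continuity of its partial derivatives follows from Cauchy's
  estimate.\<close>

lemma hol_fun_integral:
  fixes F :: "complex^'n \<Rightarrow> real \<Rightarrow> complex"
  assumes U: "open U" and cont: "continuous_on (U \<times> {a..b}) (\<lambda>(x, t). F x t)"
    and hol: "\<And>t. t \<in> {a..b} \<Longrightarrow> holomorphic_fun_on (\<lambda>x. F x t) U"
  shows "holomorphic_fun_on (\<lambda>x. integral {a..b} (F x)) U"
proof (rule osgood[OF U])
  show "continuous_on U (\<lambda>x. integral {a..b} (F x))"
    using integral_continuous_on_param[of U a b F] cont by simp
  fix x i assume x: "x \<in> U"
  obtain r where r: "r > 0" "cball x (2*r) \<subseteq> U"
  proof -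
    obtain e where "e > 0" "cball x e \<subseteq> U" using U x open_contains_cball by blast
    then show ?thesis using that[of "e/2"] by auto
  qed
  have in_U: "x + axis i u \<in> U" if "norm u \<le> 2 * r" for u
  proof -
    have "x + axis i u \<in> cball x (2*r)" using that by (simp add: dist_norm norm_axis_complex)
    then show ?thesis using r by blast
  qed
  have in_U2: "x + axis i (u + \<eta>) \<in> U" if "norm u \<le> r" "norm \<eta> \<le> r" for u \<eta>
    by (rule in_U) (use that norm_triangle_ineq[of u \<eta>] in linarith)
  \<comment> \<open>Written as a derivative at \<open>0\<close> of a shifted function, so that
    \<open>continuous_on_deriv_param\<close> applies with \<open>(u, t)\<close> as the
    parameter.\<close>
  let ?d = "\<lambda>u t. deriv (\<lambda>\<eta>. F (x + axis i (u + \<eta>)) t) 0"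
  have "((\<lambda>u. integral (cbox a b) (F (x + axis i u))) has_field_derivative integral (cbox a b) (?d 0)) (at 0 within ball 0 r)"
  proof (rule leibniz_rule_field_derivative[where f="\<lambda>u. F (x + axis i u)" and fx="?d"])
    fix u t assume z: "u \<in> ball (0::complex) r" and t: "t \<in> cbox a b"
    have "(\<lambda>u. F (x + axis i u) t) field_differentiable (at u)"
      using z t r by (intro hol_fun_imp_separately[OF hol] in_U) auto
    then have 1: "((\<lambda>u. F (x + axis i u) t) has_field_derivative deriv (\<lambda>u. F (x + axis i u) t) u) (at u)"
      by (simp add: field_differentiable_derivI)
    then have "((\<lambda>u. F (x + axis i u) t) has_field_derivative deriv (\<lambda>u. F (x + axis i u) t) u) (at (u + 0))"
      by simp
    then have "((\<lambda>\<eta>. F (x + axis i (u + \<eta>)) t) has_field_derivative deriv (\<lambda>u. F (x + axis i u) t) u * 1) (at 0)"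
      by (rule DERIV_chain2) (auto intro!: derivative_eq_intros)
    then have "?d u t = deriv (\<lambda>u. F (x + axis i u) t) u"
      by (simp add: DERIV_imp_deriv)
    with 1 show "((\<lambda>u. F (x + axis i u) t) has_field_derivative ?d u t) (at u within ball 0 r)"
      by (simp add: has_field_derivative_at_within)
  next
    fix u assume z: "u \<in> ball (0::complex) r"
    then have "x + axis i u \<in> U" using r by (intro in_U) auto
    then show "F (x + axis i u) integrable_on cbox a b"
      by (intro integrable_continuous continuous_on_compose2[OF cont, of _ "\<lambda>t. (x + axis i u, t)", simplified])
         (auto intro!: continuous_intros)
  next
    show "continuous_on (ball 0 r \<times> cbox a b) (\<lambda>(u, t). ?d u t)"
      unfolding case_prod_unfold
    proof (rule continuous_on_deriv_param[where r=r])
      show "continuous_on ((ball 0 r \<times> cbox a b) \<times> cball 0 r)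
        (\<lambda>(p, u). F (x + axis i (fst p + u)) (snd p))"
      proof -
        let ?g = "\<lambda>q. (x + axis i (fst (fst q) + snd q), snd (fst q))"
        have "?g ` ((ball 0 r \<times> {a..b}) \<times> cball 0 r) \<subseteq> U \<times> {a..b}"
          by (intro image_subsetI SigmaI in_U2) (auto simp: mem_Times_iff)
        moreover have "continuous_on ((ball 0 r \<times> {a..b}) \<times> cball 0 r) ?g"
          by (intro continuous_intros)
        ultimately have "continuous_on ((ball 0 r \<times> {a..b}) \<times> cball 0 r) (\<lambda>q. case ?g q of (x, t) \<Rightarrow> F x t)"
          by (rule continuous_on_compose2[OF cont, rotated])
        then show ?thesis by (simp add: case_prod_unfold)
      qed
      show "(\<lambda>u. F (x + axis i (fst p + u)) (snd p)) holomorphic_on ball 0 r" if "p \<in> ball 0 r \<times> cbox a b" for p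
        unfolding holomorphic_on_def
      proof (rule ballI, rule field_differentiable_at_within)
        fix u assume z: "u \<in> ball (0::complex) r"
        have "(\<lambda>u. F (x + axis i (fst p) + axis i u) (snd p)) field_differentiable (at u)"
          by (rule hol_fun_imp_separately[OF hol])
             (use that in_U2[of "fst p" u] z in \<open>auto simp: axis_add add.assoc\<close>)
        then show "(\<lambda>u. F (x + axis i (fst p + u)) (snd p)) field_differentiable (at u)"
          by (simp add: axis_add add.assoc)
      qed
    qed (use r in auto)
  qed (use r in auto)
  then have "((\<lambda>u. integral {a..b} (F (x + axis i u))) has_field_derivative integral {a..b} (?d 0)) (at 0)"
    using r at_within_open[of 0 "ball 0 r"] by (metis centre_in_ball interval_cbox open_ball)
  then show "(\<lambda>u. integral {a..b} (F (x + axis i u))) field_differentiable (at 0)"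
    using field_differentiable_def by blast
qed

text \<open>Weierstrass's theorem on coordinate lines. The approximants need to be holomorphic near
  \<open>x\<close> only from some index on, because the tube maps used later are holomorphic merely
  on regions that reach a given point at a late stage.\<close>

lemma hol_fun_uniform_limit:
  fixes g :: "complex^'n \<Rightarrow> complex"
  assumes U: "open U"
    and lim: "\<And>x. x \<in> U \<Longrightarrow> \<exists>r>0. cball x r \<subseteq> U \<and> uniform_limit (cball x r) f g sequentially \<and>
        (\<forall>\<^sub>F n in sequentially. holomorphic_fun_on (f n) (cball x r))"
  shows "holomorphic_fun_on g U"
proof (rule osgood[OF U])
  have cont: "continuous_on (cball x r) g"
    if "uniform_limit (cball x r) f g sequentially"
      "\<forall>\<^sub>F n in sequentially. holomorphic_fun_on (f n) (cball x r)" for x r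
    by (rule uniform_limit_theorem[OF _ that(1)])
       (use that(2) in \<open>auto elim!: eventually_mono intro: hol_fun_continuous_on\<close>)
  show "continuous_on U g"
  proof (rule continuous_at_imp_continuous_on, rule ballI)
    fix x assume "x \<in> U"
    then obtain r where "r > 0" "continuous_on (cball x r) g" using lim cont by metis
    then show "isCont g x"
      by (meson ball_subset_cball centre_in_ball continuous_on_eq_continuous_at continuous_on_subset open_ball)
  qed
  fix x i assume "x \<in> U"
  then obtain r where r: "r > 0" "cball x r \<subseteq> U" "uniform_limit (cball x r) f g sequentially"
      "\<forall>\<^sub>F n in sequentially. holomorphic_fun_on (f n) (cball x r)" using lim by blast
  have in_b: "x + axis i u \<in> cball x r" if "norm u \<le> r" for u
    using that by (simp add: dist_norm norm_axis_complex)
  have "continuous_on (cball 0 r) (\<lambda>u. g (x + axis i u)) \<and> (\<lambda>u. g (x + axis i u)) holomorphic_on ball 0 r"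
  proof (rule holomorphic_uniform_limit[where f="\<lambda>n u. f n (x + axis i u)" and F=sequentially])
    show "\<forall>\<^sub>F n in sequentially. continuous_on (cball 0 r) (\<lambda>u. f n (x + axis i u)) \<and>
        (\<lambda>u. f n (x + axis i u)) holomorphic_on ball 0 r"
      using r(4)
    proof (rule eventually_mono)
      fix n assume h: "holomorphic_fun_on (f n) (cball x r)"
      have "(\<lambda>u. f n (x + axis i u)) holomorphic_on cball 0 r"
        unfolding holomorphic_on_def
        by (rule ballI, rule field_differentiable_at_within, rule hol_fun_imp_separately[OF h], rule in_b) auto
      then show "continuous_on (cball 0 r) (\<lambda>u. f n (x + axis i u)) \<and>
        (\<lambda>u. f n (x + axis i u)) holomorphic_on ball 0 r"
        using holomorphic_on_imp_continuous_on holomorphic_on_subset ball_subset_cball by blast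
    qed
    show "uniform_limit (cball 0 r) (\<lambda>n u. f n (x + axis i u)) (\<lambda>u. g (x + axis i u)) sequentially"
      unfolding uniform_limit_iff
    proof (intro allI impI)
      fix e :: real assume "e > 0"
      with r(3) have "\<forall>\<^sub>F n in sequentially. \<forall>y\<in>cball x r. dist (f n y) (g y) < e"
        unfolding uniform_limit_iff by blast
      then show "\<forall>\<^sub>F n in sequentially. \<forall>u\<in>cball 0 r. dist (f n (x + axis i u)) (g (x + axis i u)) < e"
        by eventually_elim (use in_b in auto)
    qed
  qed auto
  then show "(\<lambda>u. g (x + axis i u)) field_differentiable (at 0)"
    using holomorphic_on_imp_differentiable_at[of _ "ball 0 r"] r by auto
qed

section \<open>Substitution into a single coordinate, and polydiscs\<close>

definition vec_upd :: "'a^'n \<Rightarrow> 'n \<Rightarrow> 'a \<Rightarrow> 'a^'n" where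
  "vec_upd x i a = (\<chi> j. if j = i then a else x $ j)"

lemma vec_upd_nth [simp]: "vec_upd x i a $ j = (if j = i then a else x $ j)"
  by (simp add: vec_upd_def)

lemma vec_upd_same [simp]: "vec_upd x i (x $ i) = x"
  by (simp add: vec_eq_iff)

lemma add_axis_eq_vec_upd: "x + axis i u = vec_upd x i (x $ i + u :: complex)"
  by (simp add: vec_eq_iff axis_def)

lemma vec_upd_eq_add_axis: "vec_upd x i u = vec_upd x i 0 + axis i (u :: complex)"
  by (simp add: vec_eq_iff axis_def)

lemma hol_map_vec_upd:
  assumes "holomorphic_fun_on g S"
  shows "holomorphic_map_on (\<lambda>x. vec_upd x i (g x)) S"
  unfolding holomorphic_map_on_def
proof
  show "holomorphic_fun_on (\<lambda>x. vec_upd x i (g x) $ j) S" for j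
    using assms by (cases "j = i") (simp_all add: hol_fun_nth)
qed

lemma continuous_on_vec_upd [continuous_intros]:
  fixes f :: "'a::topological_space \<Rightarrow> complex^'n"
  assumes "continuous_on S f" "continuous_on S g"
  shows "continuous_on S (\<lambda>x. vec_upd (f x) i (g x))"
proof -
  have "continuous_on S (\<lambda>x. if j = i then g x else f x $ j)" for j
    using assms by (cases "j = i") (auto intro: continuous_on_component)
  then show ?thesis unfolding vec_upd_def by (rule continuous_on_vec_lambda)
qed

lemma hol_fun_vec_upd:
  assumes "holomorphic_fun_on f S" "vec_upd x i u \<in> S"
  shows "(\<lambda>u. f (vec_upd x i u)) field_differentiable (at u)"
proof -
  have "vec_upd x i 0 + axis i u \<in> S"
    using assms(2) by (simp add: vec_upd_eq_add_axis[of x i u, symmetric])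
  from hol_fun_imp_separately[OF assms(1) this]
  have "(\<lambda>u. f (vec_upd x i 0 + axis i u)) field_differentiable (at u)" .
  then show ?thesis by (simp add: vec_upd_eq_add_axis[of x i, symmetric])
qed

lemma holomorphic_on_vec_upd:
  assumes "holomorphic_fun_on f S" "\<And>u. u \<in> A \<Longrightarrow> vec_upd x i u \<in> S"
  shows "(\<lambda>u. f (vec_upd x i u)) holomorphic_on A"
  unfolding holomorphic_on_def
  using field_differentiable_at_within hol_fun_vec_upd[OF assms(1)] assms(2) by blast

lemma open_polydisc: "open {x :: complex^'n. \<forall>j. j \<notin> J \<longrightarrow> norm (x $ j) < R}"
  unfolding Collect_all_eq
  by (intro open_INT ballI open_Collect_imp closed_Collect_const open_Collect_less continuous_intros) simp

lemma compact_polydisc: "compact {x :: complex^'n. \<forall>j. norm (x $ j) \<le> R}"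
proof -
  have "closed {x :: complex^'n. \<forall>j. norm (x $ j) \<le> R}"
    unfolding Collect_all_eq by (intro closed_INT ballI closed_Collect_le continuous_intros)
  moreover have "norm x \<le> real CARD('n) * R" if "\<forall>j. norm (x $ j) \<le> R" for x :: "complex^'n"
  proof -
    have "norm x \<le> (\<Sum>j\<in>UNIV. norm (x $ j))" unfolding norm_vec_def by (rule L2_set_le_sum) auto
    also have "\<dots> \<le> (\<Sum>j\<in>(UNIV::'n set). R)" by (rule sum_mono) (use that in auto)
    finally show ?thesis by simp
  qed
  then have "bounded {x :: complex^'n. \<forall>j. norm (x $ j) \<le> R}"
    by (intro boundedI[of _ "real CARD('n) * R"]) simp
  ultimately show ?thesis unfolding compact_eq_bounded_closed by auto
qed

section \<open>Approximation on polydiscs\<close>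

text \<open>On the circle \<open>c\<close> around \<open>0\<close> the derivative is
  \<open>2 pi \<i> c\<close>, so the constant \<open>2 pi \<i>\<close> cancels and the kernel
  \<open>1/(c - w)\<close> becomes \<open>c/(c - w)\<close>.\<close>

lemma cauchy_formula_vec_upd:
  fixes h :: "complex^'n \<Rightarrow> complex"
  assumes h: "holomorphic_fun_on h D" and r: "norm w < r"
    and D: "\<And>z. norm z \<le> r \<Longrightarrow> vec_upd x i z \<in> D"
  shows "((\<lambda>t. h (vec_upd x i (circlepath 0 r t)) * (circlepath 0 r t / (circlepath 0 r t - w)))
    has_integral h (vec_upd x i w)) {0..1}"
proof -
  let ?f = "\<lambda>z. h (vec_upd x i z)"
  have hol: "?f holomorphic_on cball 0 r"
    using D by (intro holomorphic_on_vec_upd[OF h]) auto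
  have "((\<lambda>u. ?f u / (u - w)) has_contour_integral (2 * of_real pi * \<i> * ?f w)) (circlepath 0 r)"
    using r holomorphic_on_imp_continuous_on[OF hol] holomorphic_on_subset[OF hol ball_subset_cball]
    by (intro Cauchy_integral_circlepath) auto
  then have "((\<lambda>t. ?f (circlepath 0 r t) / (circlepath 0 r t - w) * (2 * pi * \<i> * r * exp (2 * of_real pi * \<i> * t)))
      has_integral 2 * of_real pi * \<i> * ?f w) {0..1}"
    by (simp add: has_contour_integral vector_derivative_circlepath)
  from has_integral_mult_right[OF this, of "1 / (2 * of_real pi * \<i>)"]
  show ?thesis by (simp add: circlepath field_simps)
qed

text \<open>Truncating the Taylor series in \<open>x $ i\<close> frees this coordinate: the result
  is a polynomial in \<open>x $ i\<close>, whose coefficients are Cauchy integrals over that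
  coordinate and stay holomorphic in the others.\<close>

lemma taylor_step:
  fixes h :: "complex^'n \<Rightarrow> complex"
  assumes R: "0 < R" "R < R'" and h: "holomorphic_fun_on h {x. \<forall>j. j \<notin> J \<longrightarrow> norm (x $ j) < R'}"
    and e: "e > 0"
  shows "\<exists>h'. holomorphic_fun_on h' {x. \<forall>j. j \<notin> insert i J \<longrightarrow> norm (x $ j) < R'} \<and>
    (\<forall>x. (\<forall>j. norm (x $ j) \<le> R) \<longrightarrow> norm (h x - h' x) < e)"
proof -
  define D where "D = {x :: complex^'n. \<forall>j. j \<notin> J \<longrightarrow> norm (x $ j) < R'}"
  define D' where "D' = {x :: complex^'n. \<forall>j. j \<notin> insert i J \<longrightarrow> norm (x $ j) < R'}"
  define \<rho> where "\<rho> = (R + R') / 2"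
  have \<rho>: "R < \<rho>" "\<rho> < R'" "0 < \<rho>" using R by (auto simp: \<rho>_def)
  let ?c = "circlepath 0 \<rho>"
  have norm_c: "norm (?c t) = \<rho>" for t using \<rho> by (simp add: circlepath norm_mult)
  have c0: "?c t \<noteq> 0" for t using norm_c[of t] \<rho> by auto
  have cont_c: "continuous_on S (\<lambda>t. ?c (g t))" if "continuous_on S g" for S :: "'b::topological_space set" and g
    using that unfolding circlepath by (intro continuous_intros) auto
  define C where "C = (\<lambda>k x. integral {0..1} (\<lambda>t. h (vec_upd x i (?c t)) * inverse (?c t) ^ k))"
  have upd_D: "vec_upd x i u \<in> D" if "x \<in> D'" "norm u \<le> \<rho>" for x u
    using that \<rho> by (auto simp: D_def D'_def)
  have contD: "continuous_on D h" using h by (simp add: D_def hol_fun_continuous_on)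
  have cont1: "continuous_on (D' \<times> {0..1}) (\<lambda>q. h (vec_upd (fst q) i (?c (snd q))) * inverse (?c (snd q)) ^ k)" for k
  proof -
    have "continuous_on (D' \<times> {0..1}) (\<lambda>q. h (vec_upd (fst q) i (?c (snd q))))"
    proof (rule continuous_on_compose2[OF contD])
      show "continuous_on (D' \<times> {0..1}) (\<lambda>q. vec_upd (fst q) i (?c (snd q)))"
        by (intro continuous_intros cont_c)
      show "(\<lambda>q. vec_upd (fst q) i (?c (snd q))) ` (D' \<times> {0..1}) \<subseteq> D"
        using upd_D norm_c by fastforce
    qed
    moreover have "continuous_on (D' \<times> {0..1}) (\<lambda>q. ?c (snd q))"
      by (intro cont_c continuous_on_snd continuous_on_id)
    ultimately show ?thesis
      using c0 by (intro continuous_on_mult continuous_on_power continuous_on_inverse) auto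
  qed
  have holC: "holomorphic_fun_on (C k) D'" for k
    unfolding C_def
  proof (rule hol_fun_integral)
    show "open D'" unfolding D'_def by (rule open_polydisc)
    show "continuous_on (D' \<times> {0..1}) (\<lambda>(x, t). h (vec_upd x i (?c t)) * inverse (?c t) ^ k)"
      using cont1[of k] by (simp add: case_prod_unfold)
    show "holomorphic_fun_on (\<lambda>x. h (vec_upd x i (?c t)) * inverse (?c t) ^ k) D'" for t
    proof (rule hol_fun_mult[OF _ hol_fun_const])
      show "holomorphic_fun_on (\<lambda>x. h (vec_upd x i (?c t))) D'"
        by (rule hol_fun_compose[OF hol_map_vec_upd[OF hol_fun_const] h[folded D_def]])
           (auto intro!: upd_D simp: norm_c)
    qed
  qed
  define K where "K = {x :: complex^'n. \<forall>j. norm (x $ j) \<le> \<rho>}"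
  have "K \<subseteq> D" using \<rho>(2) unfolding K_def D_def by (blast intro: le_less_trans)
  moreover have "compact K" unfolding K_def by (rule compact_polydisc)
  ultimately obtain M where M: "M > 0" "\<And>x. x \<in> K \<Longrightarrow> norm (h x) \<le> M"
    using compact_image_bound continuous_on_subset[OF contD] by blast
  \<comment> \<open>Tail of the geometric series for the kernel \<open>c/(c - w)\<close> with
    \<open>|w| \<le> R\<close> and \<open>|c| = \<rho>\<close>, times the bound \<open>M\<close> for
    \<open>h\<close>.\<close>
  have "(\<lambda>m. M * (R / \<rho>) ^ m * (\<rho> / (\<rho> - R))) \<longlonglongrightarrow> M * 0 * (\<rho> / (\<rho> - R))"
    by (intro tendsto_intros LIMSEQ_power_zero) (use R \<rho> in auto)
  then have "eventually (\<lambda>m. M * (R / \<rho>) ^ m * (\<rho> / (\<rho> - R)) < e) sequentially"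
    using e by (simp add: order_tendstoD)
  then obtain m where m: "M * (R / \<rho>) ^ m * (\<rho> / (\<rho> - R)) < e"
    by (auto simp: eventually_sequentially)
  define h' where "h' = (\<lambda>x. \<Sum>k<m. C k x * (x $ i) ^ k)"
  have "holomorphic_fun_on h' D'" unfolding h'_def by (intro hol_intros holC)
  moreover have "norm (h x - h' x) < e" if x: "\<forall>j. norm (x $ j) \<le> R" for x
  proof -
    define w where "w = x $ i"
    have w: "norm w \<le> R" using x by (simp add: w_def)
    have xD: "x \<in> D'" using x R(2) unfolding D'_def by (blast intro: le_less_trans)
    have I1: "((\<lambda>t. h (vec_upd x i (?c t)) * (?c t / (?c t - w))) has_integral h x) {0..1}"
      using cauchy_formula_vec_upd[OF h[folded D_def], of w \<rho> x i] upd_D[OF xD] w \<rho>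
      by (simp add: w_def)
    have I2: "((\<lambda>t. h (vec_upd x i (?c t)) * inverse (?c t) ^ k) has_integral C k x) {0..1}" for k
    proof -
      have "continuous_on {0..1} (\<lambda>t. h (vec_upd x i (?c t)) * inverse (?c t) ^ k)"
      proof -
        have "continuous_on {0..1} (\<lambda>t. (x, t))"
          by (intro continuous_on_Pair continuous_on_const continuous_on_id)
        moreover have "(\<lambda>t. (x, t)) ` {0..1} \<subseteq> D' \<times> {0..1}" using xD by auto
        ultimately show ?thesis using continuous_on_compose2[OF cont1[of k]] by fastforce
      qed
      then show ?thesis unfolding C_def by (intro integrable_integral integrable_continuous_real)
    qed
    have "((\<lambda>t. h (vec_upd x i (?c t)) * (?c t / (?c t - w))
        - (\<Sum>k<m. h (vec_upd x i (?c t)) * inverse (?c t) ^ k * w ^ k)) has_integral h x - h' x) {0..1}"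
      unfolding h'_def w_def[symmetric]
      by (intro has_integral_diff has_integral_sum has_integral_mult_left I1 I2) auto
    then have "((\<lambda>t. h (vec_upd x i (?c t)) * (?c t / (?c t - w))
        - (\<Sum>k<m. h (vec_upd x i (?c t)) * inverse (?c t) ^ k * w ^ k)) has_integral h x - h' x) (cbox 0 1)"
      by simp
    then have "norm (h x - h' x) \<le> M * (R / \<rho>) ^ m * (\<rho> / (\<rho> - R)) * measure lborel (cbox 0 (1::real))"
    proof (rule has_integral_bound[rotated])
      show "0 \<le> M * (R / \<rho>) ^ m * (\<rho> / (\<rho> - R))" using M R \<rho> by auto
      fix t :: real
      define q where "q = w / ?c t"
      have q: "norm q \<le> R / \<rho>" using w \<rho> norm_c[of t] by (simp add: q_def norm_divide divide_right_mono)
      have q1: "q \<noteq> 1" using q \<rho> R by (auto simp: field_simps)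
      have wq: "w = q * ?c t" using c0 by (simp add: q_def)
      have fac: "?c t / (?c t - w) = 1 / (1 - q)"
      proof -
        have "?c t - w = ?c t * (1 - q)" by (simp add: wq algebra_simps)
        then show ?thesis using c0[of t] by simp
      qed
      have "(\<Sum>k<m. h (vec_upd x i (?c t)) * inverse (?c t) ^ k * w ^ k) = h (vec_upd x i (?c t)) * (\<Sum>k<m. q ^ k)"
        by (simp add: sum_distrib_left q_def power_mult_distrib divide_inverse power_inverse mult_ac)
      also have "\<dots> = h (vec_upd x i (?c t)) * ((1 - q ^ m) / (1 - q))"
        using q1 by (simp add: sum_gp_strict)
      finally have "h (vec_upd x i (?c t)) * (?c t / (?c t - w))
        - (\<Sum>k<m. h (vec_upd x i (?c t)) * inverse (?c t) ^ k * w ^ k) = h (vec_upd x i (?c t)) * (q ^ m / (1 - q))"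
        using q1 by (simp add: fac field_simps)
      also have "norm \<dots> = norm (h (vec_upd x i (?c t))) * (norm q ^ m * (1 / norm (1 - q)))"
        by (simp add: norm_mult norm_divide norm_power)
      also have "\<dots> \<le> M * ((R / \<rho>) ^ m * (\<rho> / (\<rho> - R)))"
      proof (intro mult_mono)
        show "norm (h (vec_upd x i (?c t))) \<le> M"
          using x norm_c by (intro M(2)) (auto simp: K_def intro: order_trans[OF _ less_imp_le[OF \<rho>(1)]])
        show "norm q ^ m \<le> (R / \<rho>) ^ m" using q by (intro power_mono) auto
        have "1 - R / \<rho> \<le> norm (1 - q)" using q norm_triangle_ineq2[of 1 q] by simp
        moreover have "1 - R / \<rho> > 0" using R \<rho> by simp
        ultimately have "1 / norm (1 - q) \<le> 1 / (1 - R / \<rho>)" by (intro divide_left_mono mult_pos_pos) auto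
        also have "\<dots> = \<rho> / (\<rho> - R)" using \<rho> by (simp add: field_simps)
        finally show "1 / norm (1 - q) \<le> \<rho> / (\<rho> - R)" .
      qed (use M R \<rho> in auto)
      finally show "norm (h (vec_upd x i (?c t)) * (?c t / (?c t - w))
        - (\<Sum>k<m. h (vec_upd x i (?c t)) * inverse (?c t) ^ k * w ^ k)) \<le> M * (R / \<rho>) ^ m * (\<rho> / (\<rho> - R))"
        by (simp add: mult.assoc)
    qed
    with m show ?thesis by simp
  qed
  ultimately show ?thesis unfolding D'_def by blast
qed

text \<open>Induction over the set of coordinates already freed. The claim is made for all
  tolerances, so that each use of \<open>taylor_step\<close> may spend half of the current
  one.\<close>

lemma runge_polydisc:
  fixes h :: "complex^'n \<Rightarrow> complex"
  assumes R: "0 < R" "R < R'" and h: "holomorphic_fun_on h {x. \<forall>j. norm (x $ j) < R'}" and e: "e > 0"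
  shows "\<exists>h'. holomorphic_fun_on h' UNIV \<and> (\<forall>x. (\<forall>j. norm (x $ j) \<le> R) \<longrightarrow> norm (h x - h' x) < e)"
proof -
  have "\<forall>e>0. \<exists>h'. holomorphic_fun_on h' {x. \<forall>j. j \<notin> J \<longrightarrow> norm (x $ j) < R'} \<and>
    (\<forall>x. (\<forall>j. norm (x $ j) \<le> R) \<longrightarrow> norm (h x - h' x) < e)" if "finite J" for J :: "'n set"
    using that
  proof (induction J)
    case empty
    then show ?case using h by (intro allI impI exI[of _ h]) auto
  next
    case (insert i J)
    show ?case
    proof (intro allI impI)
      fix e :: real assume e: "e > 0"
      then obtain h1 where h1: "holomorphic_fun_on h1 {x. \<forall>j. j \<notin> J \<longrightarrow> norm (x $ j) < R'}"
        "\<And>x. (\<forall>j. norm (x $ j) \<le> R) \<Longrightarrow> norm (h x - h1 x) < e / 2"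
        using insert.IH[rule_format, of "e / 2"] by auto
      obtain h2 where h2: "holomorphic_fun_on h2 {x. \<forall>j. j \<notin> insert i J \<longrightarrow> norm (x $ j) < R'}"
        "\<And>x. (\<forall>j. norm (x $ j) \<le> R) \<Longrightarrow> norm (h1 x - h2 x) < e / 2"
        using taylor_step[OF R h1(1), of "e / 2" i] e by auto
      have "norm (h x - h2 x) < e" if "\<forall>j. norm (x $ j) \<le> R" for x
        using norm_triangle_ineq[of "h x - h1 x" "h1 x - h2 x"] h1(2)[OF that] h2(2)[OF that] by simp
      with h2(1) show "\<exists>h'. holomorphic_fun_on h' {x. \<forall>j. j \<notin> insert i J \<longrightarrow> norm (x $ j) < R'} \<and>
        (\<forall>x. (\<forall>j. norm (x $ j) \<le> R) \<longrightarrow> norm (h x - h' x) < e)" by blast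
    qed
  qed
  from this[of UNIV] e show ?thesis by simp
qed

section \<open>The additive Cousin problem\<close>

text \<open>This integral is the contribution of one side to Cauchy's formula in coordinate
  \<open>i\<close>. It is holomorphic wherever \<open>x $ i\<close> avoids that side, even beyond
  the rectangle, which is why splitting by sides solves the Cousin problem.\<close>

lemma hol_fun_side_integral:
  fixes d :: "complex^'n \<Rightarrow> complex"
  assumes T: "open T" and d: "holomorphic_fun_on d W"
    and W: "\<And>x u. x \<in> T \<Longrightarrow> u \<in> closed_segment p q \<Longrightarrow> vec_upd x i u \<in> W \<and> u \<noteq> x $ i"
  shows "holomorphic_fun_on (\<lambda>x. integral {0..1} (\<lambda>t. d (vec_upd x i (linepath p q t)) *
    (inverse (linepath p q t - x $ i) * (q - p)))) T"
proof (rule hol_fun_integral[OF T])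
  have lp: "linepath p q t \<in> closed_segment p q" if "t \<in> {0..1}" for t
    using that by (simp add: linepath_in_path)
  have cont_lp: "continuous_on (T \<times> {0..1}) (\<lambda>z. linepath p q (snd z))"
    unfolding linepath_def by (intro continuous_intros)
  have "continuous_on (T \<times> {0..1}) (\<lambda>z. d (vec_upd (fst z) i (linepath p q (snd z))))"
  proof (rule continuous_on_compose2[OF hol_fun_continuous_on[OF d]])
    show "continuous_on (T \<times> {0..1}) (\<lambda>z. vec_upd (fst z) i (linepath p q (snd z)))"
      by (intro continuous_intros cont_lp)
    show "(\<lambda>z. vec_upd (fst z) i (linepath p q (snd z))) ` (T \<times> {0..1}) \<subseteq> W"
      using W lp by fastforce
  qed
  moreover have "continuous_on (T \<times> {0..1}) (\<lambda>z. linepath p q (snd z) - fst z $ i)"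
    by (intro continuous_intros cont_lp)
  ultimately have "continuous_on (T \<times> {0..1}) (\<lambda>z. d (vec_upd (fst z) i (linepath p q (snd z))) *
    (inverse (linepath p q (snd z) - fst z $ i) * (q - p)))"
    using W lp by (intro continuous_on_mult continuous_on_inverse continuous_on_const) force+
  then show "continuous_on (T \<times> {0..1}) (\<lambda>(x, t). d (vec_upd x i (linepath p q t)) *
    (inverse (linepath p q t - x $ i) * (q - p)))"
    by (simp add: case_prod_unfold)
  fix t :: real assume t: "t \<in> {0..1}"
  show "holomorphic_fun_on (\<lambda>x. d (vec_upd x i (linepath p q t)) * (inverse (linepath p q t - x $ i) * (q - p))) T"
  proof (rule hol_fun_mult)
    show "holomorphic_fun_on (\<lambda>x. d (vec_upd x i (linepath p q t))) T"
      by (rule hol_fun_compose[OF hol_map_vec_upd[OF hol_fun_const] d])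
         (use W lp[OF t] in auto)
    show "holomorphic_fun_on (\<lambda>x. inverse (linepath p q t - x $ i) * (q - p)) T"
      by (intro hol_intros) (use W lp[OF t] in auto)
  qed
qed

text \<open>Counterclockwise from the lower left: the segment from corner \<open>k\<close> to corner
  \<open>Suc k\<close> is the bottom, right, top and left side for \<open>k = 0, 1, 2, 3\<close>.
  The default value \<open>a\<close> serves both \<open>k = 0\<close> and \<open>k = 4\<close> and
  closes the path.\<close>

definition corner :: "complex \<Rightarrow> complex \<Rightarrow> nat \<Rightarrow> complex" where
  "corner a b k = (if k = 1 then Complex (Re b) (Im a) else if k = 2 then b
     else if k = 3 then Complex (Re a) (Im b) else a)"

text \<open>Cauchy's formula for \<open>rectpath\<close>, taken apart into the four parametrised
  integrals that \<open>hol_fun_side_integral\<close> can treat one by one.\<close>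

lemma cauchy_rectangle:
  assumes ab: "Re a < Re b" "Im a < Im b" and g: "g holomorphic_on cbox a b" and w: "w \<in> box a b"
  shows "(\<Sum>k<4. integral {0..1} (\<lambda>t. g (linepath (corner a b k) (corner a b (Suc k)) t) *
    (inverse (linepath (corner a b k) (corner a b (Suc k)) t - w) * (corner a b (Suc k) - corner a b k))))
    = 2 * of_real pi * \<i> * g w"
proof -
  let ?f = "\<lambda>u. g u / (u - w)"
  let ?l = "\<lambda>k. linepath (corner a b k) (corner a b (Suc k))"
  have rp: "rectpath a b = ?l 0 +++ ?l 1 +++ ?l 2 +++ ?l 3"
    by (simp add: rectpath_def corner_def Let_def)
  have img: "path_image (rectpath a b) \<subseteq> cbox a b - {w}"
    using path_image_rectpath_cbox_minus_box[of a b] ab w by auto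
  have "(?f has_contour_integral (complex_of_real (2 * pi) * \<i> * winding_number (rectpath a b) w * g w)) (rectpath a b)"
  proof (rule Cauchy_integral_formula_convex_simple[where S = "cbox a b"])
    show "w \<in> interior (cbox a b)" using w by (simp add: interior_cbox)
  qed (use g img in auto)
  then have 1: "contour_integral (rectpath a b) ?f = 2 * of_real pi * \<i> * g w"
    using winding_number_rectpath[OF w] by (simp add: contour_integral_unique)
  have "continuous_on (cbox a b - {w}) ?f"
    by (intro continuous_intros continuous_on_subset[OF holomorphic_on_imp_continuous_on[OF g]]) auto
  moreover have "closed_segment (corner a b k) (corner a b (Suc k)) \<subseteq> path_image (rectpath a b)" if "k < 4" for k
  proof -
    have "path_image (rectpath a b) = path_image (?l 0) \<union> (path_image (?l 1) \<union> (path_image (?l 2) \<union> path_image (?l 3)))"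
      unfolding rp by (simp add: path_image_join numeral_eq_Suc)
    moreover have "k = 0 \<or> k = 1 \<or> k = 2 \<or> k = 3" using that by auto
    ultimately show ?thesis
      by (elim disjE) (simp_all only: path_image_linepath, blast+)
  qed
  ultimately have int_k: "?f contour_integrable_on ?l k" if "k < 4" for k
    using that img
    by (intro contour_integrable_continuous_linepath) (meson continuous_on_subset order_trans)
  have int: "?f contour_integrable_on ?l 0" "?f contour_integrable_on ?l 1"
    "?f contour_integrable_on ?l 2" "?f contour_integrable_on ?l 3"
    using int_k[of 0] int_k[of 1] int_k[of 2] int_k[of 3] by simp_all
  have ends: "pathfinish (?l 2) = pathstart (?l 3)" "pathfinish (?l 1) = pathstart (?l 2)"
    "pathfinish (?l 0) = pathstart (?l 1)" by (simp_all add: numeral_eq_Suc)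
  have "contour_integral (rectpath a b) ?f = (\<Sum>k<4. contour_integral (?l k) ?f)"
    unfolding rp using int ends
    by (simp add: valid_path_join contour_integrable_joinI numeral_eq_Suc lessThan_Suc algebra_simps)
  also have "\<dots> = (\<Sum>k<4. integral {0..1} (\<lambda>t. g (?l k t) * (inverse (?l k t - w) * (corner a b (Suc k) - corner a b k))))"
    by (simp add: contour_integral_integral divide_inverse mult.assoc)
  finally show ?thesis using 1 by simp
qed

text \<open>
  The additive Cousin problem for two overlapping sets: split the boundary integral in the Cauchy
  formula for a rectangle into the sides that avoid the first set and those that avoid the second.
\<close>

lemma cousin_splitting:
  fixes d :: "complex^'n \<Rightarrow> complex"
  assumes ab: "Re a < Re b" "Im a < Im b"
    and d: "holomorphic_fun_on d W"
    and W: "\<And>x u. x \<in> T1 \<union> T2 \<Longrightarrow> u \<in> cbox a b \<Longrightarrow> vec_upd x i u \<in> W"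
    and T: "open T1" "open T2" and L: "L \<subseteq> {..<4}"
    and T1: "\<And>k x. k \<in> L \<Longrightarrow> x \<in> T1 \<Longrightarrow> x $ i \<notin> closed_segment (corner a b k) (corner a b (Suc k))"
    and T2: "\<And>k x. k < 4 \<Longrightarrow> k \<notin> L \<Longrightarrow> x \<in> T2 \<Longrightarrow> x $ i \<notin> closed_segment (corner a b k) (corner a b (Suc k))"
    and T12: "\<And>x. x \<in> T1 \<inter> T2 \<Longrightarrow> x $ i \<in> box a b"
  shows "\<exists>e1 e2. holomorphic_fun_on e1 T1 \<and> holomorphic_fun_on e2 T2 \<and> (\<forall>x\<in>T1 \<inter> T2. d x = e1 x - e2 x)"
proof -
  define I where "I = (\<lambda>k x. integral {0..1} (\<lambda>t. d (vec_upd x i (linepath (corner a b k) (corner a b (Suc k)) t)) *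
    (inverse (linepath (corner a b k) (corner a b (Suc k)) t - x $ i) * (corner a b (Suc k) - corner a b k))))"
  have corner_in: "corner a b k \<in> cbox a b" for k
    using ab by (auto simp: corner_def in_cbox_complex_iff)
  then have seg: "closed_segment (corner a b k) (corner a b (Suc k)) \<subseteq> cbox a b" for k
    by (intro closed_segment_subset) auto
  have I1: "holomorphic_fun_on (I k) T1" if "k \<in> L" for k
    unfolding I_def using T1[OF that] W seg[of k]
    by (intro hol_fun_side_integral[OF T(1) d]) auto
  have I2: "holomorphic_fun_on (I k) T2" if "k < 4" "k \<notin> L" for k
    unfolding I_def using T2[OF that] W seg[of k]
    by (intro hol_fun_side_integral[OF T(2) d]) auto
  let ?c = "1 / (2 * of_real pi * \<i>)"
  \<comment> \<open>The minus sign in \<open>?e2\<close> makes \<open>?e1 - ?e2\<close> the sum over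
    all four sides.\<close>
  let ?e1 = "\<lambda>x. ?c * (\<Sum>k\<in>L. I k x)" and ?e2 = "\<lambda>x. - (?c * (\<Sum>k\<in>{..<4} - L. I k x))"
  have "holomorphic_fun_on ?e1 T1" by (intro hol_intros I1)
  moreover have "holomorphic_fun_on ?e2 T2" by (intro hol_intros I2) auto
  moreover have "d x = ?e1 x - ?e2 x" if x: "x \<in> T1 \<inter> T2" for x
  proof -
    have "(\<lambda>u. d (vec_upd x i u)) holomorphic_on cbox a b"
      using W x by (intro holomorphic_on_vec_upd[OF d]) auto
    from cauchy_rectangle[OF ab this T12[OF x]]
    have "(\<Sum>k<4. I k x) = 2 * of_real pi * \<i> * d x" by (simp add: I_def)
    moreover have "(\<Sum>k<4. I k x) = (\<Sum>k\<in>L. I k x) + (\<Sum>k\<in>{..<4} - L. I k x)"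
      using L by (simp add: sum.subset_diff add.commute)
    ultimately have "d x = ?c * ((\<Sum>k\<in>L. I k x) + (\<Sum>k\<in>{..<4} - L. I k x))" by simp
    then show ?thesis by (simp only: diff_minus_eq_add distrib_left)
  qed
  ultimately show ?thesis by blast
qed

text \<open>Extension modulo \<open>p\<close>: \<open>G\<close> is meant to live on
  \<open>{F \<noteq> 0}\<close> only, and \<open>H\<close> continues its class modulo multiples of
  \<open>p\<close> to all of \<open>S\<close>. When \<open>F\<close> and \<open>p\<close> have no
  common zero, \<open>H\<close> equals \<open>G\<close> on the part of \<open>{p = 0}\<close> in
  \<open>S\<close>.\<close>

definition cousin_data ::
  "(complex^'n \<Rightarrow> complex) \<Rightarrow> (complex^'n \<Rightarrow> complex) \<Rightarrow> (complex^'n \<Rightarrow> complex) \<Rightarrow> (complex^'n) set \<Rightarrow> bool" where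
  "cousin_data F p G S \<longleftrightarrow> (\<exists>H q. holomorphic_fun_on H S \<and> holomorphic_fun_on q (S \<inter> {x. F x \<noteq> 0}) \<and>
     (\<forall>x\<in>S. F x \<noteq> 0 \<longrightarrow> H x = G x + p x * q x))"

lemma cousin_data_subset:
  assumes "cousin_data F p G S" "T \<subseteq> S"
  shows "cousin_data F p G T"
proof -
  obtain H q where "holomorphic_fun_on H S" "holomorphic_fun_on q (S \<inter> {x. F x \<noteq> 0})"
    and eq: "\<forall>x\<in>S. F x \<noteq> 0 \<longrightarrow> H x = G x + p x * q x"
    using assms(1) unfolding cousin_data_def by blast
  then have "holomorphic_fun_on H T" "holomorphic_fun_on q (T \<inter> {x. F x \<noteq> 0})"
    using assms(2) by (auto elim!: hol_fun_subset)
  then show ?thesis unfolding cousin_data_def using assms(2) eq by blast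
qed

lemma open_nonzero:
  assumes "holomorphic_fun_on F UNIV"
  shows "open {x. F x \<noteq> 0}"
  using hol_fun_continuous_on[OF assms] by (intro open_Collect_neq) auto

text \<open>The two trivial solutions: \<open>H = G\<close>, \<open>q = 0\<close> where
  \<open>F\<close> has no zero, and \<open>H = 0\<close>, \<open>q = - G / p\<close> where
  \<open>p\<close> has none.\<close>

lemma cousin_data_local:
  assumes "holomorphic_fun_on p UNIV" "holomorphic_fun_on G {x. F x \<noteq> 0}"
    and "S \<subseteq> {x. F x \<noteq> 0} \<or> S \<subseteq> {x. p x \<noteq> 0}"
  shows "cousin_data F p G S"
  using assms(3)
proof
  assume "S \<subseteq> {x. F x \<noteq> 0}"
  then show ?thesis unfolding cousin_data_def
    using hol_fun_subset[OF assms(2)] hol_fun_const[of 0]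
    by (intro exI[of _ G] exI[of _ "\<lambda>_. 0"]) auto
next
  assume S: "S \<subseteq> {x. p x \<noteq> 0}"
  have "holomorphic_fun_on (\<lambda>x. - G x / p x) (S \<inter> {x. F x \<noteq> 0})"
    by (intro hol_intros hol_fun_subset[OF assms(2)] hol_fun_subset[OF assms(1)]) (use S in auto)
  then show ?thesis unfolding cousin_data_def
    using S hol_fun_const[of 0 S]
    by (intro exI[of _ "\<lambda>_. 0"] exI[of _ "\<lambda>x. - G x / p x"]) auto
qed

text \<open>Two solutions differ by \<open>H1 - H2 = p * d\<close> with \<open>d\<close> holomorphic
  on the overlap. Writing \<open>d = e1 - e2\<close> by \<open>cousin_splitting\<close>, the
  corrected solutions \<open>H1 - p * e1\<close> and \<open>H2 - p * e2\<close> agree on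
  \<open>T1 \<inter> T2\<close>.\<close>

lemma cousin_merge:
  fixes F p G :: "complex^'n \<Rightarrow> complex"
  assumes F: "holomorphic_fun_on F UNIV" and p: "holomorphic_fun_on p UNIV"
    and Fp: "\<And>x. F x \<noteq> 0 \<or> p x \<noteq> 0"
    and S: "open S1" "open S2" "cousin_data F p G S1" "cousin_data F p G S2"
    and T: "open T1" "open T2" "T1 \<subseteq> S1" "T2 \<subseteq> S2"
    and ab: "Re a < Re b" "Im a < Im b"
    and W: "\<And>x u. x \<in> T1 \<union> T2 \<Longrightarrow> u \<in> cbox a b \<Longrightarrow> vec_upd x i u \<in> S1 \<inter> S2"
    and L: "L \<subseteq> {..<4}"
    and T1: "\<And>k x. k \<in> L \<Longrightarrow> x \<in> T1 \<Longrightarrow> x $ i \<notin> closed_segment (corner a b k) (corner a b (Suc k))"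
    and T2: "\<And>k x. k < 4 \<Longrightarrow> k \<notin> L \<Longrightarrow> x \<in> T2 \<Longrightarrow> x $ i \<notin> closed_segment (corner a b k) (corner a b (Suc k))"
    and T12: "\<And>x. x \<in> T1 \<inter> T2 \<Longrightarrow> x $ i \<in> box a b"
  shows "cousin_data F p G (T1 \<union> T2)"
proof -
  let ?Y = "{x. F x \<noteq> 0}"
  obtain H1 q1 where 1: "holomorphic_fun_on H1 S1" "holomorphic_fun_on q1 (S1 \<inter> ?Y)"
    "\<And>x. x \<in> S1 \<Longrightarrow> F x \<noteq> 0 \<Longrightarrow> H1 x = G x + p x * q1 x"
    using S(3) unfolding cousin_data_def by blast
  obtain H2 q2 where 2: "holomorphic_fun_on H2 S2" "holomorphic_fun_on q2 (S2 \<inter> ?Y)"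
    "\<And>x. x \<in> S2 \<Longrightarrow> F x \<noteq> 0 \<Longrightarrow> H2 x = G x + p x * q2 x"
    using S(4) unfolding cousin_data_def by blast
  define d where "d = (\<lambda>x. if F x \<noteq> 0 then q1 x - q2 x else (H1 x - H2 x) / p x)"
  have d_eq: "H1 x - H2 x = p x * d x" if "x \<in> S1 \<inter> S2" for x
  proof (cases "F x = 0")
    case True
    then show ?thesis using Fp[of x] by (simp add: d_def)
  next
    case False
    then show ?thesis using that 1(3)[of x] 2(3)[of x] by (simp add: d_def algebra_simps)
  qed
  have "holomorphic_fun_on d ((S1 \<inter> S2) \<inter> ?Y)"
  proof (rule hol_fun_cong)
    show "holomorphic_fun_on (\<lambda>x. q1 x - q2 x) ((S1 \<inter> S2) \<inter> ?Y)"
      by (intro hol_fun_diff hol_fun_subset[OF 1(2)] hol_fun_subset[OF 2(2)]) auto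
  qed (use S open_nonzero[OF F] in \<open>auto simp: d_def\<close>)
  moreover have "holomorphic_fun_on d ((S1 \<inter> S2) \<inter> {x. p x \<noteq> 0})"
  proof (rule hol_fun_cong)
    show "holomorphic_fun_on (\<lambda>x. (H1 x - H2 x) / p x) ((S1 \<inter> S2) \<inter> {x. p x \<noteq> 0})"
      by (intro hol_intros hol_fun_subset[OF 1(1)] hol_fun_subset[OF 2(1)] hol_fun_subset[OF p]) auto
  qed (use S open_nonzero[OF p] d_eq in auto)
  ultimately have "holomorphic_fun_on d (((S1 \<inter> S2) \<inter> ?Y) \<union> ((S1 \<inter> S2) \<inter> {x. p x \<noteq> 0}))"
    by (rule holomorphic_fun_on_Un)
  then have d: "holomorphic_fun_on d (S1 \<inter> S2)"
    by (rule hol_fun_subset) (use Fp in auto)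
  obtain e1 e2 where e: "holomorphic_fun_on e1 T1" "holomorphic_fun_on e2 T2"
    "\<And>x. x \<in> T1 \<inter> T2 \<Longrightarrow> d x = e1 x - e2 x"
    using cousin_splitting[OF ab d W T(1,2) L T1 T2 T12] by blast
  define H where "H = (\<lambda>x. if x \<in> T1 then H1 x - p x * e1 x else H2 x - p x * e2 x)"
  define q where "q = (\<lambda>x. if x \<in> T1 then q1 x - e1 x else q2 x - e2 x)"
  have "holomorphic_fun_on H T1"
  proof (rule hol_fun_cong[OF _ T(1)])
    show "holomorphic_fun_on (\<lambda>x. H1 x - p x * e1 x) T1"
      by (intro hol_intros hol_fun_subset[OF 1(1)] hol_fun_subset[OF p] e(1)) (use T in auto)
  qed (simp add: H_def)
  moreover have "holomorphic_fun_on H T2"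
  proof (rule hol_fun_cong[OF _ T(2)])
    show "holomorphic_fun_on (\<lambda>x. H2 x - p x * e2 x) T2"
      by (intro hol_intros hol_fun_subset[OF 2(1)] hol_fun_subset[OF p] e(2)) (use T in auto)
    fix x assume x: "x \<in> T2"
    show "H2 x - p x * e2 x = H x"
    proof (cases "x \<in> T1")
      case True
      then have "H1 x - H2 x = p x * (e1 x - e2 x)" using d_eq[of x] e(3)[of x] x T by auto
      then show ?thesis using True by (simp add: H_def algebra_simps)
    qed (simp add: H_def)
  qed
  ultimately have H: "holomorphic_fun_on H (T1 \<union> T2)" by (rule holomorphic_fun_on_Un)
  have oT: "open (T1 \<inter> ?Y)" "open (T2 \<inter> ?Y)" using T open_nonzero[OF F] by auto
  have "holomorphic_fun_on q (T1 \<inter> ?Y)"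
  proof (rule hol_fun_cong[OF _ oT(1)])
    show "holomorphic_fun_on (\<lambda>x. q1 x - e1 x) (T1 \<inter> ?Y)"
      by (intro hol_fun_diff hol_fun_subset[OF 1(2)] hol_fun_subset[OF e(1)])
        (use T in auto)
  qed (simp add: q_def)
  moreover have "holomorphic_fun_on q (T2 \<inter> ?Y)"
  proof (rule hol_fun_cong[OF _ oT(2)])
    show "holomorphic_fun_on (\<lambda>x. q2 x - e2 x) (T2 \<inter> ?Y)"
      by (intro hol_fun_diff hol_fun_subset[OF 2(2)] hol_fun_subset[OF e(2)])
        (use T in auto)
    fix x assume x: "x \<in> T2 \<inter> ?Y"
    show "q2 x - e2 x = q x"
    proof (cases "x \<in> T1")
      case True
      then have "q1 x - q2 x = e1 x - e2 x" using e(3)[of x] x by (simp add: d_def)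
      then show ?thesis using True by (simp add: q_def algebra_simps)
    qed (simp add: q_def)
  qed
  ultimately have "holomorphic_fun_on q ((T1 \<inter> ?Y) \<union> (T2 \<inter> ?Y))" by (rule holomorphic_fun_on_Un)
  then have q: "holomorphic_fun_on q ((T1 \<union> T2) \<inter> ?Y)" by (simp add: Int_Un_distrib2)
  have "H x = G x + p x * q x" if "x \<in> T1 \<union> T2" "F x \<noteq> 0" for x
    using that 1(3)[of x] 2(3)[of x] T by (auto simp: H_def q_def algebra_simps)
  with H q show ?thesis unfolding cousin_data_def by blast
qed

text \<open>
  Boxes are given by bounds for the real coordinates: \<open>(j, True)\<close> stands for the real and
  \<open>(j, False)\<close> for the imaginary part of the \<open>j\<close>-th coordinate.
\<close>

definition obox :: "real \<Rightarrow> ('n \<times> bool \<Rightarrow> real) \<Rightarrow> ('n \<times> bool \<Rightarrow> real) \<Rightarrow> (complex^'n) set" where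
  "obox r lo hi = {x. \<forall>j. lo (j, True) - r < Re (x $ j) \<and> Re (x $ j) < hi (j, True) + r \<and>
     lo (j, False) - r < Im (x $ j) \<and> Im (x $ j) < hi (j, False) + r}"

lemma open_obox: "open (obox r lo hi)"
  unfolding obox_def Collect_all_eq
  by (intro open_INT ballI open_Collect_conj open_Collect_less continuous_intros) simp

lemma obox_subset:
  assumes "\<And>d. lo' d - r' \<le> lo d - r \<and> hi d + r \<le> hi' d + r'"
  shows "obox r lo hi \<subseteq> obox r' lo' hi'"
proof
  fix x assume x: "x \<in> obox r lo hi"
  show "x \<in> obox r' lo' hi'"
    unfolding obox_def mem_Collect_eq
  proof
    fix j
    have "lo (j, True) - r < Re (x $ j) \<and> Re (x $ j) < hi (j, True) + r \<and>
       lo (j, False) - r < Im (x $ j) \<and> Im (x $ j) < hi (j, False) + r"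
      using x unfolding obox_def by blast
    then show "lo' (j, True) - r' < Re (x $ j) \<and> Re (x $ j) < hi' (j, True) + r' \<and>
       lo' (j, False) - r' < Im (x $ j) \<and> Im (x $ j) < hi' (j, False) + r'"
      using assms[of "(j, True)"] assms[of "(j, False)"] by linarith
  qed
qed

lemma obox_mono: "r \<le> r' \<Longrightarrow> obox r lo hi \<subseteq> obox r' lo hi"
  by (rule obox_subset) simp

lemma vec_upd_mem_obox:
  assumes x: "x \<in> obox r' lo hi" "r' \<le> r"
    and eq: "\<And>j e. j \<noteq> i \<Longrightarrow> lo' (j, e) = lo (j, e) \<and> hi' (j, e) = hi (j, e)"
    and z: "lo' (i, True) - r < Re u" "Re u < hi' (i, True) + r"
      "lo' (i, False) - r < Im u" "Im u < hi' (i, False) + r"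
  shows "vec_upd x i u \<in> obox r lo' hi'"
  unfolding obox_def mem_Collect_eq
proof
  fix j
  have *: "lo (j, True) - r' < Re (x $ j) \<and> Re (x $ j) < hi (j, True) + r' \<and>
     lo (j, False) - r' < Im (x $ j) \<and> Im (x $ j) < hi (j, False) + r'"
    using x(1) unfolding obox_def by blast
  show "lo' (j, True) - r < Re (vec_upd x i u $ j) \<and> Re (vec_upd x i u $ j) < hi' (j, True) + r \<and>
     lo' (j, False) - r < Im (vec_upd x i u $ j) \<and> Im (vec_upd x i u $ j) < hi' (j, False) + r"
  proof (cases "j = i")
    case True
    then show ?thesis using z by simp
  next
    case False
    then show ?thesis using * eq[of j] x(2) by auto
  qed
qed

text \<open>With margin \<open>r / 2\<close> the two halves overlap in a strip of width
  \<open>r\<close> around the cut, and the rectangle for Cauchy's formula stays in the common domain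
  of the two solutions with margin \<open>r\<close>. Gluing thus costs half the margin.\<close>

lemma cousin_data_bisect:
  fixes F p G :: "complex^'n \<Rightarrow> complex"
  assumes F: "holomorphic_fun_on F UNIV" and p: "holomorphic_fun_on p UNIV"
    and Fp: "\<And>x. F x \<noteq> 0 \<or> p x \<noteq> 0" and r: "r > 0"
    and lohi: "\<And>d. lo d \<le> hi d" and c: "lo d \<le> c" "c \<le> hi d"
    and S: "cousin_data F p G (obox r lo (hi(d := c)))" "cousin_data F p G (obox r (lo(d := c)) hi)"
  shows "cousin_data F p G (obox (r / 2) lo hi)"
proof -
  obtain i b where d: "d = (i, b)" by force
  let ?T1 = "obox (r / 2) lo (hi(d := c))" and ?T2 = "obox (r / 2) (lo(d := c)) hi"
  have sub: "obox (r / 2) lo hi \<subseteq> ?T1 \<union> ?T2"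
  proof
    fix x :: "complex^'n" assume x: "x \<in> obox (r / 2) lo hi"
    define y where "y = (if b then Re (x $ i) else Im (x $ i))"
    show "x \<in> ?T1 \<union> ?T2"
    proof (cases "y < c + r / 2")
      case True
      then have "x \<in> ?T1" using x by (auto simp: obox_def d y_def split: if_splits)
      then show ?thesis by blast
    next
      case False
      then have "x \<in> ?T2" using x r by (auto simp: obox_def d y_def split: if_splits)
      then show ?thesis by blast
    qed
  qed
  have obox_upd: "?T1 \<subseteq> obox (r / 2) lo hi" "?T2 \<subseteq> obox (r / 2) lo hi"
    using c by (auto intro!: obox_subset)
  have le1: "lo (j, e) \<le> hi (j, e)" for j e using lohi .
  \<comment> \<open>The rectangle spans the overlap in direction \<open>d\<close> and the whole box
    in the other real coordinate of \<open>x $ i\<close>. \<open>?L\<close> lists the three sides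
    missed by \<open>?T1\<close>; the remaining one, left (\<open>3\<close>) for a cut of the real
    part and bottom (\<open>0\<close>) for a cut of the imaginary part, is missed by
    \<open>?T2\<close>.\<close>
  let ?a = "if b then Complex (c - r / 2) (lo (i, False) - r / 2) else Complex (lo (i, True) - r / 2) (c - r / 2)"
    and ?b = "if b then Complex (c + r / 2) (hi (i, False) + r / 2) else Complex (hi (i, True) + r / 2) (c + r / 2)"
    and ?L = "if b then {0, 1, 2} else {1, 2, 3 :: nat}"
  have "cousin_data F p G (?T1 \<union> ?T2)"
  proof (rule cousin_merge[OF F p Fp open_obox open_obox S open_obox open_obox, where a = ?a and b = ?b and L = ?L and i = i])
    show "Re ?a < Re ?b" "Im ?a < Im ?b" using r le1[of i True] le1[of i False] by auto
    fix x :: "complex^'n" and u assume x: "x \<in> ?T1 \<union> ?T2" and z: "u \<in> cbox ?a ?b"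
    have "x \<in> obox (r / 2) lo hi" using x obox_upd by blast
    then show "vec_upd x i u \<in> obox r lo (hi(d := c)) \<inter> obox r (lo(d := c)) hi"
      using z r c d
      by (intro IntI vec_upd_mem_obox[where r' = "r / 2" and lo = lo and hi = hi])
         (auto simp: in_cbox_complex_iff split: if_splits)
  next
    fix k :: nat and x :: "complex^'n" assume "k \<in> ?L" "x \<in> ?T1"
    then show "x $ i \<notin> closed_segment (corner ?a ?b k) (corner ?a ?b (Suc k))"
      using d by (auto simp: corner_def obox_def closed_segment_same_Re closed_segment_same_Im dest: spec[of _ i] split: if_splits)
  next
    fix k :: nat and x :: "complex^'n" assume k: "k < 4" "k \<notin> ?L" "x \<in> ?T2"
    then have "k = (if b then 3 else 0)" by (auto split: if_splits)
    then show "x $ i \<notin> closed_segment (corner ?a ?b k) (corner ?a ?b (Suc k))"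
      using d k(3) by (auto simp: corner_def obox_def closed_segment_same_Re closed_segment_same_Im dest: spec[of _ i] split: if_splits)
  next
    fix x :: "complex^'n" assume "x \<in> ?T1 \<inter> ?T2"
    then show "x $ i \<in> box ?a ?b"
      using d by (auto simp: obox_def in_box_complex_iff dest: spec[of _ i])
  qed (use r in \<open>auto intro!: obox_mono\<close>)
  then show ?thesis by (rule cousin_data_subset[OF _ sub])
qed

text \<open>The box is cut into boxes small enough for \<open>cousin_data_local\<close> and
  reassembled by bisection. This takes a double induction: over the set of real coordinates in which
  a box may be longer than \<open>s\<close>, and over the number of pieces of length
  \<open>s\<close> in one of them.\<close>

lemma cousin_data_box:
  fixes F p G :: "complex^'n \<Rightarrow> complex"
  assumes F: "holomorphic_fun_on F UNIV" and p: "holomorphic_fun_on p UNIV"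
    and G: "holomorphic_fun_on G {x. F x \<noteq> 0}"
    and Fp: "\<And>x. F x \<noteq> 0 \<or> p x \<noteq> 0" and R: "R \<ge> 0"
  shows "\<exists>r>0. cousin_data F p G (obox r (\<lambda>_. - R) (\<lambda>_. R))"
proof -
  define S where "S = {x :: complex^'n. \<forall>j. norm (x $ j) \<le> 2 * (R + 1)}"
  obtain \<delta> where \<delta>: "\<delta> > 0"
    "\<And>T. T \<subseteq> S \<Longrightarrow> diameter T < \<delta> \<Longrightarrow> \<exists>B\<in>{{x. F x \<noteq> 0}, {x. p x \<noteq> 0}}. T \<subseteq> B"
  proof (rule Lebesgue_number_lemma[of S "{{x. F x \<noteq> 0}, {x. p x \<noteq> 0}}"])
    show "S \<subseteq> \<Union>{{x. F x \<noteq> 0}, {x. p x \<noteq> 0}}" using Fp by auto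
  qed (use open_nonzero[OF F] open_nonzero[OF p] in \<open>auto simp: S_def compact_polydisc\<close>)
  \<comment> \<open>With side lengths and margin at most \<open>s\<close>, the real and imaginary
    parts of each coordinate vary by at most \<open>3 * s\<close>. The diameter is then at most
    \<open>6 * s\<close> times the dimension, which has to stay below the Lebesgue number
    \<open>\<delta>\<close>.\<close>
  define s where "s = min 1 (\<delta> / (6 * real CARD('n) + 1))"
  have s: "0 < s" "s \<le> 1" using \<delta>(1) by (auto simp: s_def)
  have "s \<le> \<delta> / (6 * real CARD('n) + 1)" by (simp add: s_def)
  then have "s * (6 * real CARD('n) + 1) \<le> \<delta>"
    using pos_le_divide_eq[of "6 * real CARD('n) + 1" s \<delta>] by simp
  then have s\<delta>: "6 * s * real CARD('n) < \<delta>" using s(1) by (simp add: algebra_simps)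
  have small: "cousin_data F p G (obox s lo hi)"
    if lohi: "\<And>d. - R \<le> lo d" "\<And>d. hi d \<le> R" "\<And>d. hi d - lo d \<le> s"
    for lo hi :: "'n \<times> bool \<Rightarrow> real"
  proof -
    have bd: "lo (j, True) - s < Re (x $ j) \<and> Re (x $ j) < hi (j, True) + s \<and>
       lo (j, False) - s < Im (x $ j) \<and> Im (x $ j) < hi (j, False) + s" if "x \<in> obox s lo hi" for x j
      using that unfolding obox_def by blast
    have "obox s lo hi \<subseteq> S"
    proof
      fix x assume x: "x \<in> obox s lo hi"
      have "norm (x $ j) \<le> 2 * (R + 1)" for j
      proof -
        have "\<bar>Re (x $ j)\<bar> \<le> R + 1" using bd[OF x, of j] lohi(1,2)[of "(j, True)"] s by linarith
        moreover have "\<bar>Im (x $ j)\<bar> \<le> R + 1" using bd[OF x, of j] lohi(1,2)[of "(j, False)"] s by linarith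
        ultimately show ?thesis using cmod_le[of "x $ j"] by simp
      qed
      then show "x \<in> S" by (simp add: S_def)
    qed
    moreover have "diameter (obox s lo hi) < \<delta>"
    proof (rule le_less_trans[OF diameter_le s\<delta>])
      fix x y assume xy: "x \<in> obox s lo hi" "y \<in> obox s lo hi"
      have "norm ((x - y) $ j) \<le> 6 * s" for j
      proof -
        have "\<bar>Re (x $ j) - Re (y $ j)\<bar> \<le> 3 * s"
          using bd[OF xy(1), of j] bd[OF xy(2), of j] lohi(3)[of "(j, True)"] by linarith
        moreover have "\<bar>Im (x $ j) - Im (y $ j)\<bar> \<le> 3 * s"
          using bd[OF xy(1), of j] bd[OF xy(2), of j] lohi(3)[of "(j, False)"] by linarith
        ultimately show ?thesis using cmod_le[of "(x - y) $ j"] by simp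
      qed
      then have "(\<Sum>j\<in>UNIV. norm ((x - y) $ j)) \<le> (\<Sum>j\<in>(UNIV :: 'n set). 6 * s)" by (intro sum_mono)
      moreover have "norm (x - y) \<le> (\<Sum>j\<in>UNIV. norm ((x - y) $ j))"
        unfolding norm_vec_def by (rule L2_set_le_sum) auto
      ultimately show "norm (x - y) \<le> 6 * s * real CARD('n)" by (simp add: mult.commute)
    qed (use s in auto)
    ultimately have "\<exists>B\<in>{{x. F x \<noteq> 0}, {x. p x \<noteq> 0}}. obox s lo hi \<subseteq> B" by (rule \<delta>(2))
    then show ?thesis by (intro cousin_data_local[OF p G]) auto
  qed
  define adm where "adm = (\<lambda>lo hi :: 'n \<times> bool \<Rightarrow> real. \<forall>d. - R \<le> lo d \<and> lo d \<le> hi d \<and> hi d \<le> R)"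
  have grid: "\<forall>lo hi. adm lo hi \<longrightarrow> (\<forall>d. d \<notin> D \<longrightarrow> hi d - lo d \<le> s)
      \<longrightarrow> (\<exists>r>0. cousin_data F p G (obox r lo hi))" if "finite D" for D :: "('n \<times> bool) set"
    using that
  proof (induction D)
    case empty
    then show ?case using small s(1) unfolding adm_def by blast
  next
    case (insert d D)
    have step: "\<forall>lo hi. adm lo hi \<longrightarrow> (\<forall>d'. d' \<notin> insert d D \<longrightarrow> hi d' - lo d' \<le> s)
      \<longrightarrow> hi d - lo d \<le> s * real k \<longrightarrow> (\<exists>r>0. cousin_data F p G (obox r lo hi))" for k
    proof (induction k)
      case 0
      show ?case
      proof (intro allI impI)
        fix lo hi :: "'n \<times> bool \<Rightarrow> real"
        assume 1: "adm lo hi"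
          and 2: "\<forall>d'. d' \<notin> insert d D \<longrightarrow> hi d' - lo d' \<le> s" "hi d - lo d \<le> s * real 0"
        have "\<forall>d'. d' \<notin> D \<longrightarrow> hi d' - lo d' \<le> s"
        proof (intro allI impI)
          fix d' assume "d' \<notin> D"
          then show "hi d' - lo d' \<le> s" using 2(1)[rule_format, of d'] 2(2) s(1) by (cases "d' = d") simp_all
        qed
        then show "\<exists>r>0. cousin_data F p G (obox r lo hi)" using insert.IH 1 by blast
      qed
    next
      case (Suc k)
      show ?case
      proof (intro allI impI)
        fix lo hi :: "'n \<times> bool \<Rightarrow> real"
        assume 1: "adm lo hi"
          and 2: "\<forall>d'. d' \<notin> insert d D \<longrightarrow> hi d' - lo d' \<le> s" "hi d - lo d \<le> s * real (Suc k)"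
        \<comment> \<open>Cuts off a last piece of length at most \<open>s\<close>, which the outer
          induction hypothesis covers since \<open>d\<close> is no longer long; the rest is one
          piece shorter and falls to the inner one.\<close>
        define c where "c = max (lo d) (hi d - s)"
        have c: "lo d \<le> c" "c \<le> hi d" "hi d - c \<le> s" using 1[unfolded adm_def, rule_format, of d] s(1) by (auto simp: c_def)
        have ck: "c - lo d \<le> s * real k" using 2(2) s(1) by (auto simp: c_def algebra_simps max_def)
        let ?h = "hi(d := c)" and ?l = "lo(d := c)"
        have a1: "adm lo ?h" using 1 c by (auto simp: adm_def intro: order_trans)
        have "\<forall>d'. d' \<notin> insert d D \<longrightarrow> ?h d' - lo d' \<le> s" "?h d - lo d \<le> s * real k"
          using 2(1) ck by simp_all
        then obtain r1 where r1: "r1 > 0" "cousin_data F p G (obox r1 lo ?h)"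
          using Suc.IH a1 by blast
        have a2: "adm ?l hi" using 1 c by (auto simp: adm_def intro: order_trans)
        have "\<forall>d'. d' \<notin> D \<longrightarrow> hi d' - ?l d' \<le> s"
        proof (intro allI impI)
          fix d' assume "d' \<notin> D"
          then show "hi d' - ?l d' \<le> s" using 2(1)[rule_format, of d'] c(3) by (cases "d' = d") simp_all
        qed
        then obtain r2 where r2: "r2 > 0" "cousin_data F p G (obox r2 ?l hi)"
          using insert.IH a2 by blast
        define r where "r = min r1 r2"
        have r: "r > 0" using r1 r2 by (simp add: r_def)
        have "cousin_data F p G (obox (r / 2) lo hi)"
        proof (rule cousin_data_bisect[where d = d and c = c, OF F p Fp r])
          show "cousin_data F p G (obox r lo ?h)"
            by (rule cousin_data_subset[OF r1(2) obox_mono]) (simp add: r_def)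
          show "cousin_data F p G (obox r ?l hi)"
            by (rule cousin_data_subset[OF r2(2) obox_mono]) (simp add: r_def)
        qed (use 1 c in \<open>auto simp: adm_def\<close>)
        then show "\<exists>r>0. cousin_data F p G (obox r lo hi)" using r by (intro exI[of _ "r / 2"]) simp
      qed
    qed
    show ?case
    proof (intro allI impI)
      fix lo hi :: "'n \<times> bool \<Rightarrow> real"
      assume 1: "adm lo hi"
        and 2: "\<forall>d'. d' \<notin> insert d D \<longrightarrow> hi d' - lo d' \<le> s"
      obtain k :: nat where "(hi d - lo d) / s \<le> real k" using real_arch_simple by blast
      then have "hi d - lo d \<le> s * real k" using s(1) by (simp add: pos_divide_le_eq mult.commute)
      then show "\<exists>r>0. cousin_data F p G (obox r lo hi)" using step[of k] 1 2 by blast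
    qed
  qed
  show ?thesis using grid[of UNIV] R by (simp add: adm_def)
qed

text \<open>
  Oka's trick: a holomorphic function on \<open>{F \<noteq> 0}\<close> becomes approximable by entire functions once it is
  restricted to a closed hypersurface \<open>{p = 0}\<close> inside \<open>{F \<noteq> 0}\<close>; below \<open>p\<close> is \<open>F t - 1\<close> with an
  additional variable \<open>t\<close>.
\<close>

lemma oka_approximation:
  fixes F p G :: "complex^'n \<Rightarrow> complex"
  assumes F: "holomorphic_fun_on F UNIV" and p: "holomorphic_fun_on p UNIV"
    and G: "holomorphic_fun_on G {x. F x \<noteq> 0}"
    and Fp: "\<And>x. F x \<noteq> 0 \<or> p x \<noteq> 0" and R: "R > 0" and e: "e > 0"
  shows "\<exists>h. holomorphic_fun_on h UNIV \<and> (\<forall>x. (\<forall>j. norm (x $ j) \<le> R) \<longrightarrow> p x = 0 \<longrightarrow> norm (G x - h x) < e)"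
proof -
  \<comment> \<open>Twice the radius leaves room for \<open>runge_polydisc\<close>, which passes
    from \<open>2 * R\<close> to \<open>R\<close>.\<close>
  obtain r where r: "r > 0" "cousin_data F p G (obox r (\<lambda>_. - (2 * R)) (\<lambda>_. 2 * R))"
    using cousin_data_box[OF F p G Fp, of "2 * R"] R by auto
  have sub: "{x :: complex^'n. \<forall>j. norm (x $ j) < 2 * R} \<subseteq> obox r (\<lambda>_. - (2 * R)) (\<lambda>_. 2 * R)"
  proof
    fix x :: "complex^'n" assume x: "x \<in> {x. \<forall>j. norm (x $ j) < 2 * R}"
    show "x \<in> obox r (\<lambda>_. - (2 * R)) (\<lambda>_. 2 * R)"
      unfolding obox_def mem_Collect_eq
    proof
      fix j
      have "norm (x $ j) < 2 * R" using x by simp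
      then show "- (2 * R) - r < Re (x $ j) \<and> Re (x $ j) < 2 * R + r \<and>
        - (2 * R) - r < Im (x $ j) \<and> Im (x $ j) < 2 * R + r"
        using abs_Re_le_cmod[of "x $ j"] abs_Im_le_cmod[of "x $ j"] r(1) by linarith
    qed
  qed
  obtain H q where H: "holomorphic_fun_on H {x. \<forall>j. norm (x $ j) < 2 * R}"
    "\<And>x. x \<in> {x. \<forall>j. norm (x $ j) < 2 * R} \<Longrightarrow> F x \<noteq> 0 \<Longrightarrow> H x = G x + p x * q x"
    using cousin_data_subset[OF r(2) sub] unfolding cousin_data_def by blast
  obtain h where h: "holomorphic_fun_on h UNIV" "\<And>x. (\<forall>j. norm (x $ j) \<le> R) \<Longrightarrow> norm (H x - h x) < e"
    using runge_polydisc[OF R _ H(1) e] R by auto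
  have "norm (G x - h x) < e" if "\<forall>j. norm (x $ j) \<le> R" "p x = 0" for x
  proof -
    have "x \<in> {x. \<forall>j. norm (x $ j) < 2 * R}"
    proof (rule CollectI, rule allI)
      fix j show "norm (x $ j) < 2 * R" using that(1)[rule_format, of j] R by linarith
    qed
    then have "H x = G x" using H(2)[of x] Fp[of x] that(2) by simp
    then show ?thesis using h(2)[OF that(1)] by simp
  qed
  with h(1) show ?thesis by blast
qed

section \<open>Vector fields approximable by automorphisms\<close>

definition automorphism :: "(complex^'n \<Rightarrow> complex^'n) \<Rightarrow> bool" where
  "automorphism \<alpha> \<longleftrightarrow> holomorphic_map_on \<alpha> UNIV \<and>
     (\<exists>\<beta>. holomorphic_map_on \<beta> UNIV \<and> (\<forall>x. \<beta> (\<alpha> x) = x) \<and> (\<forall>x. \<alpha> (\<beta> x) = x))"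

lemma hol_map_id: "holomorphic_map_on (\<lambda>x. x) S"
  by (simp add: holomorphic_map_on_def hol_fun_nth)

lemma automorphism_id: "automorphism (\<lambda>x. x)"
  unfolding automorphism_def using hol_map_id by auto

lemma automorphism_compose:
  fixes \<alpha> \<beta> :: "complex^'n \<Rightarrow> complex^'n"
  assumes "automorphism \<alpha>" "automorphism \<beta>"
  shows "automorphism (\<lambda>x. \<alpha> (\<beta> x))"
proof -
  obtain \<alpha>' where a: "holomorphic_map_on \<alpha> UNIV" "holomorphic_map_on \<alpha>' UNIV" "\<And>x. \<alpha>' (\<alpha> x) = x" "\<And>x. \<alpha> (\<alpha>' x) = x"
    using assms(1) unfolding automorphism_def by blast
  obtain \<beta>' where b: "holomorphic_map_on \<beta> UNIV" "holomorphic_map_on \<beta>' UNIV" "\<And>x. \<beta>' (\<beta> x) = x" "\<And>x. \<beta> (\<beta>' x) = x"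
    using assms(2) unfolding automorphism_def by blast
  have "holomorphic_map_on (\<lambda>x. \<alpha> (\<beta> x)) UNIV" "holomorphic_map_on (\<lambda>x. \<beta>' (\<alpha>' x)) UNIV"
    using hol_map_compose[OF b(1) a(1)] hol_map_compose[OF a(2) b(2)] by auto
  then show ?thesis unfolding automorphism_def
    by (intro conjI exI[of _ "\<lambda>x. \<beta>' (\<alpha>' x)"]) (auto simp: a b)
qed

lemma automorphism_funpow: "automorphism \<alpha> \<Longrightarrow> automorphism (\<alpha> ^^ n)"
proof (induction n)
  case 0
  show ?case using automorphism_id by (simp add: id_def)
next
  case (Suc n)
  then show ?case using automorphism_compose[of \<alpha> "\<alpha> ^^ n"] by (simp add: comp_def)
qed

abbreviation euler_step ::
  "(complex^'n \<Rightarrow> complex^'n) \<Rightarrow> (complex^'n) set \<Rightarrow> real \<Rightarrow> real \<Rightarrow> bool" where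
  "euler_step V C e h \<equiv> \<exists>\<alpha>. automorphism \<alpha> \<and> (\<forall>y\<in>C. norm (\<alpha> y - y - h *\<^sub>R V y) \<le> e * h)"

text \<open>First-order consistency of a one-step method whose steps are automorphisms, uniformly on
  compact sets. Unlike completeness of a field, it is preserved by sums and by locally uniform
  limits; this is the mechanism of Andersen-Lempert theory.\<close>

definition aut_approximable :: "(complex^'n \<Rightarrow> complex^'n) \<Rightarrow> bool" where
  "aut_approximable V \<longleftrightarrow> continuous_on UNIV V \<and> (\<forall>C e. compact C \<longrightarrow> e > 0 \<longrightarrow>
     (\<exists>h0>0. \<forall>h. 0 < h \<longrightarrow> h < h0 \<longrightarrow> euler_step V C e h))"

text \<open>Lie-Trotter splitting: a step for \<open>W\<close> followed by one for \<open>V\<close>.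
  The three thirds of \<open>e\<close> pay for the two step errors and for evaluating
  \<open>V\<close> at \<open>\<beta> y\<close> instead of \<open>y\<close>.\<close>

lemma aut_approximable_add:
  fixes V W :: "complex^'n \<Rightarrow> complex^'n"
  assumes V: "aut_approximable V" and W: "aut_approximable W"
  shows "aut_approximable (\<lambda>x. V x + W x)"
  unfolding aut_approximable_def
proof (intro conjI allI impI)
  show "continuous_on UNIV (\<lambda>x. V x + W x)"
    using assms unfolding aut_approximable_def by (intro continuous_on_add) auto
  fix C :: "(complex^'n) set" and e :: real assume C: "compact C" and e: "e > 0"
  have contV: "continuous_on UNIV V" and contW: "continuous_on C W"
    using V W unfolding aut_approximable_def by (auto intro: continuous_on_subset)
  obtain \<delta> where \<delta>: "\<delta> > 0" "\<And>y z. y \<in> C \<Longrightarrow> norm (z - y) \<le> \<delta> \<Longrightarrow> norm (V z - V y) < e / 3"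
    using uniform_on_compact[OF open_UNIV contV C subset_UNIV, of "e / 3"] e by auto
  define C' where "C' = {x + y | x y. x \<in> C \<and> y \<in> cball (0 :: complex^'n) 1}"
  have C': "compact C'" unfolding C'_def using C by (intro compact_sums) auto
  obtain M where M: "M > 0" "\<And>y. y \<in> C \<Longrightarrow> norm (W y) \<le> M"
    using compact_image_bound[OF C contW] by blast
  obtain h1 where h1: "h1 > 0" "\<And>h. 0 < h \<Longrightarrow> h < h1 \<Longrightarrow> euler_step V C' (e / 3) h"
    using V C' e unfolding aut_approximable_def by (metis zero_less_divide_iff zero_less_numeral)
  obtain h2 where h2: "h2 > 0" "\<And>h. 0 < h \<Longrightarrow> h < h2 \<Longrightarrow> euler_step W C (e / 3) h"
    using W C e unfolding aut_approximable_def by (metis zero_less_divide_iff zero_less_numeral)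
  \<comment> \<open>A step of \<open>\<beta>\<close> moves points of \<open>C\<close> by at most
    \<open>h * (M + e / 3)\<close>. For \<open>h < h3\<close> this is below \<open>1\<close>, so
    that \<open>\<beta> y\<close> stays in \<open>C'\<close>, and below
    \<open>\<delta>\<close>.\<close>
  define h3 where "h3 = min 1 \<delta> / (M + e / 3)"
  have h3: "h3 > 0" using \<delta> M e by (simp add: h3_def)
  show "\<exists>h0>0. \<forall>h. 0 < h \<longrightarrow> h < h0 \<longrightarrow> euler_step (\<lambda>x. V x + W x) C e h"
  proof (intro exI[of _ "min h1 (min h2 h3)"] conjI allI impI)
    show "0 < min h1 (min h2 h3)" using h1 h2 h3 by simp
    fix h assume h: "0 < h" "h < min h1 (min h2 h3)"
    obtain \<alpha> where \<alpha>: "automorphism \<alpha>" "\<And>y. y \<in> C' \<Longrightarrow> norm (\<alpha> y - y - h *\<^sub>R V y) \<le> e / 3 * h"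
      using h1(2)[of h] h by auto
    obtain \<beta> where \<beta>: "automorphism \<beta>" "\<And>y. y \<in> C \<Longrightarrow> norm (\<beta> y - y - h *\<^sub>R W y) \<le> e / 3 * h"
      using h2(2)[of h] h by auto
    have "norm (\<alpha> (\<beta> y) - y - h *\<^sub>R (V y + W y)) \<le> e * h" if y: "y \<in> C" for y
    proof -
      have "norm (\<beta> y - y) \<le> norm (\<beta> y - y - h *\<^sub>R W y) + norm (h *\<^sub>R W y)"
        using norm_triangle_ineq[of "\<beta> y - y - h *\<^sub>R W y" "h *\<^sub>R W y"] by simp
      also have "\<dots> \<le> e / 3 * h + h * M"
        using \<beta>(2)[OF y] M(2)[OF y] h(1) by (intro add_mono) auto
      also have "\<dots> = h * (M + e / 3)" by (simp add: algebra_simps)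
      also have "\<dots> < min 1 \<delta>"
        using h(2) M(1) e by (simp add: h3_def pos_less_divide_eq)
      finally have d: "norm (\<beta> y - y) < min 1 \<delta>" .
      have "\<beta> y = y + (\<beta> y - y)" by simp
      then have bC: "\<beta> y \<in> C'" unfolding C'_def using y d by (smt (verit) mem_Collect_eq mem_cball_0)
      have "norm (V (\<beta> y) - V y) \<le> e / 3" using \<delta>(2)[OF y, of "\<beta> y"] d by simp
      then have "h * norm (V (\<beta> y) - V y) \<le> h * (e / 3)" using h(1) by (intro mult_left_mono) auto
      then have 3: "norm (h *\<^sub>R (V (\<beta> y) - V y)) \<le> e / 3 * h" using h(1) by (simp add: mult.commute)
      have "\<alpha> (\<beta> y) - y - h *\<^sub>R (V y + W y) = (\<alpha> (\<beta> y) - \<beta> y - h *\<^sub>R V (\<beta> y)) + ((\<beta> y - y - h *\<^sub>R W y)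
          + h *\<^sub>R (V (\<beta> y) - V y))"
        by (simp add: algebra_simps)
      also have "norm \<dots> \<le> e / 3 * h + (e / 3 * h + e / 3 * h)"
        by (intro norm_triangle_le add_mono 3 \<alpha>(2)[OF bC] \<beta>(2)[OF y])
      finally show ?thesis by simp
    qed
    then show "euler_step (\<lambda>x. V x + W x) C e h"
      using automorphism_compose[OF \<alpha>(1) \<beta>(1)] by blast
  qed
qed

text \<open>Step errors are measured relative to \<open>h\<close>, so replacing \<open>V\<close> by
  a field within \<open>e / 2\<close> of it on \<open>C\<close> costs only
  \<open>e / 2 * h\<close>.\<close>

lemma aut_approximable_limit:
  fixes V :: "complex^'n \<Rightarrow> complex^'n"
  assumes cont: "continuous_on UNIV V"
    and lim: "\<And>C e. compact C \<Longrightarrow> e > 0 \<Longrightarrow> \<exists>W. aut_approximable W \<and> (\<forall>y\<in>C. norm (W y - V y) \<le> e)"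
  shows "aut_approximable V"
  unfolding aut_approximable_def
proof (intro conjI cont allI impI)
  fix C :: "(complex^'n) set" and e :: real assume C: "compact C" and e: "e > 0"
  obtain W where W: "aut_approximable W" "\<And>y. y \<in> C \<Longrightarrow> norm (W y - V y) \<le> e / 2"
    using lim[OF C, of "e / 2"] e by auto
  obtain h0 where h0: "h0 > 0" "\<And>h. 0 < h \<Longrightarrow> h < h0 \<Longrightarrow> euler_step W C (e / 2) h"
    using W(1) C e unfolding aut_approximable_def by (metis zero_less_divide_iff zero_less_numeral)
  show "\<exists>h0>0. \<forall>h. 0 < h \<longrightarrow> h < h0 \<longrightarrow> euler_step V C e h"
  proof (intro exI[of _ h0] conjI h0(1) allI impI)
    fix h assume h: "0 < h" "h < h0"
    obtain \<alpha> where \<alpha>: "automorphism \<alpha>" "\<And>y. y \<in> C \<Longrightarrow> norm (\<alpha> y - y - h *\<^sub>R W y) \<le> e / 2 * h"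
      using h0(2)[OF h] by auto
    have "norm (\<alpha> y - y - h *\<^sub>R V y) \<le> e * h" if y: "y \<in> C" for y
    proof -
      have "\<alpha> y - y - h *\<^sub>R V y = (\<alpha> y - y - h *\<^sub>R W y) + h *\<^sub>R (W y - V y)" by (simp add: algebra_simps)
      also have "norm \<dots> \<le> e / 2 * h + h * (e / 2)"
        using W(2)[OF y] h by (intro norm_triangle_le add_mono \<alpha>(2) y) auto
      finally show ?thesis by simp
    qed
    then show "euler_step V C e h" using \<alpha>(1) by blast
  qed
qed

lemma norm_smult: "norm (c *s v :: complex^'n) = norm c * norm v"
  by (simp add: norm_vec_def L2_set_def norm_mult power_mult_distrib sum_distrib_left[symmetric] real_sqrt_mult)

lemma hol_map_add_smult:
  assumes "holomorphic_fun_on g S"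
  shows "holomorphic_map_on (\<lambda>x. x + g x *s v) S"
  unfolding holomorphic_map_on_def
proof
  show "holomorphic_fun_on (\<lambda>x. (x + g x *s v) $ i) S" for i
    using assms by (simp add: hol_intros)
qed

lemma continuous_on_smult_vec:
  fixes v :: "complex^'n"
  assumes "continuous_on S g"
  shows "continuous_on S (\<lambda>x. g x *s v)"
  unfolding vector_scalar_mult_def
  by (intro continuous_on_vec_lambda continuous_on_mult assms continuous_on_const)

text \<open>Since \<open>g\<close> is constant along \<open>v\<close>, the Euler step
  \<open>x + h g(x) v\<close> is the exact flow, with inverse given by \<open>-h\<close>; the step
  error is zero.\<close>

lemma aut_approximable_shear:
  fixes v :: "complex^'n"
  assumes g: "holomorphic_fun_on g UNIV" and inv: "\<And>x t. g (x + t *s v) = g x"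
  shows "aut_approximable (\<lambda>x. g x *s v)"
  unfolding aut_approximable_def
proof (intro conjI allI impI)
  show "continuous_on UNIV (\<lambda>x. g x *s v)"
    by (intro continuous_on_smult_vec hol_fun_continuous_on g)
  fix C :: "(complex^'n) set" and e :: real assume e: "e > 0"
  have aut: "automorphism (\<lambda>x. x + (of_real h * g x) *s v)" for h
    unfolding automorphism_def
  proof (intro conjI exI[of _ "\<lambda>x. x + (- of_real h * g x) *s v"] allI)
    show "x + (of_real h * g x) *s v + (- of_real h * g (x + (of_real h * g x) *s v)) *s v = x" for x
      unfolding inv by (simp add: vec_eq_iff algebra_simps)
    show "x + (- of_real h * g x) *s v + (of_real h * g (x + (- of_real h * g x) *s v)) *s v = x" for x
      unfolding inv by (simp add: vec_eq_iff algebra_simps)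
  qed (intro hol_map_add_smult hol_intros g)+
  have zero: "x + (of_real h * g x) *s v - x - h *\<^sub>R (g x *s v) = 0" for h x
    by (simp add: vec_eq_iff scaleR_conv_of_real[where 'a = complex])
  show "\<exists>h0>0. \<forall>h. 0 < h \<longrightarrow> h < h0 \<longrightarrow> euler_step (\<lambda>x. g x *s v) C e h"
  proof (intro exI[of _ 1] conjI allI impI)
    fix h :: real assume "0 < h"
    then have "\<forall>y\<in>C. norm (y + (of_real h * g y) *s v - y - h *\<^sub>R (g y *s v)) \<le> e * h"
      using e by (simp only: zero norm_zero) simp
    then show "euler_step (\<lambda>x. g x *s v) C e h"
      using aut[of h] by blast
  qed simp
qed

text \<open>Along \<open>v\<close> the factor \<open>g\<close> is constant and, since
  \<open>v $ j = 1\<close>, \<open>x $ j\<close> grows like \<open>exp (h * g x)\<close>. So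
  \<open>?S h\<close> is the exact flow, and its distance from the Euler step is the second-order
  remainder of \<open>exp\<close>.\<close>

lemma aut_approximable_overshear:
  fixes v :: "complex^'n"
  assumes g: "holomorphic_fun_on g UNIV" and inv: "\<And>x t. g (x + t *s v) = g x" and vj: "v $ j = 1"
  shows "aut_approximable (\<lambda>x. (g x * x $ j) *s v)"
  unfolding aut_approximable_def
proof (intro conjI allI impI)
  have gj: "holomorphic_fun_on (\<lambda>x. g x * x $ j) UNIV" by (intro hol_intros g)
  show "continuous_on UNIV (\<lambda>x. (g x * x $ j) *s v)"
    by (intro continuous_on_smult_vec hol_fun_continuous_on gj)
  fix C :: "(complex^'n) set" and e :: real assume C: "compact C" and e: "e > 0"
  let ?S = "\<lambda>(h::real) x. x + ((exp (of_real h * g x) - 1) * x $ j) *s v"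
  have hS: "holomorphic_map_on (?S h) UNIV" for h
    by (intro hol_map_add_smult hol_intros g)
  have inv': "?S (- h) (?S h x) = x" for h x
    unfolding inv using vj by (simp add: vec_eq_iff algebra_simps exp_minus)
  have aut: "automorphism (?S h)" for h
    unfolding automorphism_def using hS[of h] hS[of "- h"] inv'[where h = h] inv'[where h = "- h"]
    by (intro conjI exI[of _ "?S (- h)"] allI) simp_all
  have cont: "continuous_on C g" "continuous_on C (\<lambda>x. x $ j)"
    using hol_fun_continuous_on[OF hol_fun_subset[OF g subset_UNIV]]
      hol_fun_continuous_on[OF hol_fun_nth] by auto
  obtain M where M: "M > 0" "\<And>y. y \<in> C \<Longrightarrow> norm (g y) \<le> M" using compact_image_bound[OF C cont(1)] by blast
  obtain N where N: "N > 0" "\<And>y. y \<in> C \<Longrightarrow> norm (y $ j) \<le> N" using compact_image_bound[OF C cont(2)] by blast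
  \<comment> \<open>For \<open>h * M \<le> 1\<close> the remainder of \<open>exp\<close> is at most
    \<open>exp 1 * (h * M)^2\<close>, so the step error is at most \<open>h^2 * Q\<close>; this is
    why \<open>h < e / Q\<close> is imposed.\<close>
  define Q where "Q = exp 1 * M\<^sup>2 * N * (norm v + 1)"
  have Q: "Q > 0" using M N by (auto simp: Q_def intro!: mult_pos_pos add_nonneg_pos)
  show "\<exists>h0>0. \<forall>h. 0 < h \<longrightarrow> h < h0 \<longrightarrow> euler_step (\<lambda>x. (g x * x $ j) *s v) C e h"
  proof (intro exI[of _ "min (1 / M) (e / Q)"] conjI allI impI)
    show "0 < min (1 / M) (e / Q)" using M e Q by simp
    fix h assume h: "0 < h" "h < min (1 / M) (e / Q)"
    have hM: "h * M \<le> 1" and hQ: "h * Q \<le> e"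
      using h M Q by (auto simp: pos_less_divide_eq less_imp_le)
    have "norm (?S h y - y - h *\<^sub>R ((g y * y $ j) *s v)) \<le> e * h" if y: "y \<in> C" for y
    proof -
      define z where "z = of_real h * g y"
      have "norm z \<le> h * M" using h M(2)[OF y] by (simp add: z_def norm_mult)
      then have z: "norm z \<le> h * M" "norm z \<le> 1" using hM by auto
      have "norm (exp z - 1 - z) \<le> exp \<bar>Re z\<bar> * norm z ^ 2"
        using Taylor_exp[of z 1] by (simp add: numeral_2_eq_2 diff_diff_eq)
      also have "\<dots> \<le> exp 1 * (h * M) ^ 2"
        using z abs_Re_le_cmod[of z] by (intro mult_mono power_mono) auto
      finally have 1: "norm (exp z - 1 - z) \<le> exp 1 * (h * M) ^ 2" .
      have "?S h y - y - h *\<^sub>R ((g y * y $ j) *s v) = ((exp z - 1 - z) * y $ j) *s v"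
        by (simp add: vec_eq_iff z_def scaleR_conv_of_real[where 'a = complex] algebra_simps)
      then have "norm (?S h y - y - h *\<^sub>R ((g y * y $ j) *s v)) = norm (exp z - 1 - z) * norm (y $ j) * norm v"
        by (simp add: norm_smult norm_mult)
      also have "\<dots> \<le> (exp 1 * (h * M) ^ 2) * N * (norm v + 1)"
        using 1 N(2)[OF y] N(1) by (intro mult_mono) auto
      also have "\<dots> = h * (h * Q)" by (simp add: Q_def power2_eq_square)
      also have "\<dots> \<le> h * e" using hQ h by (intro mult_left_mono) auto
      finally show ?thesis by (simp add: mult.commute)
    qed
    then show "euler_step (\<lambda>x. (g x * x $ j) *s v) C e h"
      using aut[of h] by blast
  qed
qed

lemma vec_upd_vec_upd [simp]: "vec_upd (vec_upd x i a) i b = vec_upd x i b"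
  by (simp add: vec_eq_iff)

lemma vec_upd_commute: "i \<noteq> j \<Longrightarrow> vec_upd (vec_upd x i a) j b = vec_upd (vec_upd x j b) i a"
  by (simp add: vec_eq_iff)

text \<open>\<open>F\<close> is the integral of \<open>f\<close> in coordinate \<open>i\<close> from
  \<open>0\<close> to \<open>x $ i\<close>. The integral formula gives holomorphy in all variables
  and passes on the independence of \<open>x $ j\<close>; a one-variable primitive gives the
  derivative.\<close>

lemma partial_primitive:
  fixes f :: "complex^'n \<Rightarrow> complex"
  assumes f: "holomorphic_fun_on f UNIV" and ij: "i \<noteq> j" and indep: "\<And>x a. f (vec_upd x j a) = f x"
  obtains F where "holomorphic_fun_on F UNIV" "\<And>x a. F (vec_upd x j a) = F x"
    "\<And>x u. ((\<lambda>u. F (vec_upd x i u)) has_field_derivative f (vec_upd x i u)) (at u)"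
proof
  let ?l = "\<lambda>x t. of_real t * x $ i"
  let ?F = "\<lambda>x. integral {0..1} (\<lambda>t. f (vec_upd x i (?l x t)) * x $ i)"
  have holl: "holomorphic_fun_on (\<lambda>x. ?l x t) UNIV" for t
    by (intro hol_intros)
  show "holomorphic_fun_on ?F UNIV"
  proof (rule hol_fun_integral)
    have "continuous_on (UNIV \<times> {0..1}) (\<lambda>q :: (complex^'n) \<times> real. vec_upd (fst q) i (?l (fst q) (snd q)))"
      by (intro continuous_intros)
    then have "continuous_on (UNIV \<times> {0..1}) (\<lambda>q. f (vec_upd (fst q) i (?l (fst q) (snd q))))"
      by (rule continuous_on_compose2[OF hol_fun_continuous_on[OF f]]) simp
    then have "continuous_on (UNIV \<times> {0..1}) (\<lambda>q. f (vec_upd (fst q) i (?l (fst q) (snd q))) * fst q $ i)"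
      by (intro continuous_intros)
    then show "continuous_on (UNIV \<times> {0..1}) (\<lambda>(x, t). f (vec_upd x i (?l x t)) * x $ i)"
      by (simp add: case_prod_unfold)
    show "holomorphic_fun_on (\<lambda>x. f (vec_upd x i (?l x t)) * x $ i) UNIV" for t
      by (rule hol_fun_mult[OF hol_fun_compose[OF hol_map_vec_upd[OF holl] f]
          hol_fun_nth]) simp
  qed simp
  show "?F (vec_upd x j a) = ?F x" for x a
    using ij by (simp add: vec_upd_commute[of j i] indep)
  fix x :: "complex^'n" and u
  have hol: "(\<lambda>u. f (vec_upd x i u)) holomorphic_on UNIV"
    by (rule holomorphic_on_vec_upd[OF f]) simp
  obtain P where P: "\<And>z. (P has_field_derivative f (vec_upd x i z)) (at z)"
    using holomorphic_convex_primitive'[OF convex_UNIV open_UNIV hol] by auto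
  have "?F (vec_upd x i z) = P z - P 0" for z
  proof -
    have "((\<lambda>u. f (vec_upd x i u)) has_contour_integral (P (pathfinish (linepath 0 z)) - P (pathstart (linepath 0 z))))
      (linepath 0 z)"
      by (rule contour_integral_primitive[OF _ valid_path_linepath, of UNIV]) (use P in auto)
    then have "contour_integral (linepath 0 z) (\<lambda>u. f (vec_upd x i u)) = P z - P 0"
      by (simp add: contour_integral_unique)
    then show ?thesis by (simp add: contour_integral_integral linepath_def scaleR_conv_of_real)
  qed
  moreover have "((\<lambda>z. P z - P 0) has_field_derivative f (vec_upd x i u)) (at u)"
    using DERIV_diff[OF P[of u] DERIV_const[of "P 0"]] by simp
  ultimately show "((\<lambda>u. ?F (vec_upd x i u)) has_field_derivative f (vec_upd x i u)) (at u)"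
    by simp
qed

text \<open>Taylor expansions with remainders measured by the oscillation \<open>\<epsilon>\<close>
  of \<open>g\<close>: the mean value inequality is applied to \<open>\<phi>1\<close>, and its
  outcome to \<open>\<phi>2\<close>.\<close>

lemma second_primitive_estimates:
  fixes \<phi>1 \<phi>2 g :: "complex \<Rightarrow> complex"
  assumes d1: "\<And>z. (\<phi>1 has_field_derivative g z) (at z)" and d2: "\<And>z. (\<phi>2 has_field_derivative \<phi>1 z) (at z)"
    and g: "\<And>z. norm z \<le> r \<Longrightarrow> norm (g z - g 0) \<le> \<epsilon>" and t: "norm t \<le> r"
  shows "norm (\<phi>1 t - \<phi>1 0 - t * g 0) \<le> \<epsilon> * norm t"
    and "norm (\<phi>2 t - \<phi>2 0 - t * \<phi>1 0 - t\<^sup>2 * g 0 / 2) \<le> \<epsilon> * (norm t)\<^sup>2"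
proof -
  have e0: "\<epsilon> \<ge> 0" using g[OF t] norm_ge_zero order_trans by blast
  have 1: "norm (\<phi>1 z - \<phi>1 0 - z * g 0) \<le> \<epsilon> * norm z" if z: "norm z \<le> r" for z
  proof -
    have "norm ((\<phi>1 z - z * g 0) - (\<phi>1 0 - 0 * g 0)) \<le> \<epsilon> * norm (z - 0)"
    proof (rule field_differentiable_bound[where S = "cball 0 r" and f = "\<lambda>w. \<phi>1 w - w * g 0" and f' = "\<lambda>w. g w - g 0"])
      show "((\<lambda>w. \<phi>1 w - w * g 0) has_field_derivative g w - g 0) (at w within cball 0 r)" for w
        by (rule has_field_derivative_at_within) (rule derivative_eq_intros d1 refl | simp)+
      show "norm (g w - g 0) \<le> \<epsilon>" if "w \<in> cball 0 r" for w
        using g that by simp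
    qed (use z norm_ge_zero[of z] in \<open>auto intro: order_trans[of 0 "norm z" r]\<close>)
    then show ?thesis by (simp add: algebra_simps)
  qed
  show "norm (\<phi>1 t - \<phi>1 0 - t * g 0) \<le> \<epsilon> * norm t" by (rule 1[OF t])
  have "norm ((\<phi>2 t - t * \<phi>1 0 - t\<^sup>2 * g 0 / 2) - (\<phi>2 0 - 0 * \<phi>1 0 - 0\<^sup>2 * g 0 / 2)) \<le> (\<epsilon> * norm t) * norm (t - 0)"
  proof (rule field_differentiable_bound[where S = "cball 0 (norm t)" and f = "\<lambda>w. \<phi>2 w - w * \<phi>1 0 - w\<^sup>2 * g 0 / 2"
        and f' = "\<lambda>w. \<phi>1 w - \<phi>1 0 - w * g 0"])
    show "((\<lambda>w. \<phi>2 w - w * \<phi>1 0 - w\<^sup>2 * g 0 / 2) has_field_derivative \<phi>1 w - \<phi>1 0 - w * g 0) (at w within cball 0 (norm t))" for w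
      by (rule has_field_derivative_at_within) (rule derivative_eq_intros d2 refl | simp)+
    fix w :: complex assume w: "w \<in> cball 0 (norm t)"
    then have "norm (\<phi>1 w - \<phi>1 0 - w * g 0) \<le> \<epsilon> * norm w" using t by (intro 1) simp
    also have "\<dots> \<le> \<epsilon> * norm t" using w e0 by (intro mult_left_mono) auto
    finally show "norm (\<phi>1 w - \<phi>1 0 - w * g 0) \<le> \<epsilon> * norm t" .
  qed auto
  then show "norm (\<phi>2 t - \<phi>2 0 - t * \<phi>1 0 - t\<^sup>2 * g 0 / 2) \<le> \<epsilon> * (norm t)\<^sup>2"
    by (simp add: algebra_simps power2_eq_square)
qed

text \<open>
  The quadratic field \<open>f x\<^sub>j\<^sup>2 \<partial>\<^sub>j\<close> is not complete, but it is a limit of sums of complete shear and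
  overshear fields in the directions \<open>e\<^sub>j - a e\<^sub>i\<close> as \<open>a \<rightarrow> 0\<close>: with \<open>\<partial>\<^sub>i F\<^sub>1 = f\<close> and \<open>\<partial>\<^sub>i F\<^sub>2 = F\<^sub>1\<close>,
  it equals twice the first derivative at \<open>a = 0\<close> of the overshear with coefficient \<open>F\<^sub>1(x + a x\<^sub>j e\<^sub>i)\<close>
  minus the second derivative of the shear with coefficient \<open>F\<^sub>2(x + a x\<^sub>j e\<^sub>i)\<close>.
\<close>

lemma aut_approximable_quadratic:
  fixes f :: "complex^'n \<Rightarrow> complex"
  assumes f: "holomorphic_fun_on f UNIV" and ij: "i \<noteq> j" and indep: "\<And>x a. f (vec_upd x j a) = f x"
  shows "aut_approximable (\<lambda>x. (f x * (x $ j)\<^sup>2) *s axis j 1)"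
proof (rule aut_approximable_limit)
  show "continuous_on UNIV (\<lambda>x. (f x * (x $ j)\<^sup>2) *s (axis j 1 :: complex^'n))"
    by (intro continuous_on_smult_vec hol_fun_continuous_on hol_intros f)
  fix C :: "(complex^'n) set" and e :: real assume C: "compact C" and e: "e > 0"
  obtain F1 where F1: "holomorphic_fun_on F1 UNIV" "\<And>x a. F1 (vec_upd x j a) = F1 x"
    "\<And>x u. ((\<lambda>u. F1 (vec_upd x i u)) has_field_derivative f (vec_upd x i u)) (at u)"
    using partial_primitive[OF f ij indep] by metis
  obtain F2 where F2: "holomorphic_fun_on F2 UNIV" "\<And>x a. F2 (vec_upd x j a) = F2 x"
    "\<And>x u. ((\<lambda>u. F2 (vec_upd x i u)) has_field_derivative F1 (vec_upd x i u)) (at u)"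
    using partial_primitive[OF F1(1) ij F1(2)] by metis
  \<comment> \<open>Along \<open>v a = e_j - a e_i\<close> the value
    \<open>x $ i + a * x $ j\<close> does not change, so a function of \<open>sh a x\<close> that
    ignores coordinate \<open>j\<close> is constant in this direction.\<close>
  define sh where "sh = (\<lambda>(a::real) x :: complex^'n. vec_upd x i (x $ i + of_real a * x $ j))"
  define v where "v = (\<lambda>a::real. axis j 1 - axis i (of_real a) :: complex^'n)"
  have hol_sh: "holomorphic_map_on (sh a) UNIV" for a
    unfolding sh_def by (intro hol_map_vec_upd hol_intros)
  have hol_comp: "holomorphic_fun_on (\<lambda>x. F (sh a x)) UNIV" if "holomorphic_fun_on F UNIV" for F a
    by (rule hol_fun_compose[OF hol_sh that]) simp
  have sh_inv: "sh a (x + t *s v a) = vec_upd (sh a x) j (x $ j + t)" for a x t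
    using ij by (simp add: vec_eq_iff sh_def v_def axis_def algebra_simps)
  have vj: "v a $ j = 1" for a using ij by (simp add: v_def axis_def)
  have sh0: "sh 0 x = x" and v0: "v 0 = axis j 1" for x by (simp_all add: sh_def v_def vec_eq_iff axis_def)
  have over: "aut_approximable (\<lambda>x. ((of_real c * F1 (sh a x)) * x $ j) *s v a)" for c a :: real
    by (rule aut_approximable_overshear) (simp_all add: sh_inv F1(2) vj hol_comp[OF F1(1)] hol_intros)
  have shear: "aut_approximable (\<lambda>x. (of_real c * F2 (sh a x)) *s v a)" for c a :: real
    by (rule aut_approximable_shear) (simp_all add: sh_inv F2(2) hol_comp[OF F2(1)] hol_intros)
  \<comment> \<open>The derivatives in \<open>a\<close> as difference quotients: \<open>2/a\<close>
    times a forward difference of overshears, and \<open>-1/a^2\<close> times a symmetric second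
    difference of shears. Each summand keeps its own direction \<open>v a\<close>,
    \<open>v 0\<close> or \<open>v (- a)\<close> and is therefore complete.\<close>
  define W where "W = (\<lambda>(a::real) x. ((of_real (2 / a) * F1 (sh a x)) * x $ j) *s v a
      + ((of_real (- 2 / a) * F1 (sh 0 x)) * x $ j) *s v 0
      + (of_real (- 1 / a\<^sup>2) * F2 (sh a x)) *s v a + (of_real (2 / a\<^sup>2) * F2 (sh 0 x)) *s v 0
      + (of_real (- 1 / a\<^sup>2) * F2 (sh (- a) x)) *s v (- a))"
  have W: "aut_approximable (W a)" for a
    unfolding W_def by (intro aut_approximable_add over shear)
  obtain M where M: "M \<ge> 1" "\<And>x. x \<in> C \<Longrightarrow> norm (x $ j) \<le> M" "\<And>x. x \<in> C \<Longrightarrow> norm (f x) \<le> M"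
  proof -
    have cont: "continuous_on C f" "continuous_on C (\<lambda>x. x $ j)"
      using hol_fun_continuous_on[OF hol_fun_subset[OF f subset_UNIV]]
        hol_fun_continuous_on[OF hol_fun_nth] by auto
    obtain M where "M > 0" "\<And>y. y \<in> C \<Longrightarrow> norm (f y) \<le> M" using compact_image_bound[OF C cont(1)] by blast
    moreover obtain N where "N > 0" "\<And>y. y \<in> C \<Longrightarrow> norm (y $ j) \<le> N" using compact_image_bound[OF C cont(2)] by blast
    ultimately show ?thesis by (intro that[of "max 1 (max M N)"]) force+
  qed
  \<comment> \<open>The \<open>e_j\<close> component of the error will be at most
    \<open>4 * \<epsilon> * M^2 = e / 3\<close>.\<close>
  define \<epsilon> where "\<epsilon> = e / (12 * M\<^sup>2)"
  have \<epsilon>: "\<epsilon> > 0" using e M by (simp add: \<epsilon>_def)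
  obtain \<rho> where \<rho>: "\<rho> > 0" "\<And>x y. x \<in> C \<Longrightarrow> norm (y - x) \<le> \<rho> \<Longrightarrow> norm (f y - f x) < \<epsilon>"
    using uniform_on_compact[OF open_UNIV hol_fun_continuous_on[OF f] C subset_UNIV \<epsilon>] by auto
  \<comment> \<open>The first bound keeps \<open>a * x $ j\<close> within \<open>\<rho>\<close>,
    where \<open>f\<close> varies by less than \<open>\<epsilon>\<close>; the second makes the
    \<open>e_i\<close> component of the error, which is of order \<open>a\<close>, at most
    \<open>e / 2\<close>.\<close>
  define a where "a = min (\<rho> / M) (e / (2 * M\<^sup>2 * (2 * M + 4 * \<epsilon>)))"
  have den: "2 * M\<^sup>2 * (2 * M + 4 * \<epsilon>) > 0" using M \<epsilon> by (intro mult_pos_pos add_pos_pos) auto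
  have a: "a > 0" using \<rho> M e den by (simp add: a_def)
  have aM: "a * M \<le> \<rho>"
  proof -
    have "a \<le> \<rho> / M" by (simp add: a_def)
    then show ?thesis using M by (simp add: pos_le_divide_eq)
  qed
  have ae: "a * M\<^sup>2 * (2 * M + 4 * \<epsilon>) \<le> e / 2"
  proof -
    have "a \<le> e / (2 * M\<^sup>2 * (2 * M + 4 * \<epsilon>))" by (simp add: a_def)
    then have "a * (2 * M\<^sup>2 * (2 * M + 4 * \<epsilon>)) \<le> e" using den by (simp only: pos_le_divide_eq)
    then show ?thesis by (simp add: algebra_simps)
  qed
  have "norm (W a x - (f x * (x $ j)\<^sup>2) *s axis j 1) \<le> e" if x: "x \<in> C" for x
  proof -
    define s where "s = x $ j"
    define \<tau> where "\<tau> = of_real a * s"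
    define \<phi>1 where "\<phi>1 = (\<lambda>z. F1 (vec_upd x i (x $ i + z)))"
    define \<phi>2 where "\<phi>2 = (\<lambda>z. F2 (vec_upd x i (x $ i + z)))"
    define g where "g = (\<lambda>z. f (vec_upd x i (x $ i + z)))"
    have s: "norm s \<le> M" using M(2)[OF x] by (simp add: s_def)
    have d1: "(\<phi>1 has_field_derivative g z) (at z)" for z
      proof -
      have "((\<lambda>z. x $ i + z) has_field_derivative 1) (at z)" by (auto intro!: derivative_eq_intros)
      from DERIV_chain2[OF F1(3)[where x = x] this] show ?thesis by (simp add: \<phi>1_def g_def)
    qed
    have d2: "(\<phi>2 has_field_derivative \<phi>1 z) (at z)" for z
      proof -
      have "((\<lambda>z. x $ i + z) has_field_derivative 1) (at z)" by (auto intro!: derivative_eq_intros)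
      from DERIV_chain2[OF F2(3)[where x = x] this] show ?thesis by (simp add: \<phi>2_def \<phi>1_def)
    qed
    have gb: "norm (g z - g 0) \<le> \<epsilon>" if z: "norm z \<le> \<rho>" for z
    proof -
      have eq: "vec_upd x i (x $ i + z) = x + axis i z" by (simp add: add_axis_eq_vec_upd)
      have "norm (f (x + axis i z) - f x) < \<epsilon>" using \<rho>(2)[OF x, of "x + axis i z"] z by (simp add: norm_axis_complex)
      then show ?thesis by (simp add: g_def eq)
    qed
    have n\<tau>: "norm \<tau> = a * norm s" using a by (simp add: \<tau>_def norm_mult)
    then have \<tau>: "norm \<tau> \<le> \<rho>" "norm (- \<tau>) \<le> \<rho>"
      using order_trans[OF mult_left_mono[OF s] aM] a by simp_all
    note E1 = second_primitive_estimates[OF d1 d2 gb \<tau>(1)] and E2 = second_primitive_estimates[OF d1 d2 gb \<tau>(2)]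
    define A1 where "A1 = \<phi>1 \<tau> - \<phi>1 0 - \<tau> * g 0"
    define A2 where "A2 = \<phi>2 \<tau> - \<phi>2 0 - \<tau> * \<phi>1 0 - \<tau>\<^sup>2 * g 0 / 2"
    define A3 where "A3 = \<phi>2 (- \<tau>) - \<phi>2 0 + \<tau> * \<phi>1 0 - \<tau>\<^sup>2 * g 0 / 2"
    have A1: "norm A1 \<le> \<epsilon> * (a * norm s)" using E1(1) n\<tau> by (simp add: A1_def)
    have A2: "norm A2 \<le> \<epsilon> * (a * norm s)\<^sup>2" using E1(2) n\<tau> by (simp add: A2_def)
    have A3: "norm A3 \<le> \<epsilon> * (a * norm s)\<^sup>2" using E2(2) n\<tau> by (simp add: A3_def)
    have p1: "\<phi>1 \<tau> = A1 + \<phi>1 0 + \<tau> * g 0" by (simp add: A1_def)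
    have p2: "\<phi>2 \<tau> = A2 + \<phi>2 0 + \<tau> * \<phi>1 0 + \<tau>\<^sup>2 * g 0 / 2" by (simp add: A2_def)
    have p3: "\<phi>2 (- \<tau>) = A3 + \<phi>2 0 - \<tau> * \<phi>1 0 + \<tau>\<^sup>2 * g 0 / 2" by (simp add: A3_def)
    have F_eq: "F1 (sh a x) = \<phi>1 \<tau>" "F1 (sh 0 x) = \<phi>1 0" "F2 (sh a x) = \<phi>2 \<tau>" "F2 (sh 0 x) = \<phi>2 0"
      "F2 (sh (- a) x) = \<phi>2 (- \<tau>)"
      by (simp_all add: sh_def \<phi>1_def \<phi>2_def \<tau>_def s_def)
    have f_eq: "f x = g 0" by (simp add: g_def)
    \<comment> \<open>What the expansions leave over: in direction \<open>j\<close> the main terms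
      add up to the target \<open>g 0 * s^2\<close>, and in direction \<open>i\<close> the terms
      with \<open>\<phi>1 0\<close> cancel.\<close>
    define cj where "cj = 2 * s * A1 / of_real a - (A2 + A3) / of_real (a\<^sup>2)"
    define ci where "ci = - 2 * s * (A1 + \<tau> * g 0) + (A2 - A3) / of_real a"
    have a0: "complex_of_real a \<noteq> 0" using a by simp
    have "W a x - (f x * (x $ j)\<^sup>2) *s axis j 1 = axis j cj + axis i ci"
    proof (rule vec_eq_iff[THEN iffD2], rule allI)
      fix k
      consider "k = j" | "k = i" | "k \<noteq> i" "k \<noteq> j" by blast
      then show "(W a x - (f x * (x $ j)\<^sup>2) *s axis j 1) $ k = (axis j cj + axis i ci) $ k"
      proof cases
        case 1
        have "(W a x - (f x * (x $ j)\<^sup>2) *s axis j 1) $ k = 2 / of_real a * \<phi>1 \<tau> * s - 2 / of_real a * \<phi>1 0 * s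
          - \<phi>2 \<tau> / (of_real a)\<^sup>2 + 2 * \<phi>2 0 / (of_real a)\<^sup>2 - \<phi>2 (- \<tau>) / (of_real a)\<^sup>2 - g 0 * s\<^sup>2"
          using 1 ij by (simp add: W_def F_eq v_def axis_def f_eq s_def)
        also have "\<dots> = cj"
          by (simp only: p1 p2 p3 cj_def) (use a0 in \<open>simp add: \<tau>_def field_simps power2_eq_square\<close>)
        finally show ?thesis using 1 ij by (simp add: axis_def)
      next
        case 2
        have "(W a x - (f x * (x $ j)\<^sup>2) *s axis j 1) $ k = - (2 * \<phi>1 \<tau> * s)
          + \<phi>2 \<tau> / of_real a - \<phi>2 (- \<tau>) / of_real a"
          using 2 ij a0 by (simp add: W_def F_eq v_def axis_def f_eq s_def field_simps power2_eq_square)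
        also have "\<dots> = ci"
          by (simp only: p1 p2 p3 ci_def) (use a0 in \<open>simp add: \<tau>_def field_simps power2_eq_square\<close>)
        finally show ?thesis using 2 ij by (simp add: axis_def)
      next
        case 3
        then show ?thesis by (simp add: W_def v_def axis_def)
      qed
    qed
    then have "norm (W a x - (f x * (x $ j)\<^sup>2) *s axis j 1) \<le> norm cj + norm ci"
      using norm_triangle_ineq[of "axis j cj" "axis i ci"] by (simp add: norm_axis_complex)
    moreover have "norm cj \<le> e / 2"
    proof -
      have "norm cj \<le> 2 * norm s * norm A1 / a + (norm A2 + norm A3) / a\<^sup>2"
        unfolding cj_def
        by (rule order_trans[OF norm_triangle_ineq4 add_mono])
          (use a in \<open>auto simp: norm_mult norm_divide norm_power intro!: divide_right_mono norm_triangle_ineq\<close>)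
      also have "\<dots> \<le> 2 * norm s * (\<epsilon> * (a * norm s)) / a + (\<epsilon> * (a * norm s)\<^sup>2 + \<epsilon> * (a * norm s)\<^sup>2) / a\<^sup>2"
        using A1 A2 A3 a by (intro add_mono divide_right_mono mult_left_mono) auto
      also have "\<dots> = 4 * \<epsilon> * (norm s)\<^sup>2" using a by (simp add: field_simps power2_eq_square)
      also have "\<dots> \<le> 4 * \<epsilon> * M\<^sup>2" using s \<epsilon> by (intro mult_left_mono power_mono) auto
      also have "\<dots> = e / 3" using M by (simp add: \<epsilon>_def)
      finally show ?thesis using e by simp
    qed
    moreover have "norm ci \<le> e / 2"
    proof -
      have "norm ci \<le> 2 * norm s * (norm A1 + norm \<tau> * norm (g 0)) + (norm A2 + norm A3) / a"
        unfolding ci_def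
        by (rule order_trans[OF norm_triangle_ineq add_mono])
          (use a in \<open>auto simp: norm_mult norm_divide intro!: divide_right_mono mult_left_mono norm_triangle_ineq4
              order_trans[OF norm_triangle_ineq]\<close>)
      also have "\<dots> \<le> 2 * norm s * (\<epsilon> * (a * norm s) + (a * norm s) * M) + (\<epsilon> * (a * norm s)\<^sup>2 + \<epsilon> * (a * norm s)\<^sup>2) / a"
        using A1 A2 A3 a M(3)[OF x] n\<tau> f_eq by (intro add_mono divide_right_mono mult_left_mono mult_mono) auto
      also have "\<dots> = a * (norm s)\<^sup>2 * (2 * M + 4 * \<epsilon>)" using a by (simp add: field_simps power2_eq_square)
      also have "\<dots> \<le> a * M\<^sup>2 * (2 * M + 4 * \<epsilon>)"
        using s a M \<epsilon> by (intro mult_right_mono mult_left_mono power_mono) auto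
      finally show ?thesis using ae by simp
    qed
    ultimately show ?thesis by simp
  qed
  then show "\<exists>W. aut_approximable W \<and> (\<forall>y\<in>C. norm (W y - (f y * (y $ j)\<^sup>2) *s axis j 1) \<le> e)"
    using W[of a] by blast
qed

section \<open>Euler's method with automorphisms as steps\<close>

lemma entire_lipschitz:
  fixes g :: "complex^'n \<Rightarrow> complex"
  assumes g: "holomorphic_fun_on g UNIV"
  obtains L where "\<And>x y. norm x \<le> r \<Longrightarrow> norm y \<le> r \<Longrightarrow> norm (g x - g y) \<le> L * norm (x - y)"
proof -
  obtain B where "\<And>x. x \<in> cball 0 (r + 1) \<Longrightarrow> norm (g x) \<le> B"
    using compact_image_bound[OF compact_cball hol_fun_continuous_on[OF hol_fun_subset[OF g subset_UNIV]]]
    by blast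
  then have B: "norm (g x) \<le> B" if "norm x \<le> r + 1" for x using that by simp
  have "norm (g x - g y) \<le> B * norm (x - y)" if xy: "norm x \<le> r" "norm y \<le> r" for x y
  proof (cases "x = y")
    case False
    define v where "v = x - y"
    \<comment> \<open>A parameter disc of radius \<open>1 / norm v\<close> moves points of the
      segment by at most \<open>1\<close>, hence inside the ball of radius \<open>r + 1\<close>
      where \<open>B\<close> bounds \<open>g\<close>. Cauchy's estimate then gives the slope
      \<open>B * norm v\<close>.\<close>
    define \<rho> where "\<rho> = 1 / norm v"
    have v: "norm v > 0" using False by (simp add: v_def)
    then have \<rho>: "\<rho> > 0" by (simp add: \<rho>_def)
    let ?\<phi> = "\<lambda>w. g (y + w *s v)"
    have d\<phi>: "?\<phi> field_differentiable (at w)" for w by (rule hol_fun_line[OF g]) simp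
    then have hol: "?\<phi> holomorphic_on S" for S
      unfolding holomorphic_on_def using field_differentiable_at_within by blast
    have "norm (?\<phi> 1 - ?\<phi> 0) \<le> (B * norm v) * norm (1 - 0 :: complex)"
    proof (rule field_differentiable_bound[where S = "closed_segment 0 1" and f' = "deriv ?\<phi>"])
      fix w :: complex assume "w \<in> closed_segment 0 1"
      then obtain u where u: "0 \<le> u" "u \<le> 1" "w = of_real u"
        by (auto simp: in_segment scaleR_conv_of_real)
      show "(?\<phi> has_field_derivative deriv ?\<phi> w) (at w within closed_segment 0 1)"
        by (rule has_field_derivative_at_within) (simp add: field_differentiable_derivI d\<phi>)
      have "norm ((deriv ^^ 1) ?\<phi> w) \<le> fact 1 * B / \<rho> ^ 1"
      proof (rule Cauchy_inequality)
        show "?\<phi> holomorphic_on ball w \<rho>" by (rule hol)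
        show "continuous_on (cball w \<rho>) ?\<phi>" by (rule holomorphic_on_imp_continuous_on[OF hol])
        fix \<eta> assume \<eta>: "norm (w - \<eta>) = \<rho>"
        have "y + \<eta> *s v = ((1 - u) *\<^sub>R y + u *\<^sub>R x) + (\<eta> - w) *s v"
          by (simp add: vec_eq_iff v_def u(3) scaleR_conv_of_real[where 'a = complex] algebra_simps)
        also have "norm \<dots> \<le> (norm ((1 - u) *\<^sub>R y) + norm (u *\<^sub>R x)) + norm ((\<eta> - w) *s v)"
          by (intro norm_triangle_le add_mono norm_triangle_ineq order_refl)
        also have "\<dots> \<le> ((1 - u) * r + u * r) + 1"
        proof (intro add_mono)
          show "norm ((1 - u) *\<^sub>R y) \<le> (1 - u) * r" using u xy by (simp add: mult_left_mono)
          show "norm (u *\<^sub>R x) \<le> u * r" using u xy by (simp add: mult_left_mono)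
          show "norm ((\<eta> - w) *s v) \<le> 1" unfolding norm_smult using \<eta> v by (simp add: \<rho>_def norm_minus_commute)
        qed
        finally show "norm (?\<phi> \<eta>) \<le> B" by (intro B) (simp add: algebra_simps)
      qed (use \<rho> in auto)
      then show "norm (deriv ?\<phi> w) \<le> B * norm v" by (simp add: \<rho>_def)
    qed auto
    moreover have "y + 1 *s v = x" "y + 0 *s v = y" by (simp_all add: v_def vec_eq_iff)
    ultimately show ?thesis by (simp add: v_def)
  qed simp
  then show ?thesis using that by blast
qed

text \<open>A discrete Gronwall argument. One step \<open>\<alpha>\<close> serves all
  \<open>p\<close> and all times, and the automorphism obtained is a power of it.\<close>

lemma euler_method:
  fixes V :: "complex^'n \<Rightarrow> complex^'n" and X :: "'p \<Rightarrow> real \<Rightarrow> complex^'n"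
  assumes V: "aut_approximable V"
    and lip: "\<And>r. \<exists>L. \<forall>x y. norm x \<le> r \<longrightarrow> norm y \<le> r \<longrightarrow> norm (V x - V y) \<le> L * norm (x - y)"
    and T: "0 \<le> T"
    and X: "\<And>p t. p \<in> K \<Longrightarrow> t \<in> {0..T} \<Longrightarrow> (X p has_vector_derivative V (X p t)) (at t within {0..T})"
    and bd: "\<And>p t. p \<in> K \<Longrightarrow> t \<in> {0..T} \<Longrightarrow> norm (X p t) \<le> r"
    and e: "e > 0"
  shows "\<exists>\<alpha>. automorphism \<alpha> \<and> (\<forall>p\<in>K. norm (\<alpha> (X p 0) - X p T) \<le> e)"
proof (cases "T = 0")
  case True
  then show ?thesis using automorphism_id e by (intro exI[of _ "\<lambda>x. x"]) auto
next
  case False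
  with T have T: "T > 0" by simp
  obtain L0 where L0: "\<And>x y. norm x \<le> r + 1 \<Longrightarrow> norm y \<le> r + 1 \<Longrightarrow> norm (V x - V y) \<le> L0 * norm (x - y)"
    using lip by blast
  define L where "L = \<bar>L0\<bar>"
  have L: "norm (V x - V y) \<le> L * norm (x - y)" if "norm x \<le> r + 1" "norm y \<le> r + 1" for x y
    by (rule order_trans[OF L0[OF that]]) (simp add: L_def mult_right_mono)
  have L_ge: "L \<ge> 0" by (simp add: L_def)
  have "continuous_on (cball 0 (r + 1)) V"
    using V unfolding aut_approximable_def by (auto intro: continuous_on_subset)
  then obtain M where "M > 0" "\<And>x. x \<in> cball 0 (r + 1) \<Longrightarrow> norm (V x) \<le> M"
    using compact_image_bound[OF compact_cball] by blast
  then have M: "M > 0" "\<And>x. norm x \<le> r + 1 \<Longrightarrow> norm (V x) \<le> M" by auto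
  \<comment> \<open>Makes the accumulated error \<open>T * e' * exp (L * T)\<close> at most
    \<open>e\<close>, and at most \<open>1\<close>, so that the iterates stay in the ball of radius
    \<open>r + 1\<close> where \<open>L\<close> and \<open>M\<close> are valid.\<close>
  define e' where "e' = min e 1 / (T * exp (L * T))"
  have e': "e' > 0" using e T by (simp add: e'_def)
  have Te': "T * e' * exp (L * T) = min e 1" using T by (simp add: e'_def)
  obtain h0 where h0: "h0 > 0" "\<And>h. 0 < h \<Longrightarrow> h < h0 \<Longrightarrow>
      euler_step V (cball 0 (r + 1)) (e' / 2) h"
    using V e' unfolding aut_approximable_def by (metis compact_cball half_gt_zero)
  \<comment> \<open>The first bound yields \<open>h < h0\<close>, the second
    \<open>3 * L * M * h \<le> e' / 2\<close>: half of \<open>e'\<close> goes to the automorphism,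
    half to the truncation error of Euler's method.\<close>
  obtain N :: nat where N: "real N > max (T / h0) (6 * L * M * T / e')" using reals_Archimedean2 by blast
  have N0: "real N > 0"
  proof -
    have "0 < T / h0" using T h0(1) by simp
    moreover have "T / h0 < real N" using N by simp
    ultimately show ?thesis by linarith
  qed
  define h where "h = T / real N"
  have h: "h > 0" using T N0 by (simp add: h_def)
  have hN: "real N * h = T" using N0 by (simp add: h_def)
  have "h < h0"
  proof -
    have "T / h0 < real N" using N by simp
    then show ?thesis using h0(1) N0 by (simp add: h_def field_simps)
  qed
  then obtain \<alpha> where \<alpha>: "automorphism \<alpha>" "\<And>y. norm y \<le> r + 1 \<Longrightarrow> norm (\<alpha> y - y - h *\<^sub>R V y) \<le> e' / 2 * h"
    using h0(2)[OF h] by auto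
  have hLM: "3 * L * M * h \<le> e' / 2"
  proof -
    have "6 * L * M * T / e' < real N" using N by simp
    then have "6 * L * M * T < real N * e'" using e' by (simp add: pos_divide_less_eq)
    then have "6 * L * M * T / real N \<le> e'" using N0 by (simp add: pos_divide_le_eq mult.commute less_imp_le)
    then show ?thesis by (simp add: h_def)
  qed
  have "norm (((\<alpha> ^^ N)) (X p 0) - X p T) \<le> e" if p: "p \<in> K" for p
  proof -
    have Xb: "norm (X p t) \<le> r + 1" if "t \<in> {0..T}" for t using bd[OF p that] by simp
    have loc: "norm (X p (t + h) - X p t - h *\<^sub>R V (X p t)) \<le> e' / 2 * h" if t: "0 \<le> t" "t + h \<le> T" for t
    proof -
      have dX: "(X p has_vector_derivative V (X p s)) (at s within {t..t + h})" if "s \<in> {t..t + h}" for s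
        using that t by (intro has_vector_derivative_within_subset[OF X[OF p]]) auto
      have lipX: "norm (X p s - X p t) \<le> 3 * M * h" if s: "s \<in> {t..t + h}" for s
      proof -
        have "norm (X p s - X p t - (s - t) *\<^sub>R V (X p t)) \<le> norm (s - t) * (2 * M)"
        proof (rule vector_differentiable_bound_linearization[where f' = "\<lambda>s. V (X p s)" and S = "{t..t + h}"])
          show "closed_segment t s \<subseteq> {t..t + h}" using s by (auto simp: closed_segment_eq_real_ivl)
          fix w assume w: "w \<in> {t..t + h}"
          have "norm (V (X p w)) \<le> M" "norm (V (X p t)) \<le> M" using w t h by (intro M(2) Xb; simp)+
          then show "norm (V (X p w) - V (X p t)) \<le> 2 * M"
            using norm_triangle_ineq4[of "V (X p w)" "V (X p t)"] by simp
        qed (use dX h in auto)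
        moreover have "norm ((s - t) *\<^sub>R V (X p t)) \<le> norm (s - t) * M"
          using t h M(2)[OF Xb, of t] by (simp add: mult_left_mono)
        ultimately have "norm (X p s - X p t) \<le> norm (s - t) * (2 * M) + norm (s - t) * M"
          using norm_triangle_ineq[of "X p s - X p t - (s - t) *\<^sub>R V (X p t)" "(s - t) *\<^sub>R V (X p t)"]
          by (simp only: diff_add_cancel)
        also have "\<dots> = norm (s - t) * (3 * M)" by (simp add: algebra_simps)
        also have "\<dots> \<le> h * (3 * M)" using s M by (intro mult_right_mono) auto
        finally show ?thesis by (simp add: algebra_simps)
      qed
      have "norm (X p (t + h) - X p t - (t + h - t) *\<^sub>R V (X p t)) \<le> norm (t + h - t) * (L * (3 * M * h))"
      proof (rule vector_differentiable_bound_linearization[where f' = "\<lambda>s. V (X p s)" and S = "{t..t + h}"])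
        show "closed_segment t (t + h) \<subseteq> {t..t + h}" using h by (auto simp: closed_segment_eq_real_ivl)
        fix w assume w: "w \<in> {t..t + h}"
        have "norm (V (X p w) - V (X p t)) \<le> L * norm (X p w - X p t)"
          using w t h by (intro L Xb) auto
        also have "\<dots> \<le> L * (3 * M * h)" by (intro mult_left_mono lipX w L_ge)
        finally show "norm (V (X p w) - V (X p t)) \<le> L * (3 * M * h)" .
      qed (use dX h in auto)
      also have "\<dots> = (3 * L * M * h) * h" using h by simp
      also have "\<dots> \<le> e' / 2 * h" using hLM h by (intro mult_right_mono) auto
      finally show ?thesis by simp
    qed
    have gr: "real n * h * e' * (1 + L * h) ^ n \<le> min e 1" if n: "n \<le> N" for n
    proof -
      have nh: "real n * h \<le> T" using n h by (simp add: hN[symmetric])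
      have "(1 + L * h) ^ n \<le> exp (L * h) ^ n" using L_ge h by (intro power_mono exp_ge_add_one_self) auto
      also have "\<dots> = exp (L * (real n * h))" by (simp add: exp_of_nat_mult[symmetric] algebra_simps)
      also have "\<dots> \<le> exp (L * T)" using nh L_ge by (simp add: mult_left_mono)
      finally have "real n * h * e' * (1 + L * h) ^ n \<le> T * e' * exp (L * T)"
        using nh h e' L_ge T by (intro mult_mono) auto
      then show ?thesis using Te' by simp
    qed
    \<comment> \<open>Cruder than summing the propagated errors, but compatible with the recursion
      \<open>a \<mapsto> (1 + L * h) * a + h * e'\<close>.\<close>
    have err: "norm ((\<alpha> ^^ n) (X p 0) - X p (real n * h)) \<le> real n * h * e' * (1 + L * h) ^ n" if "n \<le> N" for n
      using that
    proof (induction n)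
      case 0
      show ?case by simp
    next
      case (Suc n)
      define y where "y = (\<alpha> ^^ n) (X p 0)"
      define x where "x = X p (real n * h)"
      define a where "a = real n * h * e' * (1 + L * h) ^ n"
      have IH: "norm (y - x) \<le> a" using Suc by (simp add: y_def x_def a_def)
      have a1: "a \<le> 1" using gr[of n] Suc.prems by (simp add: a_def)
      have "real (Suc n) * h \<le> T" using Suc.prems h unfolding hN[symmetric] by (intro mult_right_mono) auto
      then have nT: "real n * h + h \<le> T" "real n * h \<in> {0..T}" using h by (auto simp: algebra_simps)
      have x: "norm x \<le> r" unfolding x_def by (rule bd[OF p nT(2)])
      have y: "norm y \<le> r + 1" using norm_triangle_ineq[of "y - x" x] IH a1 x by simp
      have "\<alpha> y - X p (real n * h + h) = (\<alpha> y - y - h *\<^sub>R V y) + ((y - x) + (h *\<^sub>R (V y - V x)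
          + - (X p (real n * h + h) - x - h *\<^sub>R V x)))" by (simp add: algebra_simps)
      also have "norm \<dots> \<le> e' / 2 * h + (a + (h * (L * a) + e' / 2 * h))"
      proof (intro norm_triangle_le add_mono \<alpha>(2) y IH)
        have "norm (V y - V x) \<le> L * norm (y - x)" using y x by (intro L) auto
        also have "\<dots> \<le> L * a" by (intro mult_left_mono IH L_ge)
        finally show "norm (h *\<^sub>R (V y - V x)) \<le> h * (L * a)" using h by simp
        show "norm (- (X p (real n * h + h) - x - h *\<^sub>R V x)) \<le> e' / 2 * h"
          unfolding norm_minus_cancel x_def using nT h by (intro loc) auto
      qed
      also have "\<dots> = (1 + L * h) * a + h * e'" by (simp add: algebra_simps)
      also have "\<dots> \<le> (1 + L * h) * a + h * e' * (1 + L * h) ^ Suc n"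
      proof -
        have "1 \<le> (1 + L * h) ^ Suc n" using L_ge h by (intro one_le_power) auto
        then have "h * e' * 1 \<le> h * e' * (1 + L * h) ^ Suc n" using h e' by (intro mult_left_mono) auto
        then show ?thesis by simp
      qed
      also have "\<dots> = real (Suc n) * h * e' * (1 + L * h) ^ Suc n" by (simp add: a_def algebra_simps)
      finally show ?case by (simp add: y_def algebra_simps)
    qed
    show ?thesis using err[of N] gr[of N] by (simp add: hN)
  qed
  then show ?thesis using automorphism_funpow[OF \<alpha>(1)] by blast
qed

section \<open>Tubes and their dilation by the flow\<close>

definition tube :: "(complex^'n \<Rightarrow> complex) \<Rightarrow> 'n \<Rightarrow> real \<Rightarrow> complex^'n \<Rightarrow> complex^'n" where
  "tube f j \<epsilon> x = vec_upd x j (inverse (f x + of_real \<epsilon> * x $ j))"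

text \<open>The solution curve through a tube point just changes the radius to
  \<open>\<epsilon>' * exp t\<close> and reaches \<open>\<epsilon>\<close> at time
  \<open>ln (\<epsilon> / \<epsilon>')\<close>. Nonvanishing at all intermediate radii keeps the
  curves defined and, over compact \<open>K\<close>, uniformly bounded.\<close>

lemma tube_dilation:
  fixes f :: "complex^'n \<Rightarrow> complex"
  assumes f: "holomorphic_fun_on f UNIV" and ij: "i \<noteq> j" and indep: "\<And>x a. f (vec_upd x j a) = f x"
    and \<epsilon>: "0 < \<epsilon>'" "\<epsilon>' \<le> \<epsilon>" and K: "compact K"
    and nz: "\<And>x \<delta>. x \<in> K \<Longrightarrow> \<epsilon>' \<le> \<delta> \<Longrightarrow> \<delta> \<le> \<epsilon> \<Longrightarrow> f x + of_real \<delta> * x $ j \<noteq> 0" and e: "e > 0"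
  shows "\<exists>\<alpha>. automorphism \<alpha> \<and> (\<forall>x\<in>K. norm (\<alpha> (tube f j \<epsilon>' x) - tube f j \<epsilon> x) \<le> e)"
proof -
  \<comment> \<open>An overshear field with constant coefficient \<open>-1\<close> plus the
    quadratic field; \<open>c\<close> is the only nonzero component.\<close>
  define V where "V = (\<lambda>x :: complex^'n. (- 1 * x $ j) *s axis j 1 + (f x * (x $ j)\<^sup>2) *s axis j 1)"
  define c where "c = (\<lambda>x :: complex^'n. - x $ j + f x * (x $ j)\<^sup>2)"
  have Vc: "V x = axis j (c x)" for x by (simp add: V_def c_def vec_eq_iff axis_def)
  define T where "T = ln (\<epsilon> / \<epsilon>')"
  have T: "T \<ge> 0" using \<epsilon> by (simp add: T_def)
  have exp_T: "\<epsilon>' * exp T = \<epsilon>" using \<epsilon> by (simp add: T_def)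
  define X where "X = (\<lambda>x t. tube f j (\<epsilon>' * exp t) x)"
  have rng: "\<epsilon>' \<le> \<epsilon>' * exp t" "\<epsilon>' * exp t \<le> \<epsilon>" if "t \<in> {0..T}" for t
    using that \<epsilon> by (auto simp: exp_T[symmetric])
  have nz': "f x + of_real (\<epsilon>' * exp t) * x $ j \<noteq> 0" if "x \<in> K" "t \<in> {0..T}" for x t
    using nz[OF that(1) rng[OF that(2)]] .
  have "continuous_on (K \<times> {0..T}) (\<lambda>q. f (fst q))"
    by (rule continuous_on_compose2[OF hol_fun_continuous_on[OF f]])
       (intro continuous_on_fst continuous_on_id, simp)
  then have "continuous_on (K \<times> {0..T}) (\<lambda>q. f (fst q) + of_real (\<epsilon>' * exp (snd q)) * fst q $ j)"
    by (intro continuous_intros)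
  then have "continuous_on (K \<times> {0..T}) (\<lambda>q. vec_upd (fst q) j (inverse (f (fst q) + of_real (\<epsilon>' * exp (snd q)) * fst q $ j)))"
    using nz' by (intro continuous_on_vec_upd continuous_on_inverse continuous_on_fst continuous_on_id) auto
  then have "continuous_on (K \<times> {0..T}) (\<lambda>q. X (fst q) (snd q))" by (simp add: X_def tube_def)
  then obtain r where "\<And>q. q \<in> K \<times> {0..T} \<Longrightarrow> norm (X (fst q) (snd q)) \<le> r"
    using compact_image_bound[OF compact_Times[OF K compact_Icc]] by blast
  then have r: "norm (X x t) \<le> r" if "x \<in> K" "t \<in> {0..T}" for x t using that by force
  have "\<exists>\<alpha>. automorphism \<alpha> \<and> (\<forall>x\<in>K. norm (\<alpha> (X x 0) - X x T) \<le> e)"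
  proof (rule euler_method[where V = V and r = r, OF _ _ T _ r e])
    show "aut_approximable V"
      unfolding V_def
    proof (intro aut_approximable_add)
      show "aut_approximable (\<lambda>x. (- 1 * x $ j) *s (axis j 1 :: complex^'n))"
        by (rule aut_approximable_overshear) (auto intro: hol_intros simp: axis_def)
      show "aut_approximable (\<lambda>x. (f x * (x $ j)\<^sup>2) *s axis j 1)"
        by (rule aut_approximable_quadratic[OF f ij indep])
    qed
    show "\<exists>L. \<forall>x y. norm x \<le> r \<longrightarrow> norm y \<le> r \<longrightarrow> norm (V x - V y) \<le> L * norm (x - y)" for r
    proof -
      have "holomorphic_fun_on c UNIV" unfolding c_def by (intro hol_intros f)
      then obtain L where "\<And>x y. norm x \<le> r \<Longrightarrow> norm y \<le> r \<Longrightarrow> norm (c x - c y) \<le> L * norm (x - y)"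
        using entire_lipschitz[of c r] by blast
      moreover have "V x - V y = axis j (c x - c y)" for x y by (simp add: Vc vec_eq_iff axis_def)
      ultimately show ?thesis by (auto simp: norm_axis_complex)
    qed
    fix x t assume x: "x \<in> K" and t: "t \<in> {0..T}"
    define s where "s = x $ j"
    define q where "q = of_real (\<epsilon>' * exp t) * s"
    have qn: "f x + q \<noteq> 0" using nz'[OF x t] by (simp add: q_def s_def)
    have "((\<lambda>t. f x + of_real (\<epsilon>' * exp t) * s) has_vector_derivative q) (at t)"
      unfolding q_def by (auto intro!: derivative_eq_intros simp: has_real_derivative_iff_has_vector_derivative[symmetric])
    moreover have "(inverse has_field_derivative - (inverse (f x + q) * inverse (f x + q))) (at (f x + q))"
      using DERIV_inverse'[OF DERIV_ident qn] by simp
    ultimately have dv: "((inverse \<circ> (\<lambda>t. f x + of_real (\<epsilon>' * exp t) * s)) has_vector_derivative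
        q * - (inverse (f x + q) * inverse (f x + q))) (at t)"
      by (intro field_vector_diff_chain_at) (simp_all add: q_def)
    have bl: "bounded_linear (axis j :: complex \<Rightarrow> complex^'n)"
      by (rule linear_conv_bounded_linear[THEN iffD1]) (auto intro!: linearI simp: vec_eq_iff axis_def)
    have "((\<lambda>t. axis j ((inverse \<circ> (\<lambda>t. f x + of_real (\<epsilon>' * exp t) * s)) t)) has_vector_derivative
        axis j (q * - (inverse (f x + q) * inverse (f x + q)))) (at t)"
      by (rule bounded_linear.has_vector_derivative[OF bl dv])
    then have "((\<lambda>t. vec_upd x j 0 + axis j ((inverse \<circ> (\<lambda>t. f x + of_real (\<epsilon>' * exp t) * s)) t)) has_vector_derivative
        0 + axis j (q * - (inverse (f x + q) * inverse (f x + q)))) (at t)"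
      by (rule has_vector_derivative_add[OF has_vector_derivative_const])
    moreover have "vec_upd x j 0 + axis j ((inverse \<circ> (\<lambda>t. f x + of_real (\<epsilon>' * exp t) * s)) t) = X x t" for t
      by (simp add: X_def tube_def s_def vec_upd_eq_add_axis[symmetric])
    \<comment> \<open>With \<open>w = 1/(f + q)\<close> one has \<open>f w = 1 - q w\<close>, hence
      \<open>f w^2 - w = - q w^2\<close>.\<close>
    moreover have "q * - (inverse (f x + q) * inverse (f x + q)) = c (X x t)"
    proof -
      have X_j: "X x t $ j = inverse (f x + q)" and fX: "f (X x t) = f x"
        by (simp_all add: X_def tube_def q_def s_def indep)
      have "f x * inverse (f x + q) = 1 - q * inverse (f x + q)"
        using qn by (simp add: eq_diff_eq distrib_right[symmetric])
      then have "f x * (inverse (f x + q))\<^sup>2 = (1 - q * inverse (f x + q)) * inverse (f x + q)"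
        by (simp add: power2_eq_square mult.assoc[symmetric])
      then show ?thesis by (simp only: c_def X_j fX) (simp add: algebra_simps)
    qed
    ultimately have "(X x has_vector_derivative V (X x t)) (at t)" by (simp add: Vc)
    then show "(X x has_vector_derivative V (X x t)) (at t within {0..T})" by (rule has_vector_derivative_at_within)
  qed
  then show ?thesis by (simp add: X_def exp_T)
qed

section \<open>Approximation on thin tubes\<close>

definition vec_snoc :: "complex^'m \<Rightarrow> complex \<Rightarrow> complex^('m + 1)" where
  "vec_snoc x t = (\<chi> k. case k of Inl l \<Rightarrow> x $ l | Inr _ \<Rightarrow> t)"

definition vec_init :: "complex^('m + 1) \<Rightarrow> complex^'m" where
  "vec_init y = (\<chi> l. y $ Inl l)"

lemma vec_snoc_nth [simp]: "vec_snoc x t $ Inl l = x $ l" "vec_snoc x t $ Inr u = t"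
  by (simp_all add: vec_snoc_def)

lemma vec_init_nth [simp]: "vec_init y $ l = y $ Inl l"
  by (simp add: vec_init_def)

lemma vec_init_snoc [simp]: "vec_init (vec_snoc x t) = x"
  by (simp add: vec_eq_iff)

lemma hol_map_vec_init: "holomorphic_map_on vec_init S"
  by (simp add: holomorphic_map_on_def hol_fun_nth)

lemma hol_map_vec_snoc:
  assumes "holomorphic_map_on g S" "holomorphic_fun_on h S"
  shows "holomorphic_map_on (\<lambda>x. vec_snoc (g x) (h x)) S"
  unfolding holomorphic_map_on_def
proof
  show "holomorphic_fun_on (\<lambda>x. vec_snoc (g x) (h x) $ k) S" for k
    using assms by (cases k) (simp_all add: holomorphic_map_on_def)
qed

lemma norm_vec_snoc_le: "norm (vec_snoc x t) \<le> norm x + norm t"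
proof -
  have "vec_snoc x t = vec_snoc x 0 + axis (Inr 1) t"
  proof (rule vec_eq_iff[THEN iffD2], rule allI)
    fix k :: "'a + 1"
    show "vec_snoc x t $ k = (vec_snoc x 0 + axis (Inr 1) t) $ k"
      by (cases k) (simp_all add: axis_def)
  qed
  moreover have "norm (vec_snoc x 0) = norm x"
    unfolding norm_vec_def L2_set_def
    by (simp add: UNIV_Plus_UNIV[symmetric] Plus_def sum.reindex image_iff)
  ultimately show ?thesis using norm_triangle_ineq[of "vec_snoc x 0" "axis (Inr 1) t"]
    by (simp add: norm_axis_complex)
qed

text \<open>The graph of \<open>1/f\<close> is the zero set of \<open>?p\<close> in one more
  variable. On the zeros of \<open>?F\<close> the value of \<open>?p\<close> is \<open>-1\<close>,
  so there are no common zeros, and over compact \<open>K\<close> the graph lies in a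
  polydisc.\<close>

lemma holomorphic_approximation_off_hypersurface:
  fixes f g :: "complex^'m \<Rightarrow> complex"
  assumes f: "holomorphic_fun_on f UNIV" and g: "holomorphic_fun_on g {x. f x \<noteq> 0}"
    and K: "compact K" "K \<subseteq> {x. f x \<noteq> 0}" and e: "e > 0"
  shows "\<exists>h. holomorphic_fun_on h UNIV \<and> (\<forall>x\<in>K. norm (g x - h (vec_snoc x (inverse (f x)))) < e)"
proof -
  let ?F = "\<lambda>y :: complex^('m + 1). f (vec_init y)"
  let ?p = "\<lambda>y :: complex^('m + 1). ?F y * y $ Inr 1 - 1"
  have F: "holomorphic_fun_on ?F UNIV"
    by (rule hol_fun_compose[OF hol_map_vec_init f]) simp
  have p: "holomorphic_fun_on ?p UNIV" by (intro hol_intros F)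
  have G: "holomorphic_fun_on (\<lambda>y. g (vec_init y)) {y :: complex^('m + 1). ?F y \<noteq> 0}"
    by (rule hol_fun_compose[OF hol_map_vec_init g]) auto
  have "continuous_on K (\<lambda>x. inverse (f x))"
    using K(2) by (intro continuous_on_inverse hol_fun_continuous_on hol_fun_subset[OF f]) auto
  then obtain R1 where R1: "R1 > 0" "\<And>x. x \<in> K \<Longrightarrow> norm (inverse (f x)) \<le> R1"
    using compact_image_bound[OF K(1)] by blast
  obtain R2 where "R2 > 0" "\<And>x. x \<in> K \<Longrightarrow> norm x \<le> R2" using compact_image_bound[OF K(1) continuous_on_id] by blast
  note R = R1 this
  have "\<exists>h. holomorphic_fun_on h UNIV \<and>
      (\<forall>y. (\<forall>k. norm (y $ k) \<le> max R1 R2) \<longrightarrow> ?p y = 0 \<longrightarrow> norm (g (vec_init y) - h y) < e)"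
    by (rule oka_approximation[OF F p G _ _ e]) (use R(1) in auto)
  then obtain h where h: "holomorphic_fun_on h UNIV"
    "\<And>y. (\<And>k. norm (y $ k) \<le> max R1 R2) \<Longrightarrow> ?p y = 0 \<Longrightarrow> norm (g (vec_init y) - h y) < e"
    by blast
  have "norm (g x - h (vec_snoc x (inverse (f x)))) < e" if x: "x \<in> K" for x
  proof -
    have "norm (vec_snoc x (inverse (f x)) $ k) \<le> max R1 R2" for k
    proof (cases k)
      case (Inl l)
      have "norm (x $ l) \<le> norm x" by (rule norm_component_le)
      then show ?thesis using Inl R(4)[OF x] by simp
    next
      case (Inr u)
      then show ?thesis using R(2)[OF x] by simp
    qed
    moreover have "?p (vec_snoc x (inverse (f x))) = 0" using x K(2) by auto
    ultimately have "norm (g (vec_init (vec_snoc x (inverse (f x)))) - h (vec_snoc x (inverse (f x)))) < e"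
      by (rule h(2))
    then show ?thesis by simp
  qed
  with h(1) show ?thesis by blast
qed

lemma geometric_sum_error:
  fixes q :: complex
  assumes q: "norm q \<le> 1 / 2"
  shows "norm ((\<Sum>n<N. q ^ n) - inverse (1 - q)) \<le> 2 * (1 / 2) ^ N"
proof -
  have q1: "q \<noteq> 1" using q by auto
  have "(\<Sum>n<N. q ^ n) - inverse (1 - q) = - (q ^ N * inverse (1 - q))"
    using q1 by (simp add: sum_gp_strict divide_inverse algebra_simps)
  then have "norm ((\<Sum>n<N. q ^ n) - inverse (1 - q)) = norm q ^ N * inverse (norm (1 - q))"
    by (simp add: norm_mult norm_power norm_inverse)
  also have "\<dots> \<le> (1 / 2) ^ N * 2"
  proof (intro mult_mono power_mono q)
    have "1 / 2 \<le> norm (1 - q)" using norm_triangle_ineq2[of 1 q] q by simp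
    then show "inverse (norm (1 - q)) \<le> 2" using le_imp_inverse_le[of "1 / 2" "norm (1 - q)"] by simp
  qed auto
  finally show ?thesis by simp
qed

text \<open>
  On a thin tube around the graph \<open>{f(x) w = 1}\<close> the functions \<open>1/w\<close> and \<open>1/f\<close> are geometric series in
  \<open>1 - f w\<close>, so everything pulled back from \<open>{f \<noteq> 0}\<close> can be approximated by entire functions.
\<close>

lemma tube_runge:
  fixes f G :: "complex^'m \<Rightarrow> complex"
  assumes f: "holomorphic_fun_on f UNIV" and indep: "\<And>x a. f (vec_upd x j a) = f x"
    and G: "holomorphic_fun_on G {x. f x \<noteq> 0}" and \<epsilon>: "\<epsilon> > 0"
    and K: "compact K" "\<And>x. x \<in> K \<Longrightarrow> f x \<noteq> 0" "\<And>x. x \<in> K \<Longrightarrow> f x + of_real \<epsilon> * x $ j \<noteq> 0"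
      "\<And>x. x \<in> K \<Longrightarrow> norm (1 - f x * inverse (f x + of_real \<epsilon> * x $ j)) \<le> 1 / 2"
    and e: "e > 0"
  shows "\<exists>h. holomorphic_fun_on h UNIV \<and> (\<forall>x\<in>K. norm (G x - h (tube f j \<epsilon> x)) < e)"
proof -
  have Kf: "K \<subseteq> {x. f x \<noteq> 0}" using K(2) by blast
  obtain H where H: "holomorphic_fun_on H UNIV" "\<And>x. x \<in> K \<Longrightarrow> norm (G x - H (vec_snoc x (inverse (f x)))) < e / 2"
    using holomorphic_approximation_off_hypersurface[OF f G K(1) Kf, of "e / 2"] e by auto
  have contf: "continuous_on K f" by (rule hol_fun_continuous_on[OF hol_fun_subset[OF f]]) simp
  have contj: "continuous_on K (\<lambda>x. inverse (f x + of_real \<epsilon> * x $ j))"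
    using K(3) contf by (intro continuous_on_inverse continuous_on_add continuous_on_mult continuous_on_const
        continuous_on_component continuous_on_id) auto
  have conti: "continuous_on K (\<lambda>x. inverse (f x))" using K(2) contf by (intro continuous_on_inverse) auto
  obtain B1 where B1: "B1 > 0" "\<And>x. x \<in> K \<Longrightarrow> norm (f x) \<le> B1" using compact_image_bound[OF K(1) contf] by blast
  obtain B2 where B2: "B2 > 0" "\<And>x. x \<in> K \<Longrightarrow> norm (inverse (f x + of_real \<epsilon> * x $ j)) \<le> B2"
    using compact_image_bound[OF K(1) contj] by blast
  obtain B3 where B3: "B3 > 0" "\<And>x. x \<in> K \<Longrightarrow> norm (inverse (f x)) \<le> B3" using compact_image_bound[OF K(1) conti] by blast
  obtain B4 where B4: "B4 > 0" "\<And>x. x \<in> K \<Longrightarrow> norm x \<le> B4" using compact_image_bound[OF K(1) continuous_on_id] by blast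
  obtain L where L: "\<And>x y. norm x \<le> B4 + B3 + 1 \<Longrightarrow> norm y \<le> B4 + B3 + 1 \<Longrightarrow> norm (H x - H y) \<le> L * norm (x - y)"
    using entire_lipschitz[OF H(1)] by blast
  \<comment> \<open>Converts an error of \<open>P\<close> into one of \<open>E\<close>: it is
    multiplied by \<open>f / \<epsilon>\<close> in coordinate \<open>j\<close> and by
    \<open>u $ j\<close> in the last coordinate.\<close>
  define B where "B = B1 / \<epsilon> + B2"
  have B: "B > 0" using B1(1) B2(1) \<epsilon> by (simp add: B_def add_pos_pos)
  have "(\<lambda>N. B * (2 * (1 / 2) ^ N)) \<longlonglongrightarrow> B * (2 * 0)"
    by (intro tendsto_intros LIMSEQ_power_zero) simp
  \<comment> \<open>An error below \<open>1\<close> keeps \<open>E\<close> in the ball on which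
    \<open>L\<close> is a Lipschitz constant of \<open>H\<close>.\<close>
  then have "eventually (\<lambda>N. B * (2 * (1 / 2) ^ N) < min 1 (e / (2 * (\<bar>L\<bar> + 1)))) sequentially"
    by (rule order_tendstoD) (use e in auto)
  then obtain N where N: "B * (2 * (1 / 2) ^ N) < min 1 (e / (2 * (\<bar>L\<bar> + 1)))"
    by (auto simp: eventually_sequentially)
  \<comment> \<open>With \<open>w = u $ j\<close>, \<open>P\<close> approximates
    \<open>1 / (f w)\<close> on the tube. So \<open>f P\<close> approximates
    \<open>1 / w = f + \<epsilon> s\<close> and \<open>w P\<close> approximates
    \<open>1 / f\<close>, and \<open>E\<close> recovers from \<open>u\<close> nearly the point
    \<open>(x, 1 / f x)\<close> of the graph.\<close>
  define P where "P = (\<lambda>u :: complex^'m. \<Sum>n<N. (1 - f u * u $ j) ^ n)"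
  define E where "E = (\<lambda>u :: complex^'m. vec_snoc (vec_upd u j ((f u * P u - f u) * of_real (1 / \<epsilon>))) (u $ j * P u))"
  have holP: "holomorphic_fun_on P UNIV" unfolding P_def by (intro hol_intros f)
  have "holomorphic_map_on E UNIV" unfolding E_def
    by (intro hol_map_vec_snoc hol_map_vec_upd hol_intros f holP)
  then have "holomorphic_fun_on (\<lambda>u. H (E u)) UNIV" by (rule hol_fun_compose[OF _ H(1)]) simp
  moreover have "norm (G x - H (E (tube f j \<epsilon> x))) < e" if x: "x \<in> K" for x
  proof -
    define d where "d = f x + of_real \<epsilon> * x $ j"
    define u where "u = tube f j \<epsilon> x"
    have d: "d \<noteq> 0" using K(3)[OF x] by (simp add: d_def)
    have uj: "u $ j = inverse d" and fu: "f u = f x" and upd: "vec_upd u j a = vec_upd x j a" for a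
      by (simp_all add: u_def tube_def d_def indep)
    have fx: "f x \<noteq> 0" using K(2)[OF x] .
    define \<Delta> where "\<Delta> = P u - d * inverse (f x)"
    have inv: "inverse (1 - (1 - f x * inverse d)) = d * inverse (f x)" using d by (simp add: field_simps)
    have \<Delta>: "norm \<Delta> \<le> 2 * (1 / 2) ^ N"
      using geometric_sum_error[OF K(4)[OF x, folded d_def], of N] unfolding inv by (simp add: \<Delta>_def P_def fu uj)
    have Pu: "P u = d * inverse (f x) + \<Delta>" by (simp add: \<Delta>_def)
    have xj: "x $ j = (d - f x) * of_real (1 / \<epsilon>)" using \<epsilon> by (simp add: d_def)
    have "f x * P u = d + f x * \<Delta>" unfolding Pu using fx by (simp add: distrib_left)
    then have "(f u * P u - f u) * of_real (1 / \<epsilon>) = x $ j + f x * of_real (1 / \<epsilon>) * \<Delta>"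
      unfolding xj fu by (simp only: algebra_simps)
    moreover have "u $ j * P u = inverse (f x) + inverse d * \<Delta>"
      unfolding Pu uj using d by (simp add: field_simps)
    ultimately have "E u = vec_snoc (vec_upd x j (x $ j + f x * of_real (1 / \<epsilon>) * \<Delta>)) (inverse (f x) + inverse d * \<Delta>)"
      by (simp add: E_def upd)
    then have Eu: "E u - vec_snoc x (inverse (f x)) = vec_snoc (axis j (f x * of_real (1 / \<epsilon>) * \<Delta>)) (inverse d * \<Delta>)"
      by (simp add: vec_eq_iff vec_snoc_def axis_def split: sum.split)
    have "norm (E u - vec_snoc x (inverse (f x))) \<le> norm (f x * of_real (1 / \<epsilon>) * \<Delta>) + norm (inverse d * \<Delta>)"
      unfolding Eu using norm_vec_snoc_le[of "axis j (f x * of_real (1 / \<epsilon>) * \<Delta>)" "inverse d * \<Delta>"]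
      by (simp add: norm_axis_complex)
    also have "\<dots> = (norm (f x) / \<epsilon> + norm (inverse d)) * norm \<Delta>"
      using \<epsilon> by (simp add: norm_mult norm_divide algebra_simps)
    also have "\<dots> \<le> B * (2 * (1 / 2) ^ N)"
      unfolding B_def using B1(2)[OF x] B2(2)[OF x, folded d_def] \<Delta> B1(1) B2(1) \<epsilon>
      by (intro mult_mono add_mono divide_right_mono) auto
    finally have 1: "norm (E u - vec_snoc x (inverse (f x))) < min 1 (e / (2 * (\<bar>L\<bar> + 1)))" using N by linarith
    have n1: "norm (vec_snoc x (inverse (f x))) \<le> B4 + B3"
      using norm_vec_snoc_le[of x "inverse (f x)"] B4(2)[OF x] B3(2)[OF x] by linarith
    have n2: "norm (E u) \<le> B4 + B3 + 1"
      using norm_triangle_ineq[of "E u - vec_snoc x (inverse (f x))" "vec_snoc x (inverse (f x))"] 1 n1 by simp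
    have "norm (H (E u) - H (vec_snoc x (inverse (f x)))) \<le> L * norm (E u - vec_snoc x (inverse (f x)))"
      using n1 n2 by (intro L) auto
    also have "\<dots> \<le> (\<bar>L\<bar> + 1) * norm (E u - vec_snoc x (inverse (f x)))" by (intro mult_right_mono) auto
    also have "\<dots> \<le> (\<bar>L\<bar> + 1) * (e / (2 * (\<bar>L\<bar> + 1)))" using 1 by (intro mult_left_mono) auto
    also have "\<dots> = e / 2" by (simp add: field_simps)
    finally have "norm (H (E u) - H (vec_snoc x (inverse (f x)))) \<le> e / 2" .
    then have "norm ((G x - H (vec_snoc x (inverse (f x)))) - (H (E u) - H (vec_snoc x (inverse (f x))))) < e"
      using norm_triangle_ineq4[of "G x - H (vec_snoc x (inverse (f x)))" "H (E u) - H (vec_snoc x (inverse (f x)))"]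
        H(2)[OF x] by linarith
    then show ?thesis by (simp add: u_def)
  qed
  ultimately show ?thesis by blast
qed

section \<open>The embedding\<close>

definition tube_inv :: "(complex^'m \<Rightarrow> complex) \<Rightarrow> 'm \<Rightarrow> real \<Rightarrow> complex^'m \<Rightarrow> complex^'m" where
  "tube_inv f j \<epsilon> w = vec_upd w j ((inverse (w $ j) - f w) * of_real (1 / \<epsilon>))"

lemma hol_map_tube:
  assumes "holomorphic_fun_on f UNIV"
  shows "holomorphic_map_on (tube f j \<epsilon>) {x. f x + of_real \<epsilon> * x $ j \<noteq> 0}"
  unfolding tube_def
  by (intro hol_map_vec_upd hol_intros hol_fun_subset[OF assms]) auto

lemma hol_map_tube_inv:
  assumes "holomorphic_fun_on f UNIV"
  shows "holomorphic_map_on (tube_inv f j \<epsilon>) {w. w $ j \<noteq> 0}"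
  unfolding tube_inv_def
  by (intro hol_map_vec_upd hol_intros hol_fun_subset[OF assms]) auto

text \<open>True at every \<open>x\<close>: with \<open>inverse 0 = 0\<close>,
  \<open>inverse\<close> is an involution everywhere, and \<open>f\<close> ignores the modified
  coordinate.\<close>

lemma tube_inv_tube:
  assumes "\<And>x a. f (vec_upd x j a) = f x" "\<epsilon> > 0"
  shows "tube_inv f j \<epsilon> (tube f j \<epsilon> x) = x"
  using assms(2) by (simp add: tube_inv_def tube_def assms(1))

lemma tube_tube_inv:
  assumes "\<And>x a. f (vec_upd x j a) = f x" "\<epsilon> > 0"
  shows "tube f j \<epsilon> (tube_inv f j \<epsilon> w) = w"
  using assms(2) by (simp add: tube_inv_def tube_def assms(1))

text \<open>Sublevel sets of the coordinates and of \<open>1/f\<close>. These functions are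
  holomorphic on \<open>{f \<noteq> 0}\<close>, so the same sets later witness that the image is
  Stein.\<close>

definition exhaustion :: "(complex^'m \<Rightarrow> complex) \<Rightarrow> nat \<Rightarrow> (complex^'m) set" where
  "exhaustion f k = {x. (\<forall>l. norm (x $ l) \<le> real k + 1) \<and> 1 / (real k + 1) \<le> norm (f x)}"

text \<open>On \<open>exhaustion f k\<close> this gives
  \<open>|\<epsilon> s| \<le> 1/(4 (k + 1)) \<le> |f|/4\<close>; the denominator keeps three
  quarters of \<open>|f|\<close>, and the ratio of the geometric series is at most
  \<open>1/3\<close>.\<close>

definition tube_radius :: "nat \<Rightarrow> real" where
  "tube_radius k = 1 / (4 * (real k + 1)\<^sup>2)"

lemma tube_radius_pos: "tube_radius k > 0"
  by (simp add: tube_radius_def)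

lemma tube_radius_Suc_le: "tube_radius (Suc k) \<le> tube_radius k"
  unfolding tube_radius_def by (intro divide_left_mono mult_left_mono power_mono) auto

lemma compact_exhaustion:
  assumes "holomorphic_fun_on f UNIV"
  shows "compact (exhaustion f k)"
proof -
  have "closed {x. 1 / (real k + 1) \<le> norm (f x)}"
    by (intro closed_Collect_le continuous_on_const continuous_on_norm hol_fun_continuous_on assms)
  moreover have "exhaustion f k = {x. \<forall>l. norm (x $ l) \<le> real k + 1} \<inter> {x. 1 / (real k + 1) \<le> norm (f x)}"
    by (auto simp: exhaustion_def)
  ultimately show ?thesis using compact_polydisc compact_Int_closed by metis
qed

lemma exhaustion_nonzero: "x \<in> exhaustion f k \<Longrightarrow> f x \<noteq> 0"
  unfolding exhaustion_def by (auto simp: field_simps)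

lemma exhaustion_mono:
  assumes "k \<le> m"
  shows "exhaustion f k \<subseteq> exhaustion f m"
proof
  fix x assume x: "x \<in> exhaustion f k"
  have "1 / (real m + 1) \<le> 1 / (real k + 1)" using assms by (intro divide_left_mono) auto
  moreover have "norm (x $ l) \<le> real m + 1" for l
  proof -
    have "norm (x $ l) \<le> real k + 1" using x by (simp add: exhaustion_def)
    then show ?thesis using assms by simp
  qed
  ultimately show "x \<in> exhaustion f m" using x by (auto simp: exhaustion_def)
qed

lemma compact_subset_exhaustion:
  assumes f: "holomorphic_fun_on f UNIV" and C: "compact C" "C \<subseteq> {x. f x \<noteq> 0}"
  shows "\<exists>k0. \<forall>k\<ge>k0. C \<subseteq> exhaustion f k"
proof -
  have "continuous_on C (\<lambda>x. inverse (f x))"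
    using C(2) by (intro continuous_on_inverse hol_fun_continuous_on hol_fun_subset[OF f]) auto
  then obtain R1 where R1: "R1 > 0" "\<And>x. x \<in> C \<Longrightarrow> norm (inverse (f x)) \<le> R1"
    using compact_image_bound[OF C(1)] by blast
  obtain R2 where "R2 > 0" "\<And>x. x \<in> C \<Longrightarrow> norm x \<le> R2" using compact_image_bound[OF C(1) continuous_on_id] by blast
  note R = R1 this
  obtain k0 :: nat where k0: "max R1 R2 \<le> real k0" using real_arch_simple by blast
  have "C \<subseteq> exhaustion f k0"
  proof
    fix x assume x: "x \<in> C"
    have "norm (x $ l) \<le> real k0 + 1" for l
      using norm_component_le[of x l] R(4)[OF x] k0 by simp
    moreover have "1 / (real k0 + 1) \<le> norm (f x)"
    proof -
      have "f x \<noteq> 0" using x C(2) by blast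
      moreover have "inverse (norm (f x)) \<le> real k0 + 1" using R(2)[OF x] k0 by (simp add: norm_inverse)
      ultimately show ?thesis by (simp add: field_simps)
    qed
    ultimately show "x \<in> exhaustion f k0" by (simp add: exhaustion_def)
  qed
  then show ?thesis using exhaustion_mono by blast
qed

text \<open>Covers all radii up to \<open>tube_radius k\<close>, since a dilation passes through
  every radius between two consecutive stages.\<close>

lemma tube_thin:
  assumes x: "x \<in> exhaustion f k" and \<delta>: "0 < \<delta>" "\<delta> \<le> tube_radius k"
  shows "f x + of_real \<delta> * x $ j \<noteq> 0"
    and "norm (1 - f x * inverse (f x + of_real \<delta> * x $ j)) \<le> 1 / 2"
proof -
  define q where "q = of_real \<delta> * x $ j"
  have xj: "norm (x $ j) \<le> real k + 1" and fx: "1 / (real k + 1) \<le> norm (f x)"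
    using x by (auto simp: exhaustion_def)
  have "norm q \<le> tube_radius k * (real k + 1)"
    using xj \<delta> by (simp add: q_def norm_mult mult_mono)
  also have "\<dots> = (1 / (real k + 1)) / 4" by (simp add: tube_radius_def power2_eq_square)
  also have "\<dots> \<le> norm (f x) / 4" using fx by (intro divide_right_mono) auto
  finally have q: "norm q \<le> norm (f x) / 4" .
  have fpos: "norm (f x) > 0" using exhaustion_nonzero[OF x] by simp
  have fq: "3 / 4 * norm (f x) \<le> norm (f x + q)"
    using norm_triangle_ineq2[of "f x" "- q"] q by simp
  then have nz: "f x + q \<noteq> 0" using fpos by auto
  then show "f x + of_real \<delta> * x $ j \<noteq> 0" by (simp add: q_def)
  have "1 - f x * inverse (f x + q) = q * inverse (f x + q)"
    using nz by (simp add: diff_eq_eq distrib_right[symmetric] add.commute)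
  then have "norm (1 - f x * inverse (f x + q)) = norm q / norm (f x + q)"
    by (simp add: norm_mult norm_inverse divide_inverse)
  also have "\<dots> \<le> 1 / 2"
  proof -
    have "norm q \<le> norm (f x + q) / 2" using q fq fpos by linarith
    then show ?thesis using nz by (simp add: pos_divide_le_eq)
  qed
  finally show "norm (1 - f x * inverse (f x + of_real \<delta> * x $ j)) \<le> 1 / 2" by (simp add: q_def)
qed

text \<open>
  The maps \<open>\<alpha>\<^sub>k \<circ> tube\<close> with radius \<open>\<epsilon>\<^sub>k\<close> converge because the automorphism \<open>\<alpha>\<^sub>k\<^sup>-\<^sup>1 \<circ> \<alpha>\<^sub>k\<^sub>+\<^sub>1\<close> nearly
  dilates the tube of radius \<open>\<epsilon>\<^sub>k\<^sub>+\<^sub>1\<close> to the one of radius \<open>\<epsilon>\<^sub>k\<close>. The errors are so small that pulling the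
  limit back by \<open>\<beta>\<^sub>k = \<alpha>\<^sub>k\<^sup>-\<^sup>1\<close> and the inverse of the tube parametrization nearly gives the identity.
\<close>

lemma exists_limit_map:
  fixes f :: "complex^'m \<Rightarrow> complex"
  assumes f: "holomorphic_fun_on f UNIV" and ij: "i \<noteq> j" and indep: "\<And>x a. f (vec_upd x j a) = f x"
  shows "\<exists>(\<Phi> :: complex^'m \<Rightarrow> complex^'m) \<beta>. holomorphic_map_on \<Phi> {x. f x \<noteq> 0} \<and> (\<forall>k. holomorphic_map_on (\<beta> k) UNIV) \<and>
    (\<forall>k. \<forall>x\<in>exhaustion f k. \<beta> k (\<Phi> x) $ j \<noteq> 0 \<and>
      norm (tube_inv f j (tube_radius k) (\<beta> k (\<Phi> x)) - x) < 1 / (real k + 1))"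
proof -
  let ?t = "\<lambda>k. tube f j (tube_radius k)" and ?ti = "\<lambda>k. tube_inv f j (tube_radius k)" and ?K = "exhaustion f"
  \<comment> \<open>The factor \<open>2\<close> anticipates that \<open>\<Phi> x\<close> lies within
    \<open>\<eta> + \<eta> / 2 + \<eta> / 4 + ... = 2 * \<eta>\<close> of the \<open>k\<close>-th
    approximation, so the conclusion will apply to \<open>y = \<Phi> x\<close>.\<close>
  define good where "good = (\<lambda>k (\<alpha> :: complex^'m \<Rightarrow> complex^'m) (\<beta> :: complex^'m \<Rightarrow> complex^'m) (\<eta> :: real). \<forall>x\<in>?K k. \<forall>y. norm (y - \<alpha> (?t k x)) \<le> 2 * \<eta> \<longrightarrow>
      \<beta> y $ j \<noteq> 0 \<and> norm (?ti k (\<beta> y) - x) < 1 / (real k + 1))"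
  define P where "P = (\<lambda>k (\<alpha>, \<beta>, \<eta>). holomorphic_map_on \<alpha> UNIV \<and> holomorphic_map_on \<beta> UNIV \<and>
      (\<forall>x. \<beta> (\<alpha> x) = x) \<and> (\<forall>x. \<alpha> (\<beta> x) = x) \<and> \<eta> > 0 \<and> good k \<alpha> \<beta> \<eta>)"
  define Q where "Q = (\<lambda>k (\<alpha> :: complex^'m \<Rightarrow> complex^'m, \<beta> :: complex^'m \<Rightarrow> complex^'m, \<eta> :: real) (\<alpha>' :: complex^'m \<Rightarrow> complex^'m, \<beta>' :: complex^'m \<Rightarrow> complex^'m, \<eta>' :: real).
      (\<forall>x\<in>?K k. norm (\<alpha>' (?t (Suc k) x) - \<alpha> (?t k x)) \<le> \<eta>) \<and> \<eta>' \<le> \<eta> / 2)"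
  have tK: "?K k \<subseteq> {x. f x + of_real (tube_radius k) * x $ j \<noteq> 0}" for k
    using tube_thin(1)[OF _ tube_radius_pos order_refl] by blast
  have cont_t: "continuous_on (?K k) (?t k)" for k
    by (rule hol_map_continuous_on[OF hol_map_subset[OF hol_map_tube[OF f] tK]])
  have comp_t: "compact (?t k ` ?K k)" for k
    by (intro compact_continuous_image cont_t compact_exhaustion f)
  have ex_good: "\<exists>\<eta>>0. good k \<alpha> \<beta> \<eta>"
    if hol: "holomorphic_map_on \<alpha> UNIV" "holomorphic_map_on \<beta> UNIV" and inv: "\<And>x. \<beta> (\<alpha> x) = x" for k \<alpha> \<beta>
  proof -
    let ?U = "{y. \<beta> y $ j \<noteq> 0}"
    have holU: "holomorphic_map_on (\<lambda>y. ?ti k (\<beta> y)) ?U"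
      by (rule hol_map_compose[OF hol_map_subset[OF hol(2)] hol_map_tube_inv[OF f]]) auto
    have openU: "open ?U"
      using hol(2) unfolding holomorphic_map_on_def by (intro open_nonzero) blast
    have "compact (\<alpha> ` ?t k ` ?K k)"
      by (intro compact_continuous_image comp_t continuous_on_subset[OF hol_map_continuous_on[OF hol(1)]]) simp
    \<comment> \<open>\<open>\<beta>\<close> undoes \<open>\<alpha>\<close>, and the
      \<open>j\<close>-th coordinate of a tube point is the inverse of a nonzero number.\<close>
    moreover have "\<alpha> ` ?t k ` ?K k \<subseteq> ?U"
      using tK[of k] by (auto simp: inv tube_def)
    ultimately obtain \<eta> where \<eta>: "\<eta> > 0" "\<And>c y. c \<in> \<alpha> ` ?t k ` ?K k \<Longrightarrow> norm (y - c) \<le> \<eta> \<Longrightarrow>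
        y \<in> ?U \<and> norm (?ti k (\<beta> y) - ?ti k (\<beta> c)) < 1 / (real k + 1)"
      using uniform_on_compact[OF openU hol_map_continuous_on[OF holU], of "\<alpha> ` ?t k ` ?K k" "1 / (real k + 1)"]
      by auto
    have "good k \<alpha> \<beta> (\<eta> / 2)"
      unfolding good_def
    proof (intro ballI allI impI)
      fix x y assume x: "x \<in> ?K k" and y: "norm (y - \<alpha> (?t k x)) \<le> 2 * (\<eta> / 2)"
      have "\<alpha> (?t k x) \<in> \<alpha> ` ?t k ` ?K k" using x by blast
      from \<eta>(2)[OF this, of y] y show "\<beta> y $ j \<noteq> 0 \<and> norm (?ti k (\<beta> y) - x) < 1 / (real k + 1)"
        by (simp add: inv tube_inv_tube[OF indep tube_radius_pos])
    qed
    then show ?thesis using \<eta>(1) by (intro exI[of _ "\<eta> / 2"]) simp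
  qed
  have good_mono: "good k \<alpha> \<beta> \<eta>'" if "good k \<alpha> \<beta> \<eta>" "\<eta>' \<le> \<eta>" for k \<alpha> \<beta> \<eta> \<eta>'
    using that unfolding good_def by (meson mult_left_mono order_trans zero_le_numeral)
  have "\<exists>s. P 0 s"
  proof -
    obtain \<eta> where "\<eta> > 0" "good 0 (\<lambda>x. x) (\<lambda>x. x) \<eta>"
      using ex_good[OF hol_map_id hol_map_id] by blast
    then show ?thesis
      by (intro exI[of _ "(\<lambda>x. x, \<lambda>x. x, \<eta>)"]) (simp add: P_def hol_map_id)
  qed
  moreover have "\<exists>s'. P (Suc k) s' \<and> Q k s s'" if "P k s" for k s
  proof -
    obtain \<alpha> \<beta> \<eta> where s: "s = (\<alpha>, \<beta>, \<eta>)" by (cases s)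
    have hol: "holomorphic_map_on \<alpha> UNIV" "holomorphic_map_on \<beta> UNIV"
      and inv: "\<And>x. \<beta> (\<alpha> x) = x" "\<And>x. \<alpha> (\<beta> x) = x" and \<eta>: "\<eta> > 0"
      using that unfolding s P_def by auto
    \<comment> \<open>\<open>\<delta>\<close> is the accuracy demanded of the dilation, so that its
      error stays below \<open>\<eta>\<close> after \<open>\<alpha>\<close> is applied.\<close>
    have "\<exists>\<delta>>0. \<forall>c\<in>?t k ` ?K k. \<forall>y. norm (y - c) \<le> \<delta> \<longrightarrow> y \<in> UNIV \<and> norm (\<alpha> y - \<alpha> c) < \<eta>"
      by (rule uniform_on_compact[OF open_UNIV hol_map_continuous_on[OF hol(1)] comp_t _ \<eta>]) simp
    then obtain \<delta> where \<delta>: "\<delta> > 0" "\<And>x y. x \<in> ?K k \<Longrightarrow> norm (y - ?t k x) \<le> \<delta> \<Longrightarrow> norm (\<alpha> y - \<alpha> (?t k x)) < \<eta>"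
      by blast
    have "\<exists>\<theta>. automorphism \<theta> \<and> (\<forall>x\<in>?K k. norm (\<theta> (?t (Suc k) x) - ?t k x) \<le> \<delta>)"
    proof (rule tube_dilation[OF f ij indep tube_radius_pos tube_radius_Suc_le compact_exhaustion[OF f] _ \<delta>(1)])
      fix x \<gamma> assume "x \<in> ?K k" "tube_radius (Suc k) \<le> \<gamma>" "\<gamma> \<le> tube_radius k"
      then show "f x + of_real \<gamma> * x $ j \<noteq> 0"
        using tube_thin(1)[of x f k \<gamma> j] tube_radius_pos[of "Suc k"] by linarith
    qed
    then obtain \<theta> where \<theta>: "automorphism \<theta>" "\<And>x. x \<in> ?K k \<Longrightarrow> norm (\<theta> (?t (Suc k) x) - ?t k x) \<le> \<delta>" by blast
    have "automorphism \<alpha>" unfolding automorphism_def using hol inv by blast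
    then have "automorphism (\<lambda>x. \<alpha> (\<theta> x))" using \<theta>(1) by (rule automorphism_compose)
    then obtain \<beta>' where \<beta>': "holomorphic_map_on (\<lambda>x. \<alpha> (\<theta> x)) UNIV" "holomorphic_map_on \<beta>' UNIV"
      "\<And>x. \<beta>' (\<alpha> (\<theta> x)) = x" "\<And>x. \<alpha> (\<theta> (\<beta>' x)) = x"
      unfolding automorphism_def by blast
    obtain \<eta>1 where \<eta>1: "\<eta>1 > 0" "good (Suc k) (\<lambda>x. \<alpha> (\<theta> x)) \<beta>' \<eta>1"
      using ex_good[OF \<beta>'(1,2,3)] by blast
    have "P (Suc k) (\<lambda>x. \<alpha> (\<theta> x), \<beta>', min \<eta>1 (\<eta> / 2))"
      using \<beta>' \<eta> \<eta>1(1) good_mono[OF \<eta>1(2), of "min \<eta>1 (\<eta> / 2)"] by (simp add: P_def)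
    moreover have "Q k s (\<lambda>x. \<alpha> (\<theta> x), \<beta>', min \<eta>1 (\<eta> / 2))"
      unfolding s Q_def using \<delta>(2) \<theta>(2) by (auto intro: less_imp_le)
    ultimately show ?thesis by blast
  qed
  ultimately obtain st where st: "\<And>k. P k (st k)" "\<And>k. Q k (st k) (st (Suc k))"
    using dependent_nat_choice[of P Q] by blast
  define \<alpha> where "\<alpha> = (\<lambda>k. fst (st k))"
  define \<beta> where "\<beta> = (\<lambda>k. fst (snd (st k)))"
  define \<eta> where "\<eta> = (\<lambda>k. snd (snd (st k)))"
  have stk: "st k = (\<alpha> k, \<beta> k, \<eta> k)" for k by (simp add: \<alpha>_def \<beta>_def \<eta>_def)
  have hol\<alpha>: "holomorphic_map_on (\<alpha> k) UNIV" and hol\<beta>: "holomorphic_map_on (\<beta> k) UNIV"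
    and \<eta>_pos: "\<eta> k > 0" and goodk: "good k (\<alpha> k) (\<beta> k) (\<eta> k)" for k
    using st(1)[of k] unfolding stk P_def by auto
  have step: "norm (\<alpha> (Suc k) (?t (Suc k) x) - \<alpha> k (?t k x)) \<le> \<eta> k" if "x \<in> ?K k" for k x
    using st(2)[of k] that unfolding stk Q_def by auto
  have half: "\<eta> (Suc k) \<le> \<eta> k / 2" for k using st(2)[of k] unfolding stk Q_def by auto
  have geo: "\<eta> (m + n) \<le> \<eta> m * (1 / 2) ^ n" for m n
  proof (induction n)
    case (Suc n)
    then show ?case using half[of "m + n"] by simp
  qed simp
  define \<Phi>k where "\<Phi>k = (\<lambda>k x. \<alpha> k (?t k x))"
  \<comment> \<open>The exact partial sum of the geometric series, not its limit, carries the
    induction.\<close>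
  have tele: "norm (\<Phi>k (m + n) x - \<Phi>k m x) \<le> 2 * \<eta> m * (1 - (1 / 2) ^ n)" if x: "x \<in> ?K m" for m n x
  proof (induction n)
    case (Suc n)
    have "x \<in> ?K (m + n)" using x exhaustion_mono[of m "m + n" f] by auto
    then have "norm (\<Phi>k (m + Suc n) x - \<Phi>k (m + n) x) \<le> \<eta> m * (1 / 2) ^ n"
      using step[of x "m + n"] geo[of m n] by (simp add: \<Phi>k_def)
    then have "norm (\<Phi>k (m + Suc n) x - \<Phi>k m x) \<le> \<eta> m * (1 / 2) ^ n + 2 * \<eta> m * (1 - (1 / 2) ^ n)"
      using norm_triangle_ineq[of "\<Phi>k (m + Suc n) x - \<Phi>k (m + n) x" "\<Phi>k (m + n) x - \<Phi>k m x"] Suc by simp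
    also have "\<dots> = 2 * \<eta> m * (1 - (1 / 2) ^ Suc n)" by (simp add: algebra_simps)
    finally show ?case .
  qed simp
  have tele': "norm (\<Phi>k (m + n) x - \<Phi>k m x) \<le> 2 * \<eta> m" if x: "x \<in> ?K m" for m n x
  proof -
    have "2 * \<eta> m * (1 - (1 / 2) ^ n) \<le> 2 * \<eta> m * 1" using \<eta>_pos[of m] by (intro mult_left_mono) auto
    then show ?thesis using tele[OF x, of n] by simp
  qed
  have \<eta>0: "\<eta> \<longlonglongrightarrow> 0"
  proof (rule tendsto_sandwich[of "\<lambda>_. 0" _ _ "\<lambda>n. \<eta> 0 * (1 / 2) ^ n"])
    show "\<forall>\<^sub>F n in sequentially. \<eta> n \<le> \<eta> 0 * (1 / 2) ^ n" using geo[of 0] by simp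
    have "(\<lambda>n. \<eta> 0 * (1 / 2) ^ n) \<longlonglongrightarrow> \<eta> 0 * 0" by (intro tendsto_intros LIMSEQ_power_zero) simp
    then show "(\<lambda>n. \<eta> 0 * (1 / 2) ^ n) \<longlonglongrightarrow> 0" by simp
  qed (use \<eta>_pos in \<open>auto simp: less_imp_le\<close>)
  have small: "\<exists>M. \<forall>n\<ge>M. 2 * \<eta> n < e" if "e > 0" for e
  proof -
    have "\<forall>\<^sub>F n in sequentially. \<eta> n < e / 2" using \<eta>0 that by (intro order_tendstoD) auto
    then obtain M where M: "\<forall>n\<ge>M. \<eta> n < e / 2" unfolding eventually_sequentially by blast
    have "2 * \<eta> n < e" if "n \<ge> M" for n using M[rule_format, OF that] by linarith
    then show ?thesis by blast
  qed
  define \<Phi> where "\<Phi> = (\<lambda>x. lim (\<lambda>n. \<Phi>k n x))"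
  have lim\<Phi>: "(\<lambda>n. \<Phi>k n x) \<longlonglongrightarrow> \<Phi> x" if x: "x \<in> ?K k" for x k
  proof -
    have "Cauchy (\<lambda>n. \<Phi>k n x)"
    proof (rule CauchyI)
      fix e :: real assume "e > 0"
      then obtain M where M: "\<And>n. n \<ge> M \<Longrightarrow> 2 * \<eta> n < e / 2" using small[of "e / 2"] by auto
      define N where "N = max M k"
      have xN: "x \<in> ?K N" using x exhaustion_mono[of k N f] by (auto simp: N_def)
      have close: "norm (\<Phi>k n x - \<Phi>k N x) < e / 2" if "n \<ge> N" for n
        using tele'[OF xN, of "n - N"] M[of N] that by (simp add: N_def)
      have "norm (\<Phi>k a x - \<Phi>k b x) < e" if "a \<ge> N" "b \<ge> N" for a b
        using norm_triangle_ineq4[of "\<Phi>k a x - \<Phi>k N x" "\<Phi>k b x - \<Phi>k N x"] close[OF that(1)] close[OF that(2)] by simp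
      then show "\<exists>N. \<forall>m\<ge>N. \<forall>n\<ge>N. norm (\<Phi>k m x - \<Phi>k n x) < e" by blast
    qed
    then have "convergent (\<lambda>n. \<Phi>k n x)" by (rule Cauchy_convergent)
    then show ?thesis unfolding \<Phi>_def by (simp add: convergent_LIMSEQ_iff)
  qed
  have err: "norm (\<Phi> x - \<Phi>k m x) \<le> 2 * \<eta> m" if x: "x \<in> ?K m" for x m
  proof (rule LIMSEQ_le_const2)
    show "(\<lambda>n. norm (\<Phi>k (m + n) x - \<Phi>k m x)) \<longlonglongrightarrow> norm (\<Phi> x - \<Phi>k m x)"
      using LIMSEQ_ignore_initial_segment[OF lim\<Phi>[OF x], of m]
      by (intro tendsto_norm tendsto_diff tendsto_const) (simp add: add.commute)
    show "\<exists>N. \<forall>n\<ge>N. norm (\<Phi>k (m + n) x - \<Phi>k m x) \<le> 2 * \<eta> m" using tele'[OF x] by blast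
  qed
  have "holomorphic_map_on \<Phi> {x. f x \<noteq> 0}"
    unfolding holomorphic_map_on_def
  proof
    fix l
    show "holomorphic_fun_on (\<lambda>x. \<Phi> x $ l) {x. f x \<noteq> 0}"
    proof (rule hol_fun_uniform_limit[where f = "\<lambda>n x. \<Phi>k n x $ l"])
      show "open {x. f x \<noteq> 0}" by (rule open_nonzero[OF f])
      fix x assume "x \<in> {x. f x \<noteq> 0}"
      then obtain r where r: "r > 0" "cball x r \<subseteq> {x. f x \<noteq> 0}"
        using open_nonzero[OF f] open_contains_cball by blast
      obtain k0 where k0: "\<And>k. k \<ge> k0 \<Longrightarrow> cball x r \<subseteq> ?K k"
        using compact_subset_exhaustion[OF f compact_cball r(2)] by blast
      have "uniform_limit (cball x r) (\<lambda>n x. \<Phi>k n x $ l) (\<lambda>x. \<Phi> x $ l) sequentially"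
        unfolding uniform_limit_iff
      proof (intro allI impI)
        fix e :: real assume "e > 0"
        then obtain M where M: "\<And>n. n \<ge> M \<Longrightarrow> 2 * \<eta> n < e" using small by blast
        have "dist (\<Phi>k n y $ l) (\<Phi> y $ l) < e" if "n \<ge> max M k0" "y \<in> cball x r" for n y
        proof -
          have "y \<in> ?K n" using k0[of n] that by auto
          then have "norm (\<Phi> y - \<Phi>k n y) < e" using err[of y n] M[of n] that(1) by simp
          then show ?thesis using norm_component_le[of "\<Phi> y - \<Phi>k n y" l]
            by (simp add: dist_norm norm_minus_commute)
        qed
        then show "\<forall>\<^sub>F n in sequentially. \<forall>y\<in>cball x r. dist (\<Phi>k n y $ l) (\<Phi> y $ l) < e"
          unfolding eventually_sequentially by blast
      qed
      moreover have "holomorphic_fun_on (\<lambda>x. \<Phi>k n x $ l) (cball x r)" if "n \<ge> k0" for n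
      proof -
        have "holomorphic_map_on (\<Phi>k n) {x. f x + of_real (tube_radius n) * x $ j \<noteq> 0}"
          unfolding \<Phi>k_def by (rule hol_map_compose[OF hol_map_tube[OF f] hol\<alpha>]) simp
        then have "holomorphic_map_on (\<Phi>k n) (cball x r)"
          by (rule hol_map_subset) (use k0[OF that] tK[of n] in blast)
        then show ?thesis by (simp add: holomorphic_map_on_def)
      qed
      ultimately show "\<exists>r>0. cball x r \<subseteq> {x. f x \<noteq> 0} \<and>
          uniform_limit (cball x r) (\<lambda>n x. \<Phi>k n x $ l) (\<lambda>x. \<Phi> x $ l) sequentially \<and>
          (\<forall>\<^sub>F n in sequentially. holomorphic_fun_on (\<lambda>x. \<Phi>k n x $ l) (cball x r))"
        using r unfolding eventually_sequentially by blast
    qed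
  qed
  moreover have "\<beta> k (\<Phi> x) $ j \<noteq> 0 \<and> norm (?ti k (\<beta> k (\<Phi> x)) - x) < 1 / (real k + 1)" if x: "x \<in> ?K k" for k x
    using goodk[of k] err[OF x] x unfolding good_def \<Phi>k_def by blast
  ultimately show ?thesis using hol\<beta> by (intro exI[of _ \<Phi>] exI[of _ \<beta>]) simp
qed

text \<open>Source and target have equal dimension, so invariance of domain applies. Holomorphy of
  the inverse comes later, from approximation instead of a Jacobian.\<close>

lemma open_holomorphic_image:
  fixes \<Phi> :: "complex^'m \<Rightarrow> complex^'m"
  assumes "holomorphic_map_on \<Phi> Y" "open Y" "inj_on \<Phi> Y"
  shows "open (\<Phi> ` Y)" and "continuous_on (\<Phi> ` Y) (inv_into Y \<Phi>)"
proof -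
  have cont: "continuous_on Y \<Phi>" by (rule hol_map_continuous_on[OF assms(1)])
  show "open (\<Phi> ` Y)" by (rule invariance_of_domain[OF cont assms(2,3)])
  show "continuous_on (\<Phi> ` Y) (inv_into Y \<Phi>)"
    using inv_into_f_f[OF assms(3)]
    by (intro continuous_on_inverse_open[OF _ cont] assms(2)) auto
qed

text \<open>A hull lies in a common sublevel set of the finitely many functions in \<open>G\<close>,
  hence in a compact part of \<open>\<Omega>\<close>, and there it is an intersection of closed
  sets.\<close>

lemma stein_of_exhaustion:
  fixes \<Omega> :: "(complex^'m) set"
  assumes \<Omega>: "open \<Omega>" and G: "finite G" "\<And>g. g \<in> G \<Longrightarrow> holomorphic_fun_on g \<Omega>"
    and ex: "\<And>R. \<exists>C. compact C \<and> C \<subseteq> \<Omega> \<and> {w \<in> \<Omega>. \<forall>g\<in>G. norm (g w) \<le> R} \<subseteq> C"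
  shows "stein \<Omega>"
  unfolding stein_def
proof (intro conjI allI impI ballI)
  show "open \<Omega>" by (rule \<Omega>)
  fix K :: "(complex^'m) set" assume K: "compact K \<and> K \<noteq> {} \<and> K \<subseteq> \<Omega>"
  have bdd: "bdd_above ((\<lambda>w. norm (g w)) ` K)" if "holomorphic_fun_on g \<Omega>" for g
  proof -
    have "continuous_on K (\<lambda>w. norm (g w))"
      using K by (intro continuous_on_norm hol_fun_continuous_on hol_fun_subset[OF that]) auto
    then have "compact ((\<lambda>w. norm (g w)) ` K)" using K compact_continuous_image by blast
    then show ?thesis by (intro bounded_imp_bdd_above compact_imp_bounded)
  qed
  define R where "R = (\<Sum>g\<in>G. \<bar>SUP w\<in>K. norm (g w)\<bar>)"
  obtain C where C: "compact C" "C \<subseteq> \<Omega>" "{w \<in> \<Omega>. \<forall>g\<in>G. norm (g w) \<le> R} \<subseteq> C" using ex by blast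
  have hullC: "holomorphic_hull \<Omega> K \<subseteq> C"
  proof
    fix w assume w: "w \<in> holomorphic_hull \<Omega> K"
    have "norm (g w) \<le> R" if g: "g \<in> G" for g
    proof -
      have "norm (g w) \<le> (SUP w\<in>K. norm (g w))" using w G(2)[OF g] by (simp add: holomorphic_hull_def)
      also have "\<dots> \<le> \<bar>SUP w\<in>K. norm (g w)\<bar>" by simp
      also have "\<dots> \<le> R" unfolding R_def by (rule member_le_sum[OF g _ G(1)]) simp
      finally show ?thesis .
    qed
    then show "w \<in> C" using C(3) w by (auto simp: holomorphic_hull_def)
  qed
  have "holomorphic_hull \<Omega> K = (\<Inter>g\<in>{g. holomorphic_fun_on g \<Omega>}. {w \<in> C. norm (g w) \<le> (SUP w\<in>K. norm (g w))})"
    (is "_ = ?I")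
  proof (intro equalityI subsetI)
    fix w assume "w \<in> holomorphic_hull \<Omega> K"
    then show "w \<in> ?I" using hullC by (auto simp: holomorphic_hull_def)
  next
    fix w assume w: "w \<in> ?I"
    \<comment> \<open>The constant \<open>0\<close> shows that the intersection has a nonempty index
      set.\<close>
    have "w \<in> C" using w hol_fun_const[of 0 \<Omega>] by blast
    then show "w \<in> holomorphic_hull \<Omega> K" using w C(2) by (auto simp: holomorphic_hull_def)
  qed
  moreover have "closed {w \<in> C. norm (g w) \<le> (SUP w\<in>K. norm (g w))}" if "holomorphic_fun_on g \<Omega>" for g
  proof -
    have "continuous_on C (\<lambda>w. norm (g w))"
      using C(2) by (intro continuous_on_norm hol_fun_continuous_on hol_fun_subset[OF that])
    then have "closed (C \<inter> (\<lambda>w. norm (g w)) -` {..(SUP w\<in>K. norm (g w))})"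
      by (rule continuous_closed_preimage) (use C(1) compact_imp_closed in auto)
    moreover have "C \<inter> (\<lambda>w. norm (g w)) -` {..(SUP w\<in>K. norm (g w))} = {w \<in> C. norm (g w) \<le> (SUP w\<in>K. norm (g w))}"
      by auto
    ultimately show ?thesis by simp
  qed
  ultimately have "closed (holomorphic_hull \<Omega> K)" by (auto intro: closed_INT)
  then have "compact (C \<inter> holomorphic_hull \<Omega> K)" using C(1) by (rule compact_Int_closed[rotated])
  then show "compact (holomorphic_hull \<Omega> K)" using hullC by (simp add: Int_absorb1)
next
  fix z w :: "complex^'m" assume "z \<noteq> w"
  then obtain l where "z $ l \<noteq> w $ l" by (auto simp: vec_eq_iff)
  then show "\<exists>g. holomorphic_fun_on g \<Omega> \<and> g z \<noteq> g w"
    by (intro exI[of _ "\<lambda>x. x $ l"]) (simp add: hol_fun_nth)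
next
  fix z :: "complex^'m"
  show "\<exists>(G :: complex^'m \<Rightarrow> complex^'m) D. holomorphic_map_on G \<Omega> \<and> (G has_derivative D) (at z) \<and> bij D"
    by (intro exI[of _ "\<lambda>x. x"]) (simp add: hol_map_id bij_id[unfolded id_def])
qed

text \<open>The maps \<open>?ti k\<close> after \<open>\<beta> k\<close> converge locally uniformly
  on the image to the inverse of \<open>\<Phi>\<close>. For the Runge property, entire functions
  that approximate on the \<open>k\<close>-th tube are composed with \<open>\<beta> k\<close>, which
  is itself entire.\<close>

lemma exists_stein_runge_embedding:
  fixes f :: "complex^'m \<Rightarrow> complex"
  assumes f: "holomorphic_fun_on f UNIV" and ij: "i \<noteq> j" and indep: "\<And>x a. f (vec_upd x j a) = f x"
  shows "\<exists>\<Phi>. stein_runge_embedding \<Phi> {x. f x \<noteq> 0} UNIV"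
proof -
  let ?Y = "{x. f x \<noteq> 0}" and ?ti = "\<lambda>k. tube_inv f j (tube_radius k)" and ?K = "exhaustion f"
  have openY: "open ?Y" by (rule open_nonzero[OF f])
  obtain \<Phi> :: "complex^'m \<Rightarrow> complex^'m" and \<beta> where \<Phi>: "holomorphic_map_on \<Phi> ?Y" and \<beta>: "\<And>k. holomorphic_map_on (\<beta> k) UNIV"
    and \<beta>nz: "\<And>k x. x \<in> ?K k \<Longrightarrow> \<beta> k (\<Phi> x) $ j \<noteq> 0"
    and near: "\<And>k x. x \<in> ?K k \<Longrightarrow> norm (?ti k (\<beta> k (\<Phi> x)) - x) < 1 / (real k + 1)"
    using exists_limit_map[OF f ij indep] by blast
  have small: "\<exists>k0. \<forall>k\<ge>k0. 1 / (real k + 1) < e" if "e > 0" for e :: real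
  proof -
    obtain k0 :: nat where k0: "1 / e < real k0" using reals_Archimedean2 by blast
    have "1 / (real k + 1) < e" if "k \<ge> k0" for k
    proof -
      have "1 / e < real k + 1" using k0 that by simp
      then show ?thesis using \<open>e > 0\<close> by (simp add: field_simps)
    qed
    then show ?thesis by blast
  qed
  have inj: "inj_on \<Phi> ?Y"
  proof (rule inj_onI)
    fix x y assume xy: "x \<in> ?Y" "y \<in> ?Y" "\<Phi> x = \<Phi> y"
    obtain k0 where k0: "\<And>k. k \<ge> k0 \<Longrightarrow> {x, y} \<subseteq> ?K k"
      using compact_subset_exhaustion[OF f, of "{x, y}"] xy by auto
    \<comment> \<open>One and the same point is close to both \<open>x\<close> and
      \<open>y\<close>.\<close>
    have "norm (x - y) \<le> e" if "e > 0" for e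
    proof -
      obtain k1 where k1: "\<And>k. k \<ge> k1 \<Longrightarrow> 1 / (real k + 1) < e / 2" using small[of "e / 2"] \<open>e > 0\<close> by auto
      define k where "k = max k0 k1"
      have "x \<in> ?K k" "y \<in> ?K k" "1 / (real k + 1) < e / 2" using k0[of k] k1[of k] by (auto simp: k_def)
      then have "norm (?ti k (\<beta> k (\<Phi> x)) - x) < e / 2" "norm (?ti k (\<beta> k (\<Phi> x)) - y) < e / 2"
        using near[of x k] near[of y k] xy(3) by auto
      then show ?thesis
        using norm_triangle_ineq4[of "?ti k (\<beta> k (\<Phi> x)) - y" "?ti k (\<beta> k (\<Phi> x)) - x"] by simp
    qed
    then have "norm (x - y) \<le> 0" by (rule field_le_epsilon) simp
    then show "x = y" by simp
  qed
  define \<Omega> where "\<Omega> = \<Phi> ` ?Y"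
  define g where "g = inv_into ?Y \<Phi>"
  have open\<Omega>: "open \<Omega>" and contg: "continuous_on \<Omega> g"
    unfolding \<Omega>_def g_def using open_holomorphic_image[OF \<Phi> openY inj] by auto
  have g\<Phi>: "g (\<Phi> x) = x" if "x \<in> ?Y" for x unfolding g_def using inv_into_f_f[OF inj that] .
  have \<Phi>g: "\<Phi> (g w) = w" "g w \<in> ?Y" if "w \<in> \<Omega>" for w using that g\<Phi> by (auto simp: \<Omega>_def)
  have holg: "holomorphic_map_on g \<Omega>"
    unfolding holomorphic_map_on_def
  proof
    fix l
    show "holomorphic_fun_on (\<lambda>w. g w $ l) \<Omega>"
    proof (rule hol_fun_uniform_limit[where f = "\<lambda>k w. ?ti k (\<beta> k w) $ l", OF open\<Omega>])
      fix w0 assume "w0 \<in> \<Omega>"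
      then obtain r where r: "r > 0" "cball w0 r \<subseteq> \<Omega>" using open\<Omega> open_contains_cball by blast
      have "compact (g ` cball w0 r)"
        by (intro compact_continuous_image continuous_on_subset[OF contg] r compact_cball)
      moreover have "g ` cball w0 r \<subseteq> ?Y" using \<Phi>g(2) r(2) by blast
      ultimately obtain k0 where k0: "\<And>k. k \<ge> k0 \<Longrightarrow> g ` cball w0 r \<subseteq> ?K k"
        using compact_subset_exhaustion[OF f] by blast
      have gK: "g w \<in> ?K k" "\<Phi> (g w) = w" if "k \<ge> k0" "w \<in> cball w0 r" for k w
        using k0[OF that(1)] that(2) \<Phi>g(1) r(2) by auto
      have "uniform_limit (cball w0 r) (\<lambda>k w. ?ti k (\<beta> k w) $ l) (\<lambda>w. g w $ l) sequentially"
        unfolding uniform_limit_iff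
      proof (intro allI impI)
        fix e :: real assume "e > 0"
        then obtain k1 where k1: "\<And>k. k \<ge> k1 \<Longrightarrow> 1 / (real k + 1) < e" using small by blast
        have "dist (?ti k (\<beta> k w) $ l) (g w $ l) < e" if k: "k \<ge> max k0 k1" and w: "w \<in> cball w0 r" for k w
        proof -
          have "norm (?ti k (\<beta> k w) - g w) < e"
            using near[of "g w" k] gK[of k w] k1[of k] k w by simp
          then show ?thesis
            using norm_component_le[of "?ti k (\<beta> k w) - g w" l] by (simp add: dist_norm)
        qed
        then show "\<forall>\<^sub>F k in sequentially. \<forall>w\<in>cball w0 r. dist (?ti k (\<beta> k w) $ l) (g w $ l) < e"
          unfolding eventually_sequentially by blast
      qed
      moreover have "holomorphic_fun_on (\<lambda>w. ?ti k (\<beta> k w) $ l) (cball w0 r)" if k: "k \<ge> k0" for k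
      proof -
        have "\<beta> k ` cball w0 r \<subseteq> {u. u $ j \<noteq> 0}"
        proof (rule image_subsetI)
          fix w assume "w \<in> cball w0 r"
          then show "\<beta> k w \<in> {u. u $ j \<noteq> 0}" using gK[OF k, of w] \<beta>nz[of "g w" k] by simp
        qed
        then have "holomorphic_map_on (\<lambda>w. ?ti k (\<beta> k w)) (cball w0 r)"
          by (intro hol_map_compose[OF hol_map_subset[OF \<beta>] hol_map_tube_inv[OF f]]) auto
        then show ?thesis by (simp add: holomorphic_map_on_def)
      qed
      ultimately show "\<exists>r>0. cball w0 r \<subseteq> \<Omega> \<and>
          uniform_limit (cball w0 r) (\<lambda>k w. ?ti k (\<beta> k w) $ l) (\<lambda>w. g w $ l) sequentially \<and>
          (\<forall>\<^sub>F k in sequentially. holomorphic_fun_on (\<lambda>w. ?ti k (\<beta> k w) $ l) (cball w0 r))"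
        using r unfolding eventually_sequentially by blast
    qed
  qed
  \<comment> \<open>The coordinates and \<open>1/f\<close>, transported by \<open>g\<close>, exhaust
    the image: if all are bounded by \<open>R \<le> k\<close>, then \<open>g w\<close> lies in
    \<open>?K k\<close>.\<close>
  have "stein \<Omega>"
  proof (rule stein_of_exhaustion[OF open\<Omega>, where G = "insert (\<lambda>w. inverse (f (g w))) (range (\<lambda>l w. g w $ l))"])
    have fg: "holomorphic_fun_on (\<lambda>w. f (g w)) \<Omega>"
      by (rule hol_fun_compose[OF holg f]) simp
    have "holomorphic_fun_on (\<lambda>w. inverse (f (g w))) \<Omega>"
      using \<Phi>g(2) by (intro hol_fun_inverse fg) auto
    then show "holomorphic_fun_on u \<Omega>" if "u \<in> insert (\<lambda>w. inverse (f (g w))) (range (\<lambda>l w. g w $ l))" for u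
      using that holg by (auto simp: holomorphic_map_on_def)
    fix R :: real
    obtain k :: nat where k: "R \<le> real k" using real_arch_simple by blast
    have KY: "?K k \<subseteq> ?Y" using exhaustion_nonzero by blast
    have "compact (\<Phi> ` ?K k)"
      by (intro compact_continuous_image compact_exhaustion f
          continuous_on_subset[OF hol_map_continuous_on[OF \<Phi>] KY])
    moreover have "\<Phi> ` ?K k \<subseteq> \<Omega>" using KY by (auto simp: \<Omega>_def)
    moreover have "w \<in> \<Phi> ` ?K k" if w: "w \<in> \<Omega>" "norm (inverse (f (g w))) \<le> R" "\<And>l. norm (g w $ l) \<le> R" for w
    proof -
      have "1 / (real k + 1) \<le> norm (f (g w))"
      proof -
        have "f (g w) \<noteq> 0" using \<Phi>g(2)[OF w(1)] by simp
        moreover have "inverse (norm (f (g w))) \<le> real k + 1" using w(2) k by (simp add: norm_inverse)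
        ultimately show ?thesis by (simp add: field_simps)
      qed
      moreover have "norm (g w $ l) \<le> real k + 1" for l using w(3)[of l] k by linarith
      ultimately have "g w \<in> ?K k" by (simp add: exhaustion_def)
      then show ?thesis using \<Phi>g(1)[OF w(1)] by (metis imageI)
    qed
    ultimately show "\<exists>C. compact C \<and> C \<subseteq> \<Omega> \<and>
        {w \<in> \<Omega>. \<forall>u\<in>insert (\<lambda>w. inverse (f (g w))) (range (\<lambda>l w. g w $ l)). norm (u w) \<le> R} \<subseteq> C"
      by (intro exI[of _ "\<Phi> ` ?K k"]) auto
  qed simp
  moreover have "runge_in \<Omega> UNIV"
    unfolding runge_in_def
  proof (intro allI impI)
    fix u :: "complex^'m \<Rightarrow> complex" and K :: "(complex^'m) set" and e :: real
    assume u: "holomorphic_fun_on u \<Omega>" and K: "compact K \<and> K \<subseteq> \<Omega> \<and> e > 0"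
    define G where "G = (\<lambda>x. u (\<Phi> x))"
    have G: "holomorphic_fun_on G ?Y"
      unfolding G_def by (rule hol_fun_compose[OF \<Phi> u]) (simp add: \<Omega>_def)
    have uG: "u w = G (g w)" if "w \<in> \<Omega>" for w using \<Phi>g(1)[OF that] by (simp add: G_def)
    define L where "L = g ` K"
    have L: "compact L" "L \<subseteq> ?Y"
      using K \<Phi>g(2) by (auto simp: L_def intro!: compact_continuous_image continuous_on_subset[OF contg])
    obtain \<delta> where \<delta>: "\<delta> > 0" "\<And>x y. x \<in> L \<Longrightarrow> norm (y - x) \<le> \<delta> \<Longrightarrow> y \<in> ?Y \<and> norm (G y - G x) < e / 2"
      using uniform_on_compact[OF openY hol_fun_continuous_on[OF G] L, of "e / 2"] K by auto
    \<comment> \<open>The approximate preimage of a point of \<open>K\<close> may leave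
      \<open>L\<close>, but not its closed \<open>\<delta>\<close>-neighbourhood; so
      \<open>G\<close> has to be approximated on the latter.\<close>
    define L' where "L' = {x + y | x y. x \<in> L \<and> y \<in> cball (0 :: complex^'m) \<delta>}"
    have L': "compact L'" unfolding L'_def using L(1) by (intro compact_sums) auto
    have in_L': "y \<in> L'" if "x \<in> L" "norm (y - x) \<le> \<delta>" for x y
      unfolding L'_def using that by (intro CollectI exI[of _ x] exI[of _ "y - x"]) simp
    have L'Y: "L' \<subseteq> ?Y"
    proof
      fix z assume "z \<in> L'"
      then obtain x y where "z = x + y" "x \<in> L" "norm y \<le> \<delta>" by (auto simp: L'_def)
      then show "z \<in> ?Y" using \<delta>(2)[of x z] by simp
    qed
    obtain k0 where k0: "\<And>k. k \<ge> k0 \<Longrightarrow> L' \<subseteq> ?K k" using compact_subset_exhaustion[OF f L' L'Y] by blast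
    obtain k1 where k1: "\<And>k. k \<ge> k1 \<Longrightarrow> 1 / (real k + 1) < \<delta>" using small[OF \<delta>(1)] by blast
    define k where "k = max k0 k1"
    have L'K: "L' \<subseteq> ?K k" and kr: "1 / (real k + 1) < \<delta>" using k0[of k] k1[of k] by (auto simp: k_def)
    have "\<exists>h. holomorphic_fun_on h UNIV \<and> (\<forall>x\<in>L'. norm (G x - h (tube f j (tube_radius k) x)) < e / 2)"
    proof (rule tube_runge[OF f indep G tube_radius_pos L'])
      fix x assume "x \<in> L'"
      then have x: "x \<in> ?K k" using L'K by blast
      show "f x \<noteq> 0" by (rule exhaustion_nonzero[OF x])
      show "f x + of_real (tube_radius k) * x $ j \<noteq> 0"
        "norm (1 - f x * inverse (f x + of_real (tube_radius k) * x $ j)) \<le> 1 / 2"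
        using tube_thin[OF x tube_radius_pos order_refl] by auto
    qed (use K in auto)
    then obtain h where h: "holomorphic_fun_on h UNIV"
      "\<And>x. x \<in> L' \<Longrightarrow> norm (G x - h (tube f j (tube_radius k) x)) < e / 2" by blast
    have "norm (u w - h (\<beta> k w)) < e" if w: "w \<in> K" for w
    proof -
      have w\<Omega>: "w \<in> \<Omega>" using w K by blast
      define x where "x = g w"
      have x: "x \<in> L" "\<Phi> x = w" using w \<Phi>g(1)[OF w\<Omega>] by (auto simp: L_def x_def)
      have xL': "x \<in> L'" using in_L'[OF x(1), of x] \<delta>(1) by simp
      \<comment> \<open>\<open>\<beta> k w\<close> is exactly the tube point of \<open>x'\<close>.
        Hence \<open>h\<close> is compared with \<open>G\<close> at \<open>x'\<close>, and uniform
        continuity of \<open>G\<close> leads back to \<open>x\<close>.\<close>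
      define x' where "x' = ?ti k (\<beta> k w)"
      have n: "norm (x' - x) < 1 / (real k + 1)" using near[of x k] xL' L'K x(2) by (auto simp: x'_def)
      then have x'L: "x' \<in> L'" using in_L'[OF x(1), of x'] kr by simp
      have "norm (G x - G x') < e / 2" using \<delta>(2)[OF x(1), of x'] n kr by (simp add: norm_minus_commute)
      moreover have "norm (G x' - h (\<beta> k w)) < e / 2"
        using h(2)[OF x'L] by (simp add: x'_def tube_tube_inv[OF indep tube_radius_pos])
      ultimately have "norm (G x - h (\<beta> k w)) < e"
        using norm_triangle_ineq[of "G x - G x'" "G x' - h (\<beta> k w)"] by simp
      then show ?thesis using uG[OF w\<Omega>] by (simp add: x_def)
    qed
    moreover have "holomorphic_fun_on (\<lambda>w. h (\<beta> k w)) UNIV"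
      by (rule hol_fun_compose[OF \<beta> h(1)]) simp
    ultimately show "\<exists>h. holomorphic_fun_on h UNIV \<and> (\<forall>z\<in>K. norm (u z - h z) < e)" by blast
  qed
  ultimately have "stein_runge_embedding \<Phi> ?Y UNIV"
    unfolding stein_runge_embedding_def \<Omega>_def using openY \<Phi> inj by simp
  then show ?thesis by blast
qed

theorem theorem1p4:
  fixes f :: "complex^'n \<Rightarrow> complex" and A :: "(complex^'n) set"
  assumes "holomorphic_fun_on f UNIV"
    and "A = {z. f z = 0}"
  shows "\<exists>\<Phi> :: complex^('n + 1) \<Rightarrow> complex^('n + 1).
           stein_runge_embedding \<Phi> (product_in_succ (UNIV - A) UNIV) UNIV"
proof -
  have "holomorphic_fun_on (\<lambda>x :: complex^('n + 1). f (vec_init x)) UNIV"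
    by (rule hol_fun_compose[OF hol_map_vec_init assms(1)]) simp
  moreover have "vec_init (vec_upd x (Inr 1) a) = vec_init x" for x :: "complex^('n + 1)" and a
    by (simp add: vec_eq_iff)
  moreover have "product_in_succ (UNIV - A) UNIV = {x :: complex^('n + 1). f (vec_init x) \<noteq> 0}"
    by (auto simp: product_in_succ_def vec_init_def assms(2))
  \<comment> \<open>The quadratic field needs a second coordinate \<open>i \<noteq> j\<close>; since
    index types are nonempty, any one of the first \<open>n\<close> coordinates can be
    taken.\<close>
  moreover have "(Inl undefined :: 'n + 1) \<noteq> Inr 1" by simp
  ultimately show ?thesis
    using exists_stein_runge_embedding[of "\<lambda>x. f (vec_init x)" "Inl undefined" "Inr 1"] by simp
qed

end
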